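(* For every $d\in\mathbb{N}$ there are constants $C(d)>0$ and $D=D(d)\ge1$, depending only on $d$, and for every $\mathbf{r}=(r_1,\dots,r_d)$ with $r_j>0$, $j=1,\dots,d$, there is a constant $C(\mathbf{r},d)>0$, depending only on $\mathbf{r}$ and $d$, such that the following holds. For every $n\in\mathbb{N}$ there exists a set $\xi=\{\xi^j\}_{j=1}^m\subset\mathbb{T}^d$ (not depending on $\mathbf{r}$), with $m\le C(d)2^n$, which provides $L_\infty$-universal discretization with constant $D$ for the collection $H(n,d)$, i.e. $$\|f\|_\infty\le D\max_{1\le j\le m}|f(\xi^j)|\qquad\text{for every } f\in\bigcup_{\mathbf{s}\in\mathbb{Z}^d_+:\,\|\mathbf{s}\|_1=n}\mathcal{T}(R(\mathbf{s})),$$ and such that for every $\mathbf{r}=(r_1,\dots,r_d)$ with $r_j>0$, $j=1,\dots,d$, and any function $f\in\mathcal{C}(\mathbb{T}^d)$ which belongs to either $W^{\mathbf{r}}_{\infty,\alpha}$ (for some $\alpha\in\mathbb{R}^d$) or $H^{\mathbf{r}}_\infty$, we have $$\|f-\ell(\xi,H(n,d))(f)\|_\infty\le C(\mathbf{r},d)\,2^{-g(\mathbf{r})n}.$$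
   Context: $\mathbb{T}^d=[0,2\pi]^d$ with normalized Lebesgue measure; $\mathcal{C}(\mathbb{T}^d)$ is the space of continuous functions with $\|f\|_\infty=\max_{\mathbf{x}\in\mathbb{T}^d}|f(\mathbf{x})|$; functions in the classes below are $2\pi$-periodic in each variable. $g(\mathbf{r}):=\left(\sum_{j=1}^d 1/r_j\right)^{-1}$. For a finite $Q\subset\mathbb{Z}^d$, $\mathcal{T}(Q)$ is the space of trigonometric polynomials $\sum_{\mathbf{k}\in Q}c_{\mathbf{k}}e^{i(\mathbf{k},\mathbf{x})}$, $c_{\mathbf{k}}\in\mathbb{C}$. For $\mathbf{s}\in\mathbb{Z}_+^d$ (nonnegative integer vectors), $R(\mathbf{s}):=\{\mathbf{k}\in\mathbb{Z}^d:|k_j|<2^{s_j},\ j=1,\dots,d\}$, $\|\mathbf{s}\|_1=s_1+\dots+s_d$, and $H(n,d):=\{\mathcal{T}(R(\mathbf{s})):\mathbf{s}\in\mathbb{Z}_+^d,\ \|\mathbf{s}\|_1=n\}$. For $\xi=\{\xi^j\}_{j=1}^m\subset\mathbb{T}^d$ and a finite-dimensional subspace $Y\subset\mathcal{C}(\mathbb{T}^d)$, $\ell(\xi,Y)(f):=\arg\min_{u\in Y}\max_{1\le j\le m}|f(\xi^j)-u(\xi^j)|$ (any minimizer, fixed for each $f$ and $Y$). For a finite collection $\mathcal{X}$ of such subspaces, $\ell(\xi,\mathcal{X})(f):=\ell(\xi,Y^* )(f)$, where $Y^*\in\mathcal{X}$ is any subspace minimizing $\|f-\ell(\xi,Y)(f)\|_\infty$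 over $Y\in\mathcal{X}$. Sobolev class: for $r>0$, $\alpha\in\mathbb{R}$ let $F_r(x,\alpha):=1+2\sum_{k=1}^\infty k^{-r}\cos(kx-\alpha\pi/2)$. For $\mathbf{r}$ with $r_j>0$ and $\alpha=(\alpha_1,\dots,\alpha_d)\in\mathbb{R}^d$, $W^{\mathbf{r}}_{\infty,\alpha}$ is the set of functions $f$ that for each $1\le j\le d$ have a representation $$f(\mathbf{x})=(2\pi)^{-1}\int_0^{2\pi}\varphi_j(x_1,\dots,x_{j-1},y,x_{j+1},\dots,x_d)F_{r_j}(x_j-y,\alpha_j)\,dy,\qquad\|\varphi_j\|_\infty\le1.$$ Nikol'skii class: $H^{\mathbf{r}}_\infty$ is the set of $f\in L_\infty$ such that, with $l_j:=[r_j]+1$, $\|f\|_\infty\le1$ and $\|\Delta_h^{l_j,j}f\|_\infty\le|h|^{r_j}$ for all $h$ and all $j=1,\dots,d$, where $\Delta_h^{l,j}$ is the $l$-th difference with step $h$ in the variable $x_j$. *)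

theory Defs
  imports "HOL-Analysis.Analysis"
begin

text \<open>
  The dimension is \<open>CARD('d)\<close> for a finite index type \<open>'d\<close>. Functions on the torus are complex-valued
  functions on \<open>real^'d\<close>; periodicity is part of the definition of the function classes.
\<close>

definition torus :: "(real^'d) set" where
  "torus = cbox 0 (\<chi> j. 2 * pi)"

definition periodic :: "(real^'d \<Rightarrow> complex) \<Rightarrow> bool" where
  "periodic f \<longleftrightarrow> (\<forall>j x. f (x + axis j (2 * pi)) = f x)"

definition sup_norm :: "(real^'d \<Rightarrow> complex) \<Rightarrow> real" where
  "sup_norm f = (SUP x\<in>torus. norm (f x))"

definition discr_norm :: "(real^'d) set \<Rightarrow> (real^'d \<Rightarrow> complex) \<Rightarrow> real" where
  "discr_norm \<xi> f = Max ((\<lambda>x. norm (f x)) ` \<xi>)"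

definition g :: "real^'d \<Rightarrow> real" where
  "g r = inverse (\<Sum>j\<in>UNIV. 1 / r $ j)"

subsection \<open>Trigonometric polynomials\<close>

definition trig_char :: "int^'d \<Rightarrow> real^'d \<Rightarrow> complex" where
  "trig_char k x = exp (\<i> * complex_of_real (\<Sum>j\<in>UNIV. real_of_int (k $ j) * x $ j))"

definition trig_polys :: "(int^'d) set \<Rightarrow> (real^'d \<Rightarrow> complex) set" where
  "trig_polys Q = {u. \<exists>c :: int^'d \<Rightarrow> complex. u = (\<lambda>x. \<Sum>k\<in>Q. c k * trig_char k x)}"

definition freq_box :: "nat^'d \<Rightarrow> (int^'d) set" where
  "freq_box s = {k. \<forall>j. \<bar>k $ j\<bar> < 2 ^ (s $ j)}"

definition H_coll :: "nat \<Rightarrow> (real^'d \<Rightarrow> complex) set set" where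
  "H_coll n = {trig_polys (freq_box s) | s :: nat^'d. (\<Sum>j\<in>UNIV. s $ j) = n}"

definition universal_discretization ::
    "(real^'d) set \<Rightarrow> real \<Rightarrow> (real^'d \<Rightarrow> complex) set set \<Rightarrow> bool" where
  "universal_discretization \<xi> D X \<longleftrightarrow> (\<forall>f\<in>\<Union>X. sup_norm f \<le> D * discr_norm \<xi> f)"

subsection \<open>The recovery operator\<close>

text \<open>
  The minimizers need not be unique, so the operators are described by predicates: \<open>L\<close> is a choice
  of a minimizer \<open>\<ell>(\<xi>,Y)(f)\<close> for each \<open>Y\<close> and \<open>f\<close>, and \<open>ell\<close> is an operator \<open>\<ell>(\<xi>,X)\<close> obtained from
  some such choice, followed by a choice of an optimal subspace for each \<open>f\<close>.
\<close>

definition is_ell_choice ::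
    "(real^'d) set \<Rightarrow> (real^'d \<Rightarrow> complex) set set \<Rightarrow>
     ((real^'d \<Rightarrow> complex) set \<Rightarrow> (real^'d \<Rightarrow> complex) \<Rightarrow> (real^'d \<Rightarrow> complex)) \<Rightarrow> bool" where
  "is_ell_choice \<xi> X L \<longleftrightarrow>
     (\<forall>Y\<in>X. \<forall>f. continuous_on torus f \<longrightarrow>
        is_arg_min (\<lambda>u. discr_norm \<xi> (\<lambda>x. f x - u x)) (\<lambda>u. u \<in> Y) (L Y f))"

definition is_ell ::
    "(real^'d) set \<Rightarrow> (real^'d \<Rightarrow> complex) set set \<Rightarrow>
     ((real^'d \<Rightarrow> complex) \<Rightarrow> (real^'d \<Rightarrow> complex)) \<Rightarrow> bool" where
  "is_ell \<xi> X ell \<longleftrightarrow>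
     (\<exists>L. is_ell_choice \<xi> X L \<and>
       (\<forall>f. continuous_on torus f \<longrightarrow>
          (\<exists>Y. is_arg_min (\<lambda>Y. sup_norm (\<lambda>x. f x - L Y f x)) (\<lambda>Y. Y \<in> X) Y \<and> ell f = L Y f)))"

text \<open>Such operators exist, so that a statement about all of them is not vacuous.\<close>

lemma discr_norm_le_iff:
  assumes "finite \<xi>" "\<xi> \<noteq> {}"
  shows "discr_norm \<xi> f \<le> c \<longleftrightarrow> (\<forall>x\<in>\<xi>. norm (f x) \<le> c)"
  using assms by (simp add: discr_norm_def)

lemma norm_le_discr_norm:
  assumes "finite \<xi>" "x \<in> \<xi>"
  shows "norm (f x) \<le> discr_norm \<xi> f"
  using assms by (simp add: discr_norm_def)

lemma discr_norm_triangle_scaled: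
  assumes "finite \<xi>" "\<xi> \<noteq> {}"
  shows "discr_norm \<xi> (\<lambda>x. f x + c * h x) \<le> discr_norm \<xi> f + norm c * discr_norm \<xi> h"
  unfolding discr_norm_le_iff[OF assms]
proof
  fix x assume x: "x \<in> \<xi>"
  have "norm (f x + c * h x) \<le> norm (f x) + norm c * norm (h x)"
    by (metis norm_mult norm_triangle_ineq)
  also have "\<dots> \<le> discr_norm \<xi> f + norm c * discr_norm \<xi> h"
    using x assms by (intro add_mono mult_left_mono norm_le_discr_norm) auto
  finally show "norm (f x + c * h x) \<le> discr_norm \<xi> f + norm c * discr_norm \<xi> h" .
qed

lemma discr_norm_nonneg:
  assumes "finite \<xi>" "\<xi> \<noteq> {}"
  shows "0 \<le> discr_norm \<xi> f"
proof -
  obtain x where "x \<in> \<xi>" using assms by auto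
  then show ?thesis using norm_le_discr_norm[OF assms(1), of x f] norm_ge_zero order_trans by blast
qed

lemma trig_polys_add_scaled:
  assumes "u \<in> trig_polys Q" "v \<in> trig_polys Q"
  shows "(\<lambda>x. u x + a * v x) \<in> trig_polys Q"
proof -
  obtain c d where "u = (\<lambda>x. \<Sum>k\<in>Q. c k * trig_char k x)" "v = (\<lambda>x. \<Sum>k\<in>Q. d k * trig_char k x)"
    using assms by (auto simp: trig_polys_def)
  then have "(\<lambda>x. u x + a * v x) = (\<lambda>x. \<Sum>k\<in>Q. (c k + a * d k) * trig_char k x)"
    by (simp add: sum.distrib sum_distrib_left algebra_simps)
  then show ?thesis unfolding trig_polys_def by (auto intro!: exI[of _ "\<lambda>k. c k + a * d k"])
qed

lemma zero_in_trig_polys: "(\<lambda>x. 0) \<in> trig_polys Q"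
  unfolding trig_polys_def by (auto intro!: exI[of _ "\<lambda>_. 0"])

lemma trig_polys_insert:
  assumes "finite Q" "k \<notin> Q"
  shows "v \<in> trig_polys (insert k Q) \<longleftrightarrow>
    (\<exists>w\<in>trig_polys Q. \<exists>a. v = (\<lambda>x. w x + a * trig_char k x))"
proof
  assume "v \<in> trig_polys (insert k Q)"
  then obtain c where "v = (\<lambda>x. \<Sum>k\<in>insert k Q. c k * trig_char k x)" by (auto simp: trig_polys_def)
  then have "v = (\<lambda>x. (\<Sum>k\<in>Q. c k * trig_char k x) + c k * trig_char k x)"
    using assms by (simp add: add.commute)
  then show "\<exists>w\<in>trig_polys Q. \<exists>a. v = (\<lambda>x. w x + a * trig_char k x)"
    by (intro bexI[of _ "\<lambda>x. \<Sum>k\<in>Q. c k * trig_char k x"] exI[of _ "c k"])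
       (auto simp: trig_polys_def)
next
  assume "\<exists>w\<in>trig_polys Q. \<exists>a. v = (\<lambda>x. w x + a * trig_char k x)"
  then obtain c a where v: "v = (\<lambda>x. (\<Sum>k\<in>Q. c k * trig_char k x) + a * trig_char k x)"
    by (auto simp: trig_polys_def)
  have "(\<Sum>i\<in>Q. (c(k := a)) i * trig_char i x) = (\<Sum>i\<in>Q. c i * trig_char i x)" for x
    using assms by (intro sum.cong) auto
  then have "v = (\<lambda>x. \<Sum>i\<in>insert k Q. (c(k := a)) i * trig_char i x)"
    unfolding v using assms by (simp add: add.commute)
  then show "v \<in> trig_polys (insert k Q)" unfolding trig_polys_def by blast
qed

lemma discr_minimizer_exists:
  assumes \<xi>: "finite \<xi>" "\<xi> \<noteq> {}" and "finite Q"
  shows "\<exists>u\<in>trig_polys Q. \<forall>v\<in>trig_polys Q.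
    discr_norm \<xi> (\<lambda>x. f x - u x) \<le> discr_norm \<xi> (\<lambda>x. f x - v x)"
  using \<open>finite Q\<close>
proof (induction Q arbitrary: f)
  case empty
  show ?case by (auto simp: trig_polys_def)
next
  case (insert k Q)
  let ?N = "discr_norm \<xi>" and ?V = "trig_polys Q"
  define e where "e = trig_char k"
  have "\<forall>h. \<exists>u. u \<in> ?V \<and> (\<forall>v\<in>?V. ?N (\<lambda>x. h x - u x) \<le> ?N (\<lambda>x. h x - v x))"
    using insert.IH by blast
  then obtain B where BV: "\<And>h. B h \<in> ?V"
    and Bmin: "\<And>h v. v \<in> ?V \<Longrightarrow> ?N (\<lambda>x. h x - B h x) \<le> ?N (\<lambda>x. h x - v x)"
    by metis
  define \<delta> where "\<delta> = ?N (\<lambda>x. e x - B e x)"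
  define res where "res a = (\<lambda>x. f x - a * e x)" for a
  define \<phi> where "\<phi> a = ?N (\<lambda>x. res a x - B (res a) x)" for a
  have "\<exists>u\<in>?V. \<exists>a. \<forall>w\<in>?V. \<forall>b.
      ?N (\<lambda>x. f x - (u x + a * e x)) \<le> ?N (\<lambda>x. f x - (w x + b * e x))"
  proof (cases "\<delta> = 0")
    case True
    then have eq: "e x = B e x" if "x \<in> \<xi>" for x
      using norm_le_discr_norm[OF \<xi>(1) that, of "\<lambda>x. e x - B e x"] by (simp add: \<delta>_def)
    have "?N (\<lambda>x. f x - (B f x + 0 * e x)) \<le> ?N (\<lambda>x. f x - (w x + b * e x))" if "w \<in> ?V" for w b
    proof -
      have "?N (\<lambda>x. f x - B f x) \<le> ?N (\<lambda>x. f x - (w x + b * B e x))"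
        using Bmin[OF trig_polys_add_scaled[OF that BV]] .
      also have "\<dots> = ?N (\<lambda>x. f x - (w x + b * e x))"
        unfolding discr_norm_def using eq by (intro arg_cong[of _ _ Max] image_cong) auto
      finally show ?thesis by simp
    qed
    with BV[of f] show ?thesis by blast
  next
    case False
    then have \<delta>: "\<delta> > 0" using discr_norm_nonneg[OF \<xi>] unfolding \<delta>_def by (metis less_eq_real_def)
    have \<phi>_min: "\<phi> a \<le> ?N (\<lambda>x. res a x - w x)" if "w \<in> ?V" for a w
      unfolding \<phi>_def using Bmin[OF that] .
    have lip: "\<phi> a \<le> \<phi> b + norm (b - a) * ?N e" for a b
    proof -
      have "\<phi> a \<le> ?N (\<lambda>x. res a x - B (res b) x)" using \<phi>_min[OF BV] .
      also have "(\<lambda>x. res a x - B (res b) x) = (\<lambda>x. (res b x - B (res b) x) + (b - a) * e x)"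
        by (auto simp: res_def algebra_simps)
      also have "?N \<dots> \<le> \<phi> b + norm (b - a) * ?N e"
        unfolding \<phi>_def by (rule discr_norm_triangle_scaled[OF \<xi>])
      finally show ?thesis .
    qed
    have "(?N e)-lipschitz_on UNIV \<phi>"
    proof (rule lipschitz_onI)
      show "dist (\<phi> a) (\<phi> b) \<le> ?N e * dist a b" for a b
        using lip[of a b] lip[of b a] by (simp add: dist_norm norm_minus_commute mult.commute abs_le_iff)
    qed (rule discr_norm_nonneg[OF \<xi>])
    then have cont: "continuous_on A \<phi>" for A
      using lipschitz_on_continuous_on continuous_on_subset by blast
    have coer: "norm a * \<delta> \<le> \<phi> a + ?N f" for a
    proof (cases "a = 0")
      case True
      then show ?thesis using discr_norm_nonneg[OF \<xi>] by (simp add: \<phi>_def)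
    next
      case False
      define w where "w = (\<lambda>x. 0 + (- 1 / a) * B (res a) x)"
      have "w \<in> ?V" unfolding w_def by (rule trig_polys_add_scaled[OF zero_in_trig_polys BV])
      then have "\<delta> \<le> ?N (\<lambda>x. e x - w x)" unfolding \<delta>_def by (rule Bmin)
      also have "(\<lambda>x. e x - w x) =
          (\<lambda>x. ((1 / a) * f x + (- 1 / a) * (res a x - B (res a) x)))"
        using False by (auto simp: w_def res_def field_simps)
      also have "?N \<dots> \<le> ?N (\<lambda>x. 0 + (1 / a) * f x) + norm (- 1 / a) * \<phi> a"
        unfolding \<phi>_def
        using discr_norm_triangle_scaled[OF \<xi>, of "\<lambda>x. (1 / a) * f x" "- 1 / a"
            "\<lambda>x. res a x - B (res a) x"] by simp
      also have "\<dots> \<le> (?N (\<lambda>x. 0) + norm (1 / a) * ?N f) + norm (- 1 / a) * \<phi> a"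
        using discr_norm_triangle_scaled[OF \<xi>, of "\<lambda>x. 0" "1 / a" f] by simp
      also have "\<dots> = (\<phi> a + ?N f) / norm a"
        using \<xi> by (simp add: discr_norm_def norm_divide add_divide_distrib)
      finally show ?thesis using False by (simp add: field_simps)
    qed
    define R where "R = 2 * ?N f / \<delta>"
    have "R \<ge> 0" unfolding R_def using \<delta> discr_norm_nonneg[OF \<xi>] by simp
    then obtain a where "a \<in> cball (0::complex) R" and a: "\<And>b. b \<in> cball 0 R \<Longrightarrow> \<phi> a \<le> \<phi> b"
      using continuous_attains_inf[OF compact_cball _ cont, of "0::complex" R] by fastforce
    have \<phi>0: "\<phi> 0 \<le> ?N f" using \<phi>_min[OF zero_in_trig_polys, of 0] by (simp add: res_def)
    have amin: "\<phi> a \<le> \<phi> b" for b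
    proof (cases "norm b \<le> R")
      case True
      then show ?thesis using a by simp
    next
      case False
      then have "2 * ?N f \<le> norm b * \<delta>" using \<delta> by (simp add: R_def field_simps)
      then have "\<phi> 0 \<le> \<phi> b" using coer[of b] \<phi>0 by linarith
      then show ?thesis using a[of 0] \<open>R \<ge> 0\<close> by simp
    qed
    have "?N (\<lambda>x. f x - (B (res a) x + a * e x)) \<le> ?N (\<lambda>x. f x - (w x + b * e x))"
      if "w \<in> ?V" for w b
      using order_trans[OF amin \<phi>_min[OF that, of b]] by (simp add: \<phi>_def res_def algebra_simps)
    with BV[of "res a"] show ?thesis by blast
  qed
  then obtain u a where u: "u \<in> ?V"
    and umin: "\<And>w b. w \<in> ?V \<Longrightarrow> ?N (\<lambda>x. f x - (u x + a * e x)) \<le> ?N (\<lambda>x. f x - (w x + b * e x))"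
    by blast
  show ?case
  proof (rule bexI)
    show "(\<lambda>x. u x + a * e x) \<in> trig_polys (insert k Q)"
      unfolding trig_polys_insert[OF insert.hyps] e_def using u by blast
    show "\<forall>v\<in>trig_polys (insert k Q). ?N (\<lambda>x. f x - (u x + a * e x)) \<le> ?N (\<lambda>x. f x - v x)"
    proof
      fix v assume "v \<in> trig_polys (insert k Q)"
      then obtain w b where "w \<in> ?V" and "v = (\<lambda>x. w x + b * e x)"
        unfolding trig_polys_insert[OF insert.hyps] e_def by blast
      then show "?N (\<lambda>x. f x - (u x + a * e x)) \<le> ?N (\<lambda>x. f x - v x)" using umin by simp
    qed
  qed
qed

lemma finite_vec_of_finite:
  assumes "finite (A :: 'a set)"
  shows "finite {v :: 'a^'d. \<forall>j. v $ j \<in> A}"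
proof (rule finite_subset)
  show "{v :: 'a^'d. \<forall>j. v $ j \<in> A} \<subseteq> vec_lambda ` (Pi\<^sub>E UNIV (\<lambda>_. A))"
  proof
    fix v :: "'a^'d" assume "v \<in> {v. \<forall>j. v $ j \<in> A}"
    then have "vec_nth v \<in> Pi\<^sub>E UNIV (\<lambda>_. A)" by auto
    then show "v \<in> vec_lambda ` (Pi\<^sub>E UNIV (\<lambda>_. A))" by (metis image_eqI vec_lambda_eta)
  qed
  show "finite (vec_lambda ` (Pi\<^sub>E (UNIV :: 'd set) (\<lambda>_. A)))"
    using assms by (intro finite_imageI finite_PiE) auto
qed

lemma finite_freq_box: "finite (freq_box (s :: nat^'d))"
proof (rule finite_subset)
  let ?M = "(2::int) ^ (\<Sum>j\<in>UNIV. s $ j)"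
  show "freq_box s \<subseteq> {k. \<forall>j. k $ j \<in> {- ?M..?M}}"
  proof (clarsimp simp: freq_box_def)
    fix k :: "int^'d" and j assume "\<forall>j. \<bar>k $ j\<bar> < 2 ^ (s $ j)"
    moreover have "(2::int) ^ (s $ j) \<le> ?M"
      by (intro power_increasing member_le_sum) auto
    ultimately have "\<bar>k $ j\<bar> \<le> ?M" by (meson less_le_trans less_imp_le)
    then show "- ?M \<le> k $ j \<and> k $ j \<le> ?M" by linarith
  qed
qed (rule finite_vec_of_finite, simp)

lemma finite_H_coll: "finite (H_coll n :: (real^'d \<Rightarrow> complex) set set)"
proof -
  have "finite {s :: nat^'d. (\<Sum>j\<in>UNIV. s $ j) = n}"
  proof (rule finite_subset)
    show "{s :: nat^'d. (\<Sum>j\<in>UNIV. s $ j) = n} \<subseteq> {s. \<forall>j. s $ j \<in> {..n}}"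
      by (auto intro!: member_le_sum)
  qed (rule finite_vec_of_finite, simp)
  then show ?thesis unfolding H_coll_def by simp
qed

lemma H_coll_nonempty: "(H_coll n :: (real^'d \<Rightarrow> complex) set set) \<noteq> {}"
proof -
  define i :: 'd where "i = undefined"
  have "(\<Sum>j\<in>UNIV. (\<chi> j. if j = i then n else 0) $ j) = n" by simp
  then show ?thesis unfolding H_coll_def by blast
qed

lemma is_ell_exists:
  fixes \<xi> :: "(real^'d) set"
  assumes \<xi>: "finite \<xi>" "\<xi> \<noteq> {}"
  shows "\<exists>ell. is_ell \<xi> (H_coll n) ell"
proof -
  define L where
    "L Y f = (SOME u. is_arg_min (\<lambda>u. discr_norm \<xi> (\<lambda>x. f x - u x)) (\<lambda>u. u \<in> Y) u)" for Y f
  have L: "is_arg_min (\<lambda>u. discr_norm \<xi> (\<lambda>x. f x - u x)) (\<lambda>u. u \<in> Y) (L Y f)"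
    if Y_in: "Y \<in> H_coll n" for Y f
  proof -
    obtain s where Y: "Y = trig_polys (freq_box s)" using Y_in by (auto simp: H_coll_def)
    have "\<exists>u. is_arg_min (\<lambda>u. discr_norm \<xi> (\<lambda>x. f x - u x)) (\<lambda>u. u \<in> Y) u"
      using discr_minimizer_exists[OF \<xi> finite_freq_box[of s], of f]
      unfolding Y is_arg_min_linorder by blast
    then show ?thesis unfolding L_def by (rule someI_ex)
  qed
  define Ys where
    "Ys f = (SOME Y. is_arg_min (\<lambda>Y. sup_norm (\<lambda>x. f x - L Y f x)) (\<lambda>Y. Y \<in> H_coll n) Y)" for f
  have Ys: "is_arg_min (\<lambda>Y. sup_norm (\<lambda>x. f x - L Y f x)) (\<lambda>Y. Y \<in> H_coll n) (Ys f)" for f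
    unfolding Ys_def by (rule someI_ex) (rule ex_is_arg_min_if_finite[OF finite_H_coll H_coll_nonempty])
  have "is_ell_choice \<xi> (H_coll n) L"
    unfolding is_ell_choice_def by (intro ballI allI impI L)
  then have "is_ell \<xi> (H_coll n) (\<lambda>f. L (Ys f) f)"
    unfolding is_ell_def by (intro exI[of _ L] conjI allI impI) (auto intro: Ys)
  then show ?thesis by (rule exI[where P = "is_ell \<xi> (H_coll n)"])
qed

subsection \<open>Function classes\<close>

text \<open>Membership in \<open>L\<^sub>\<infinity>\<close> of the torus together with a bound on the essential supremum.\<close>

definition Linf_le :: "(real^'d \<Rightarrow> complex) \<Rightarrow> real \<Rightarrow> bool" where
  "Linf_le f c \<longleftrightarrow> f \<in> borel_measurable (lebesgue_on torus) \<and>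
     (AE x in lebesgue_on torus. norm (f x) \<le> c)"

text \<open>
  For \<open>0 < r \<le> 1\<close> the series may diverge at multiples of \<open>2 * pi\<close>, where the value is then
  unspecified; elsewhere it converges for every \<open>r > 0\<close> (conditionally if \<open>r \<le> 1\<close>).
\<close>

definition bernoulli_kernel :: "real \<Rightarrow> real \<Rightarrow> real \<Rightarrow> real" where
  "bernoulli_kernel r x a =
     1 + 2 * (\<Sum>k. real (Suc k) powr (- r) * cos (real (Suc k) * x - a * pi / 2))"

definition upd_coord :: "real^'d \<Rightarrow> 'd \<Rightarrow> real \<Rightarrow> real^'d" where
  "upd_coord x j y = (\<chi> i. if i = j then y else x $ i)"

text \<open>
  As \<open>\<phi>\<close> is only an \<open>L\<^sub>\<infinity>\<close> function, the representation is an identity for almost every \<open>x\<close>;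
  it uses only the values of \<open>\<phi>\<close> on the torus.
\<close>

definition W_class :: "real^'d \<Rightarrow> real^'d \<Rightarrow> (real^'d \<Rightarrow> complex) set" where
  "W_class r \<alpha> = {f. periodic f \<and>
     (\<forall>j. \<exists>\<phi>. Linf_le \<phi> 1 \<and>
        (AE x in lebesgue_on torus.
           f x = complex_of_real (1 / (2 * pi)) *
             (LINT y|lebesgue_on {0..2 * pi}.
                \<phi> (upd_coord x j y) * complex_of_real (bernoulli_kernel (r $ j) (x $ j - y) (\<alpha> $ j)))))}"

definition diff_op :: "real \<Rightarrow> 'd \<Rightarrow> (real^'d \<Rightarrow> complex) \<Rightarrow> (real^'d \<Rightarrow> complex)" where
  "diff_op h j f = (\<lambda>x. f (x + axis j h) - f x)"

definition H_class :: "real^'d \<Rightarrow> (real^'d \<Rightarrow> complex) set" where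
  "H_class r = {f. periodic f \<and> Linf_le f 1 \<and>
     (\<forall>j h. Linf_le ((diff_op h j ^^ (nat \<lfloor>r $ j\<rfloor> + 1)) f) (\<bar>h\<bar> powr (r $ j)))}"

end

theory Submission imports Defs "HOL-Number_Theory.Cong" begin

text \<open>
  The proof combines a set of sample points that is good for all frequency boxes of the same volume
  with a Jackson estimate in several variables for one suitable box.

  Points. Let \<open>f\<close> have frequencies in \<open>freq_box s\<close>, where the entries of \<open>s\<close> sum to \<open>n\<close>. By Bernstein's inequality
  (\<open>bernstein\<close>) \<open>\<bar>f\<bar>\<close> stays above half of its maximum on a box around a point of maximum with sides
  proportional to \<open>2 powr (- s $ j)\<close>. It is enough to have about \<open>2 ^ n\<close> points that hit every box of
  volume about \<open>2 powr (- n)\<close>, whatever its shape. An initial segment of the Halton sequence in pairwise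
  coprime bases does this by the Chinese remainder theorem (\<open>halton_dispersion\<close>). This gives
  \<open>universal_discretization_exists\<close>, with constant 2.

  Reduction. Minimizing over the sample points in a fixed space loses a constant factor against the
  best uniform approximation from that space, by the discretization property, and the operator then
  picks the best space (\<open>ell_near_best\<close>). So one space with good approximation suffices, and it may
  depend on \<open>r\<close>: take \<open>s $ j\<close> close to \<open>g r * n / r $ j\<close> (\<open>balanced_exponents\<close>), so that all the numbers
  \<open>2 powr (- r $ j * s $ j)\<close> are of the order \<open>2 powr (- g r * n)\<close>.

  Approximation. In one variable, discrete de la Vallee Poussin means \<open>vp\<close> are bounded, reproduce
  polynomials of half their degree, and are finite sums. Applying them to one coordinate after the
  other reduces the problem to univariate errors of the order \<open>2 powr (- r $ j * s $ j)\<close> on lines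
  (\<open>anisotropic_approximation\<close>). For the Nikol'skii classes this is a Jackson theorem
  (\<open>nikolskii_vp_rate\<close>): averaging against a power of a Fejer kernel leaves a residual which is an average of
  mixed differences, and these are combinations of pure differences by Kemperman's identity. For the
  Sobolev classes (\<open>convolution_rate\<close>) the Bernoulli kernel is cut into dyadic blocks whose \<open>L\<^sub>1\<close> norms
  decrease like \<open>2 powr (- r * m)\<close>, by summation by parts; the representation, which is assumed almost
  everywhere only, is transferred to lines by Fubini's theorem and to all points by continuity.
\<close>

section \<open>Trigonometric polynomials on the circle\<close>

definition wave :: "int \<Rightarrow> real \<Rightarrow> complex" where
  "wave k t = cis (of_int k * t)"

text \<open>
  The degree \<open>n\<close> is included, so a slice of an element of \<open>trig_polys (freq_box s)\<close> in direction
  \<open>j\<close> has degree at most \<open>2 ^ (s $ j) - 1\<close>.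
\<close>

definition tpoly :: "nat \<Rightarrow> (real \<Rightarrow> complex) set" where
  "tpoly n = {P. \<exists>c. P = (\<lambda>t. \<Sum>k\<in>{- int n..int n}. c k * wave k t)}"

lemma wave_add: "wave (j + k) t = wave j t * wave k t"
  by (simp add: wave_def cis_mult algebra_simps)

lemma wave_diff: "wave (j - k) t = wave j t * cnj (wave k t)"
  by (simp add: wave_def cis_mult cis_cnj algebra_simps)

lemma wave_arg_add: "wave k (s + t) = wave k s * wave k t"
  by (simp add: wave_def cis_mult algebra_simps)

lemma wave_0 [simp]: "wave 0 t = 1" "wave k 0 = 1"
  by (simp_all add: wave_def)

lemma norm_wave [simp]: "norm (wave k t) = 1"
  by (simp add: wave_def)

lemma cnj_wave: "cnj (wave k t) = wave (- k) t"
  by (simp add: wave_def cis_cnj)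

lemma wave_minus: "wave k (- t) = wave (- k) t"
  by (simp add: wave_def)

lemma wave_periodic: "wave k (t + 2 * pi) = wave k t"
proof -
  have "cis (2 * pi * of_int k) = 1" by (rule cis_multiple_2pi) simp
  then show ?thesis unfolding wave_arg_add by (simp add: wave_def mult.commute)
qed

lemma wave_eq_power: "wave (int k) t = cis t ^ k"
  unfolding wave_def Complex.DeMoivre by simp

lemma tpoly_cmult:
  assumes "P \<in> tpoly n"
  shows "(\<lambda>t. a * P t) \<in> tpoly n"
proof -
  obtain c where "P = (\<lambda>t. \<Sum>k\<in>{- int n..int n}. c k * wave k t)"
    using assms by (auto simp: tpoly_def)
  then have "(\<lambda>t. a * P t) = (\<lambda>t. \<Sum>k\<in>{- int n..int n}. (a * c k) * wave k t)"
    by (simp add: sum_distrib_left mult.assoc)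
  then show ?thesis unfolding tpoly_def by (auto intro!: exI[of _ "\<lambda>k. a * c k"])
qed

lemma tpoly_add:
  assumes "P \<in> tpoly n" "Q \<in> tpoly n"
  shows "(\<lambda>t. P t + Q t) \<in> tpoly n"
proof -
  obtain c d where "P = (\<lambda>t. \<Sum>k\<in>{- int n..int n}. c k * wave k t)"
    "Q = (\<lambda>t. \<Sum>k\<in>{- int n..int n}. d k * wave k t)"
    using assms by (auto simp: tpoly_def)
  then have "(\<lambda>t. P t + Q t) = (\<lambda>t. \<Sum>k\<in>{- int n..int n}. (c k + d k) * wave k t)"
    by (simp add: sum.distrib algebra_simps)
  then show ?thesis unfolding tpoly_def by (auto intro!: exI[of _ "\<lambda>k. c k + d k"])
qed

lemma tpoly_zero: "(\<lambda>t. 0) \<in> tpoly n"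
  unfolding tpoly_def by (auto intro!: exI[of _ "\<lambda>_. 0"])

lemma tpoly_sum:
  "(\<And>i. i \<in> A \<Longrightarrow> P i \<in> tpoly n) \<Longrightarrow> (\<lambda>t. \<Sum>i\<in>A. P i t) \<in> tpoly n"
  by (induction A rule: infinite_finite_induct) (auto intro: tpoly_zero tpoly_add)

lemma tpoly_wave:
  assumes "\<bar>k\<bar> \<le> int n"
  shows "wave k \<in> tpoly n"
proof -
  have "wave k = (\<lambda>t. \<Sum>i\<in>{- int n..int n}. (if i = k then 1 else 0) * wave i t)"
    using assms by (auto simp: if_distrib[of "\<lambda>a. a * _"] abs_le_iff fun_eq_iff cong: if_cong)
  then show ?thesis unfolding tpoly_def by (auto intro!: exI[of _ "\<lambda>i. if i = k then 1 else 0"])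
qed

lemma tpoly_const: "(\<lambda>t. a) \<in> tpoly n"
  using tpoly_cmult[OF tpoly_wave[of 0 n], of a] by simp

lemma tpoly_diff:
  "P \<in> tpoly n \<Longrightarrow> Q \<in> tpoly n \<Longrightarrow> (\<lambda>t. P t - Q t) \<in> tpoly n"
  using tpoly_add[OF _ tpoly_cmult[of Q n "-1"], of P] by simp

text \<open>
  Operations that are linear (\<open>G\<close> the identity) or conjugate-linear (\<open>G\<close> the conjugation) need to be
  examined on exponentials only.
\<close>

lemma tpoly_substitute:
  assumes P: "P \<in> tpoly n" and *: "\<And>k. \<bar>k\<bar> \<le> int n \<Longrightarrow> F (wave k) \<in> tpoly m"
    and lin: "\<And>c. F (\<lambda>t. \<Sum>k\<in>{- int n..int n}. c k * wave k t)
       = (\<lambda>t. \<Sum>k\<in>{- int n..int n}. G (c k) * F (wave k) t)"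
  shows "F P \<in> tpoly m"
proof -
  obtain c where "P = (\<lambda>t. \<Sum>k\<in>{- int n..int n}. c k * wave k t)"
    using P by (auto simp: tpoly_def)
  then show ?thesis using lin[of c] by (auto intro!: tpoly_sum tpoly_cmult *)
qed

lemma tpoly_mono: "P \<in> tpoly n \<Longrightarrow> n \<le> m \<Longrightarrow> P \<in> tpoly m"
  by (rule tpoly_substitute[where F = "\<lambda>P. P" and G = "\<lambda>c. c"]) (auto intro: tpoly_wave)

lemma tpoly_shift: "P \<in> tpoly n \<Longrightarrow> (\<lambda>t. P (y + t)) \<in> tpoly n"
  by (rule tpoly_substitute[where F = "\<lambda>P t. P (y + t)" and G = "\<lambda>c. c"])
     (auto simp: wave_arg_add intro: tpoly_wave tpoly_cmult)

lemma tpoly_reflect: "P \<in> tpoly n \<Longrightarrow> (\<lambda>t. P (y - t)) \<in> tpoly n"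
proof -
  assume "P \<in> tpoly n"
  then have "(\<lambda>t. P (- t)) \<in> tpoly n"
    by (rule tpoly_substitute[where F = "\<lambda>P t. P (- t)" and G = "\<lambda>c. c"])
       (auto simp: wave_minus intro: tpoly_wave)
  from tpoly_shift[OF this, of "- y"] show ?thesis by simp
qed

lemma tpoly_cnj: "P \<in> tpoly n \<Longrightarrow> (\<lambda>t. cnj (P t)) \<in> tpoly n"
  by (rule tpoly_substitute[where F = "\<lambda>P t. cnj (P t)" and G = "\<lambda>c. cnj c"])
     (auto simp: cnj_wave intro: tpoly_wave)

lemma tpoly_mult:
  assumes "P \<in> tpoly n" "Q \<in> tpoly m"
  shows "(\<lambda>t. P t * Q t) \<in> tpoly (n + m)"
proof (rule tpoly_substitute[where F = "\<lambda>P t. P t * Q t" and G = "\<lambda>c. c", OF assms(1)])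
  fix k :: int assume k: "\<bar>k\<bar> \<le> int n"
  show "(\<lambda>t. wave k t * Q t) \<in> tpoly (n + m)"
    by (rule tpoly_substitute[where F = "\<lambda>Q t. wave k t * Q t" and G = "\<lambda>c. c", OF assms(2)])
       (use k in \<open>auto simp: wave_add[symmetric] sum_distrib_left mult_ac intro!: tpoly_wave\<close>)
qed (auto simp: sum_distrib_left sum_distrib_right mult_ac)

lemma tpoly_power: "P \<in> tpoly n \<Longrightarrow> (\<lambda>t. P t ^ p) \<in> tpoly (p * n)"
  by (induction p) (auto intro: tpoly_const tpoly_mult)

lemma tpoly_periodic: "P \<in> tpoly n \<Longrightarrow> P (t + 2 * pi) = P t"
  by (auto simp: tpoly_def wave_periodic)

section \<open>Discrete de la Vallee Poussin means\<close>

definition node :: "nat \<Rightarrow> nat \<Rightarrow> real" where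
  "node M m = 2 * pi * real m / real M"

text \<open>
  A geometric sum of powers of a root of unity. It makes averages over \<open>M\<close> nodes exact for frequencies
  below \<open>M\<close>; the means, Bernstein's inequality and Jackson's theorem below therefore get by with
  finite sums over nodes.
\<close>

lemma wave_node_sum:
  assumes "\<bar>k\<bar> < int M"
  shows "(\<Sum>m<M. wave k (node M m)) = (if k = 0 then of_nat M else 0)"
proof (cases "k = 0")
  case False
  define z where "z = cis (2 * pi * of_int k / of_nat M)"
  have pow: "wave k (node M m) = z ^ m" for m
    unfolding z_def Complex.DeMoivre by (simp add: wave_def node_def mult_ac)
  have M: "M > 0" using assms by linarith
  have zM: "z ^ M = 1"
  proof -
    have "z ^ M = cis (2 * pi * of_int k)" using M unfolding z_def Complex.DeMoivre by simp
    then show ?thesis by simp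
  qed
  have "z \<noteq> 1"
  proof
    assume "z = 1"
    then have "cos (2 * pi * of_int k / of_nat M) = 1"
      unfolding z_def by (simp add: complex_eq_iff)
    then obtain j :: int where "2 * pi * of_int k / of_nat M = of_int j * 2 * pi"
      by (auto simp: cos_one_2pi_int)
    then have "(of_int k :: real) = of_int (j * int M)"
      using M by (simp add: field_simps)
    then have "k = j * int M" by linarith
    then show False using assms False
      by (auto simp: abs_mult)
  qed
  then have "(\<Sum>m<M. z ^ m) = 0" by (simp add: geometric_sum zM)
  then show ?thesis using False by (simp add: pow)
qed simp

text \<open>
  The classical Fejer kernel times \<open>n\<close>. Written as a square it is visibly nonnegative, and its
  coefficient at frequency \<open>k\<close> is the number \<open>n - \<bar>k\<bar>\<close> of pairs of indices below \<open>n\<close> with difference \<open>k\<close>.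
\<close>

definition fejer :: "nat \<Rightarrow> real \<Rightarrow> real" where
  "fejer n t = (norm (\<Sum>j<n. wave (int j) t))\<^sup>2"

lemma fejer_nonneg: "fejer n t \<ge> 0"
  by (simp add: fejer_def)

lemma fejer_0 [simp]: "fejer 0 t = 0" by (simp add: fejer_def)

lemma fejer_expand:
  "complex_of_real (fejer n t) = (\<Sum>a<n. \<Sum>b<n. wave (int a - int b) t)"
proof -
  have "complex_of_real (fejer n t) = (\<Sum>j<n. wave (int j) t) * cnj (\<Sum>j<n. wave (int j) t)"
    by (simp only: fejer_def complex_norm_square)
  also have "\<dots> = (\<Sum>a<n. \<Sum>b<n. wave (int a) t * cnj (wave (int b) t))"
    by (simp add: sum_product)
  finally show ?thesis by (simp add: wave_diff)
qed

lemma tpoly_fejer: "(\<lambda>t. complex_of_real (fejer n t)) \<in> tpoly (n - 1)"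
  unfolding fejer_expand by (intro tpoly_sum tpoly_wave) auto

text \<open>
  Counting pairs \<open>a, b < n\<close> with \<open>b = a + j\<close>: these are the only terms of the expanded square that
  survive the average, because all frequencies in the product stay below \<open>M\<close>.
\<close>

lemma fejer_average:
  assumes "\<bar>j\<bar> + int n \<le> int M" "n > 0"
  shows "(\<Sum>m<M. wave j (y + node M m) * of_real (fejer n (y + node M m)))
       = of_nat M * of_int (max 0 (int n - \<bar>j\<bar>))"
proof -
  have "(\<Sum>m<M. wave j (y + node M m) * of_real (fejer n (y + node M m)))
      = (\<Sum>m<M. \<Sum>a<n. \<Sum>b<n. wave (j + (int a - int b)) (y + node M m))"
    by (simp add: fejer_expand sum_distrib_left wave_add)
  also have "\<dots> = (\<Sum>a<n. \<Sum>b<n. \<Sum>m<M. wave (j + (int a - int b)) (y + node M m))"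
    unfolding sum.swap[of _ _ "{..<M}"] ..
  also have "\<dots> = (\<Sum>a<n. \<Sum>b<n. if int b = int a + j then of_nat M else 0)"
  proof (intro sum.cong refl)
    fix a b assume "a \<in> {..<n}" "b \<in> {..<n}"
    then have "\<bar>j + (int a - int b)\<bar> < int M" using assms by auto
    then show "(\<Sum>m<M. wave (j + (int a - int b)) (y + node M m))
        = (if int b = int a + j then of_nat M else 0)"
      unfolding wave_arg_add sum_distrib_left[symmetric] by (subst wave_node_sum) auto
  qed
  also have "\<dots> = (\<Sum>a<n. if 0 \<le> int a + j \<and> int a + j < int n then of_nat M else 0)"
  proof (intro sum.cong refl)
    fix a
    show "(\<Sum>b<n. if int b = int a + j then of_nat M else (0::complex))
        = (if 0 \<le> int a + j \<and> int a + j < int n then of_nat M else 0)"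
    proof (cases "0 \<le> int a + j")
      case True
      then have "int b = int a + j \<longleftrightarrow> b = nat (int a + j)" for b by auto
      then show ?thesis using True by auto
    qed auto
  qed
  also have "\<dots> = of_nat M * of_nat (card {a. a < n \<and> 0 \<le> int a + j \<and> int a + j < int n})"
    by (simp add: sum.If_cases Int_def mult.commute)
  also have "{a. a < n \<and> 0 \<le> int a + j \<and> int a + j < int n}
      = {nat (- j)..<nat (min (int n) (int n - j))}" by auto
  also have "of_nat (card \<dots>) = (of_int (max 0 (int n - \<bar>j\<bar>)) :: complex)"
  proof -
    have "int (card {nat (- j)..<nat (min (int n) (int n - j))}) = max 0 (int n - \<bar>j\<bar>)"
      by auto
    then show ?thesis by (metis of_int_of_nat_eq)
  qed
  finally show ?thesis .
qed

text \<open>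
  The de la Vallee Poussin kernel. The coefficients \<open>n - \<bar>k\<bar>\<close> and \<open>n div 2 - \<bar>k\<bar>\<close> of the two Fejer
  kernels differ by a constant for \<open>\<bar>k\<bar> \<le> n div 2\<close>, so the quotient has coefficient 1 there. For
  \<open>n = 1\<close> it is the constant 1, which covers polynomials of degree 0.
\<close>

definition vp_kernel :: "nat \<Rightarrow> real \<Rightarrow> real" where
  "vp_kernel n t = (fejer n t - fejer (n div 2) t) / real (n - n div 2)"

text \<open>
  The de la Vallee Poussin mean with the convolution integral replaced by an average over \<open>2 * n\<close> nodes.
  It uses finitely many values of \<open>h\<close>, is bounded on arbitrary functions, and still reproduces all
  polynomials of degree at most \<open>n div 2\<close>.
\<close>

definition vp :: "nat \<Rightarrow> (real \<Rightarrow> complex) \<Rightarrow> real \<Rightarrow> complex" where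
  "vp n h x = (\<Sum>m<2 * n. h (node (2 * n) m) * of_real (vp_kernel n (node (2 * n) m - x))) / of_nat (2 * n)"

lemma tpoly_vp_kernel: "(\<lambda>t. complex_of_real (vp_kernel n t)) \<in> tpoly (n - 1)"
proof -
  have "(\<lambda>t. inverse (of_nat (n - n div 2)) * (complex_of_real (fejer n t) - complex_of_real (fejer (n div 2) t)))
    \<in> tpoly (n - 1)"
    by (intro tpoly_cmult tpoly_diff tpoly_fejer tpoly_mono[OF tpoly_fejer[of "n div 2"]]) auto
  then show ?thesis by (simp add: vp_kernel_def divide_inverse mult.commute)
qed

lemma vp_tpoly: "vp n h \<in> tpoly (n - 1)"
proof -
  have "(\<lambda>x. \<Sum>m<2 * n. (h (node (2 * n) m) / of_nat (2 * n)) * of_real (vp_kernel n (node (2 * n) m - x)))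
      \<in> tpoly (n - 1)"
    by (intro tpoly_sum tpoly_cmult tpoly_reflect[OF tpoly_vp_kernel])
  then show ?thesis by (simp add: vp_def[abs_def] sum_divide_distrib)
qed

lemma vp_diff: "vp n (\<lambda>t. h t - k t) x = vp n h x - vp n k x"
  by (simp add: vp_def algebra_simps sum_subtractf diff_divide_distrib)

text \<open>
  With \<open>p = n div 2\<close>, the Fejer kernels are nonnegative with averages \<open>n\<close> and \<open>p\<close> over the nodes, so the
  averaged absolute value of the kernel is at most \<open>(n + p) / (n - p) \<le> 3\<close>.
\<close>

lemma vp_bound:
  assumes "n > 0" and b: "\<And>m. m < 2 * n \<Longrightarrow> norm (h (node (2 * n) m)) \<le> B"
  shows "norm (vp n h x) \<le> 3 * B"
proof -
  let ?t = "\<lambda>m. node (2 * n) m" and ?p = "n div 2"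
  have B: "B \<ge> 0" using b[of 0] assms(1) by (smt (verit) norm_ge_zero mult_pos_pos zero_less_numeral)
  have avg: "(\<Sum>m<2 * n. fejer q (?t m - x)) = 2 * real n * real q" if "q \<le> n" for q
  proof (cases "q = 0")
    case False
    then have "complex_of_real (\<Sum>m<2 * n. fejer q (- x + ?t m)) = of_nat (2 * n) * of_int (max 0 (int q))"
      using fejer_average[of 0 q "2 * n" "- x"] that by simp
    also have "\<dots> = complex_of_real (2 * real n * real q)" by simp
    finally have "(\<Sum>m<2 * n. fejer q (- x + ?t m)) = 2 * real n * real q"
      by (simp only: of_real_eq_iff)
    then show ?thesis by simp
  qed simp
  have k: "\<bar>vp_kernel n t\<bar> \<le> (fejer n t + fejer ?p t) / real (n - ?p)" for t
    unfolding vp_kernel_def using fejer_nonneg[of n t] fejer_nonneg[of ?p t]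
    by (simp only: abs_divide abs_of_nat) (intro divide_right_mono, auto)
  have "norm (vp n h x) \<le> (\<Sum>m<2 * n. norm (h (?t m) * of_real (vp_kernel n (?t m - x)))) / real (2 * n)"
    unfolding vp_def norm_divide norm_of_nat by (intro divide_right_mono norm_sum) auto
  also have "\<dots> \<le> (\<Sum>m<2 * n. B * ((fejer n (?t m - x) + fejer ?p (?t m - x)) / real (n - ?p))) / real (2 * n)"
    unfolding norm_mult norm_of_real
    using b k B by (intro divide_right_mono sum_mono mult_mono) auto
  also have "\<dots> = B * (2 * real n * (real n + real ?p)) / real (n - ?p) / real (2 * n)"
    unfolding sum_distrib_left[symmetric] sum_divide_distrib[symmetric] sum.distrib
      avg[OF order_refl] avg[OF div_le_dividend] by (simp add: distrib_left)
  also have "\<dots> = B * ((real n + real ?p) / real (n - ?p))" using assms(1) by simp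
  also have "\<dots> \<le> B * 3"
  proof (intro mult_left_mono B)
    have "n + ?p \<le> 3 * (n - ?p)" "n - ?p > 0" using assms(1) by auto
    then have "real n + real ?p \<le> 3 * real (n - ?p)" "real (n - ?p) > 0" by linarith+
    then show "(real n + real ?p) / real (n - ?p) \<le> 3" by (simp add: divide_le_eq)
  qed
  finally show ?thesis by simp
qed

lemma vp_reproduces:
  assumes "n > 0" "P \<in> tpoly (n div 2)"
  shows "vp n P x = P x"
proof -
  let ?t = "\<lambda>m. node (2 * n) m" and ?p = "n div 2"
  have wave: "(\<Sum>m<2 * n. wave k (?t m) * of_real (vp_kernel n (?t m - x))) = of_nat (2 * n) * wave k x"
    if k: "\<bar>k\<bar> \<le> int ?p" for k
  proof -
    have *: "(\<Sum>m<2 * n. wave k (?t m) * of_real (fejer q (?t m - x)))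
        = of_nat (2 * n) * of_int (int q - \<bar>k\<bar>) * wave k x" if q: "?p \<le> q" "q \<le> n" "q > 0" for q
    proof -
      have "wave k (?t m) = wave k x * wave k (- x + ?t m)" for m
        by (simp add: wave_arg_add[symmetric])
      then have "(\<Sum>m<2 * n. wave k (?t m) * of_real (fejer q (?t m - x)))
          = wave k x * (\<Sum>m<2 * n. wave k (- x + ?t m) * of_real (fejer q (- x + ?t m)))"
        by (simp add: sum_distrib_left mult.assoc)
      also have "\<dots> = wave k x * (of_nat (2 * n) * of_int (max 0 (int q - \<bar>k\<bar>)))"
        using k q by (subst fejer_average) auto
      finally show ?thesis using k q by simp
    qed
    have *: "(\<Sum>m<2 * n. wave k (?t m) * of_real (fejer q (?t m - x)))
        = of_nat (2 * n) * of_int (int q - \<bar>k\<bar>) * wave k x" if q: "?p \<le> q" "q \<le> n" for q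
    proof (cases "q = 0")
      case True
      then show ?thesis using q k by simp
    qed (use * q in auto)
    have "(\<Sum>m<2 * n. wave k (?t m) * of_real (vp_kernel n (?t m - x)))
       = ((\<Sum>m<2 * n. wave k (?t m) * of_real (fejer n (?t m - x)))
         - (\<Sum>m<2 * n. wave k (?t m) * of_real (fejer ?p (?t m - x)))) / of_nat (n - ?p)"
      by (simp add: vp_kernel_def sum_divide_distrib sum_subtractf algebra_simps diff_divide_distrib)
    also have "\<dots> = of_nat (2 * n) * wave k x"
    proof -
      have "n - ?p > 0" using assms(1) by auto
      moreover have "(of_int (int n - \<bar>k\<bar>) - of_int (int ?p - \<bar>k\<bar>) :: complex) = of_nat (n - ?p)"
        by (simp add: of_nat_diff)
      moreover have "of_nat (2 * n) * A * w - of_nat (2 * n) * B * w = of_nat (2 * n) * w * (A - B)"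
        for A B w :: complex by (simp add: algebra_simps)
      ultimately show ?thesis unfolding *[OF div_le_dividend order_refl] *[OF order_refl div_le_dividend]
        by simp
    qed
    finally show ?thesis .
  qed
  obtain c where P: "P = (\<lambda>t. \<Sum>k\<in>{- int ?p..int ?p}. c k * wave k t)"
    using assms(2) by (auto simp: tpoly_def)
  have "(\<Sum>m<2 * n. P (?t m) * of_real (vp_kernel n (?t m - x)))
      = (\<Sum>k\<in>{- int ?p..int ?p}. c k * (\<Sum>m<2 * n. wave k (?t m) * of_real (vp_kernel n (?t m - x))))"
    unfolding P sum_distrib_right sum_distrib_left
    by (subst sum.swap) (simp add: mult.assoc)
  also have "\<dots> = of_nat (2 * n) * P x"
    unfolding P sum_distrib_left[of "of_nat (2 * n)"] by (intro sum.cong refl) (subst wave, auto)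
  finally show ?thesis using assms(1) by (simp add: vp_def)
qed

lemma node_mem: "m < M \<Longrightarrow> node M m \<in> {0..2 * pi}"
  by (auto simp: node_def field_simps)

text \<open>
  Lebesgue's inequality: an operator of norm 3 that fixes \<open>P\<close> loses a factor \<open>1 + 3\<close> against \<open>P\<close>.
\<close>

lemma vp_near_best:
  assumes "n > 0" "P \<in> tpoly (n div 2)"
    and e: "\<And>t. t \<in> {0..2 * pi} \<Longrightarrow> norm (h t - P t) \<le> \<epsilon>" and "t \<in> {0..2 * pi}"
  shows "norm (h t - vp n h t) \<le> 4 * \<epsilon>"
proof -
  have "h t - vp n h t = (h t - P t) - vp n (\<lambda>t. h t - P t) t"
    using vp_reproduces[OF assms(1,2)] by (simp add: vp_diff)
  also have "norm \<dots> \<le> \<epsilon> + 3 * \<epsilon>"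
    using assms by (intro order_trans[OF norm_triangle_ineq4] add_mono vp_bound e node_mem)
  finally show ?thesis by simp
qed

section \<open>Bernstein's inequality\<close>

text \<open>
  Bernstein's inequality up to a factor 2. For \<open>\<bar>k\<bar> \<le> n\<close> the coefficient of the kernel
  \<open>2 * sin (n * t) * fejer n t\<close> that acts on the frequency \<open>k\<close> is \<open>\<i> * k\<close>, so the derivative is an average
  of values of \<open>P\<close> against this kernel, whose averaged absolute value is at most \<open>2 * n\<close>. Products with
  \<open>P\<close> have frequencies below \<open>3 * n\<close>, which is why that many nodes are used.
\<close>

lemma bernstein:
  assumes P: "P \<in> tpoly n" and b: "\<And>t. norm (P t) \<le> B"
  shows "norm (P x - P y) \<le> 2 * real n * B * \<bar>x - y\<bar>"
proof (cases "n = 0")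
  case True
  then show ?thesis using P by (auto simp: tpoly_def)
next
  case False
  obtain c where Pc: "P = (\<lambda>t. \<Sum>k\<in>{- int n..int n}. c k * wave k t)"
    using P by (auto simp: tpoly_def)
  define P' where "P' = (\<lambda>t. \<Sum>k\<in>{- int n..int n}. c k * (\<i> * of_int k * wave k t))"
  let ?M = "3 * n"
  have der: "(P has_vector_derivative P' t) (at t within S)" for t S
    unfolding Pc P'_def wave_def
    by (auto intro!: derivative_eq_intros simp: has_vector_derivative_def scaleR_conv_of_real mult_ac sum_distrib_left)
  let ?s = "\<lambda>m. of_real (sin (real n * node ?M m)) * of_real (fejer n (node ?M m)) :: complex"
  have sinw: "(of_real (sin (real n * t)) :: complex) = (wave (int n) t - wave (- int n) t) / (2 * \<i>)" for t
    by (simp add: wave_def complex_eq_iff Im_divide Re_divide)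
  have wave: "(\<Sum>m<?M. wave k (x + node ?M m) * ?s m) * 2 = of_nat ?M * (\<i> * of_int k * wave k x)"
    if k: "\<bar>k\<bar> \<le> int n" for k x
  proof -
    have "(\<Sum>m<?M. wave k (x + node ?M m) * ?s m)
       = wave k x * ((\<Sum>m<?M. wave (k + int n) (0 + node ?M m) * of_real (fejer n (0 + node ?M m)))
           - (\<Sum>m<?M. wave (k - int n) (0 + node ?M m) * of_real (fejer n (0 + node ?M m)))) / (2 * \<i>)"
      unfolding sinw wave_arg_add wave_add diff_conv_add_uminus[of k] sum_subtractf[symmetric]
        sum_distrib_left sum_divide_distrib
      by (intro sum.cong refl) (simp add: field_simps)
    also have "\<dots> = wave k x * (of_nat ?M * of_int (max 0 (int n - \<bar>k + int n\<bar>))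
        - of_nat ?M * of_int (max 0 (int n - \<bar>k - int n\<bar>))) / (2 * \<i>)"
      using k False by (subst (1 2) fejer_average) auto
    also have "\<dots> = wave k x * of_nat ?M * of_int (max 0 (int n - \<bar>k + int n\<bar>) - max 0 (int n - \<bar>k - int n\<bar>)) / (2 * \<i>)"
      by (simp add: algebra_simps)
    also have "max 0 (int n - \<bar>k + int n\<bar>) - max 0 (int n - \<bar>k - int n\<bar>) = - k" using k by auto
    finally have "(\<Sum>m<?M. wave k (x + node ?M m) * ?s m) * 2 = wave k x * of_nat ?M * of_int (- k) / \<i>"
      by simp
    then show ?thesis by simp
  qed
  have P'_bound: "norm (P' t) \<le> 2 * real n * B" for t
  proof -
    have B: "B \<ge> 0" using b[of 0] by (meson norm_ge_zero order_trans)
    have "of_nat ?M * P' t = (\<Sum>k\<in>{- int n..int n}. c k * (of_nat ?M * (\<i> * of_int k * wave k t)))"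
      by (simp add: P'_def sum_distrib_left mult_ac)
    also have "\<dots> = (\<Sum>k\<in>{- int n..int n}. c k * ((\<Sum>m<?M. wave k (t + node ?M m) * ?s m) * 2))"
      by (intro sum.cong refl) (subst wave, auto)
    also have "\<dots> = 2 * (\<Sum>m<?M. P (t + node ?M m) * ?s m)"
      unfolding Pc sum_distrib_right sum_distrib_left
      by (subst sum.swap) (simp add: mult_ac)
    finally have "norm (of_nat ?M * P' t) = norm (2 * (\<Sum>m<?M. P (t + node ?M m) * ?s m))"
      by (rule arg_cong)
    then have "real ?M * norm (P' t) = 2 * norm (\<Sum>m<?M. P (t + node ?M m) * ?s m)"
      unfolding norm_mult norm_of_nat norm_numeral .
    also have "\<dots> \<le> 2 * (\<Sum>m<?M. B * fejer n (node ?M m))"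
      using b B fejer_nonneg
      by (intro mult_left_mono order_trans[OF norm_sum] sum_mono)
         (auto simp: norm_mult intro!: mult_mono mult_left_le_one_le)
    also have "(\<Sum>m<?M. B * fejer n (node ?M m)) = B * (real ?M * real n)"
    proof -
      have "complex_of_real (\<Sum>m<?M. fejer n (node ?M m)) = of_nat ?M * of_int (max 0 (int n))"
        using fejer_average[of 0 n ?M 0] False by simp
      also have "\<dots> = complex_of_real (real ?M * real n)" by simp
      finally have "(\<Sum>m<?M. fejer n (node ?M m)) = real ?M * real n" by (simp only: of_real_eq_iff)
      then show ?thesis by (simp add: sum_distrib_left[symmetric])
    qed
    finally show ?thesis using False by (simp add: mult_ac)
  qed
  have "norm (P x - P y) \<le> 2 * real n * B * norm (x - y)"
    by (rule differentiable_bound[of UNIV P "\<lambda>t h. h *\<^sub>R P' t"])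
       (use der[unfolded has_vector_derivative_def] in
         \<open>auto intro!: onorm_le simp: mult.commute[of "2 * real n * B"] mult_left_mono[OF P'_bound]\<close>)
  then show ?thesis by simp
qed

section \<open>Slices along a coordinate axis\<close>

lemma upd_coord_nth [simp]: "upd_coord x j t $ i = (if i = j then t else x $ i)"
  by (simp add: upd_coord_def)

lemma upd_coord_same [simp]: "upd_coord x j (x $ j) = x"
  by (simp add: vec_eq_iff)

lemma upd_coord_twice [simp]: "upd_coord (upd_coord x j s) j t = upd_coord x j t"
  by (simp add: vec_eq_iff)

lemma mem_torus: "x \<in> torus \<longleftrightarrow> (\<forall>j. 0 \<le> x $ j \<and> x $ j \<le> 2 * pi)"
  by (simp add: torus_def mem_box_cart)

lemma upd_coord_torus: "x \<in> torus \<Longrightarrow> t \<in> {0..2 * pi} \<Longrightarrow> upd_coord x j t \<in> torus"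
  by (simp add: mem_torus)

text \<open>
  The coordinates of \<open>x\<close> are replaced by those of \<open>y\<close> one at a time. The intermediate points \<open>z\<close> mix
  coordinates of \<open>x\<close> and \<open>y\<close>, so they stay in any box that contains both.
\<close>

lemma coordinatewise_bound:
  fixes F :: "real^'d \<Rightarrow> complex"
  assumes e: "\<And>z j. (\<And>i. z $ i = x $ i \<or> z $ i = y $ i) \<Longrightarrow>
     norm (F (upd_coord z j (x $ j)) - F (upd_coord z j (y $ j))) \<le> e"
  shows "norm (F x - F y) \<le> real CARD('d) * e"
proof -
  define mix where "mix J = (\<chi> i. if i \<in> J then y $ i else x $ i)" for J
  have "norm (F x - F (mix J)) \<le> real (card J) * e" if "finite J" for J
    using that
  proof (induction J)
    case empty
    have "mix {} = x" by (simp add: mix_def vec_eq_iff)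
    then show ?case by simp
  next
    case (insert j J)
    have "upd_coord (mix J) j (x $ j) = mix J" "upd_coord (mix J) j (y $ j) = mix (insert j J)"
      using insert.hyps by (auto simp: mix_def vec_eq_iff)
    then have "norm (F (mix J) - F (mix (insert j J))) \<le> e"
      using e[of "mix J" j] by (simp add: mix_def)
    then have "norm (F x - F (mix (insert j J))) \<le> real (card J) * e + e"
      using insert.IH norm_triangle_ineq[of "F x - F (mix J)" "F (mix J) - F (mix (insert j J))"] by simp
    then show ?case using insert.hyps by (simp add: algebra_simps)
  qed
  moreover have "mix UNIV = y" by (simp add: mix_def vec_eq_iff)
  ultimately show ?thesis using finite_class.finite_UNIV by metis
qed

lemma trig_char_upd: "trig_char k (upd_coord x j t) = trig_char k (upd_coord x j 0) * wave (k $ j) t"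
proof -
  have "(\<Sum>i\<in>UNIV. real_of_int (k $ i) * upd_coord x j t $ i)
      = (\<Sum>i\<in>UNIV. real_of_int (k $ i) * upd_coord x j 0 $ i + (if i = j then real_of_int (k $ j) * t else 0))"
    by (intro sum.cong) auto
  then have "(\<Sum>i\<in>UNIV. real_of_int (k $ i) * upd_coord x j t $ i)
      = (\<Sum>i\<in>UNIV. real_of_int (k $ i) * upd_coord x j 0 $ i) + real_of_int (k $ j) * t"
    by (simp only: sum.distrib sum.delta finite_class.finite_UNIV UNIV_I if_True)
  then show ?thesis
    unfolding trig_char_def wave_def cis_conv_exp by (simp only: of_real_add distrib_left exp_add)
qed

lemma slice_tpoly:
  assumes "u \<in> trig_polys (freq_box s)"
  shows "(\<lambda>t. u (upd_coord x j t)) \<in> tpoly (2 ^ (s $ j) - 1)"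
proof -
  obtain c where c: "u = (\<lambda>x. \<Sum>k\<in>freq_box s. c k * trig_char k x)"
    using assms by (auto simp: trig_polys_def)
  have "(\<lambda>t. \<Sum>k\<in>freq_box s. (c k * trig_char k (upd_coord x j 0)) * wave (k $ j) t) \<in> tpoly (2 ^ (s $ j) - 1)"
  proof (intro tpoly_sum tpoly_cmult tpoly_wave)
    fix k assume "k \<in> freq_box s"
    then have "\<bar>k $ j\<bar> < 2 ^ (s $ j)" by (simp add: freq_box_def)
    then show "\<bar>k $ j\<bar> \<le> int (2 ^ (s $ j) - 1)" by (simp add: of_nat_diff)
  qed
  moreover have "u (upd_coord x j t)
      = (\<Sum>k\<in>freq_box s. (c k * trig_char k (upd_coord x j 0)) * wave (k $ j) t)" for t
    unfolding c by (intro sum.cong refl) (subst trig_char_upd, simp only: mult.assoc)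
  ultimately show ?thesis by simp
qed

lemma continuous_trig_poly: "u \<in> trig_polys Q \<Longrightarrow> continuous_on S u"
  unfolding trig_polys_def trig_char_def by clarify (intro continuous_intros)

lemma torus_nonempty: "torus \<noteq> {}"
proof -
  have "0 \<in> torus" by (simp add: mem_torus)
  then show ?thesis by blast
qed

lemma norm_le_sup_norm:
  assumes "continuous_on torus f" "x \<in> torus"
  shows "norm (f x) \<le> sup_norm f"
  unfolding sup_norm_def
proof (rule cSUP_upper[OF assms(2)])
  have "compact ((\<lambda>x. norm (f x)) ` torus)"
    unfolding torus_def using assms(1)[unfolded torus_def]
    by (intro compact_continuous_image continuous_intros) auto
  then show "bdd_above ((\<lambda>x. norm (f x)) ` torus)" by (intro bounded_imp_bdd_above compact_imp_bounded)
qed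

lemma sup_norm_le: "(\<And>x. x \<in> torus \<Longrightarrow> norm (f x) \<le> c) \<Longrightarrow> sup_norm f \<le> c"
  unfolding sup_norm_def by (rule cSUP_least[OF torus_nonempty])

lemma tpoly_bound_extend:
  assumes P: "P \<in> tpoly n" and b: "\<And>t. t \<in> {0..2 * pi} \<Longrightarrow> norm (P t) \<le> B"
  shows "norm (P t) \<le> B"
proof -
  have nat: "P (t + 2 * pi * real m) = P t" for t m
  proof (induction m)
    case (Suc m)
    have "t + 2 * pi * real (Suc m) = (t + 2 * pi * real m) + 2 * pi" by (simp add: algebra_simps)
    then show ?case by (simp only: tpoly_periodic[OF P] Suc.IH)
  qed simp
  define m where "m = \<lfloor>t / (2 * pi)\<rfloor>"
  have m: "of_int m \<le> t / (2 * pi)" "t / (2 * pi) \<le> of_int m + 1"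
    unfolding m_def by linarith+
  then have mem: "t - 2 * pi * of_int m \<in> {0..2 * pi}" by (simp add: field_simps)
  have "P (t - 2 * pi * of_int m) = P t"
  proof (cases "m \<ge> 0")
    case True
    then have "(t - 2 * pi * of_int m) + 2 * pi * real (nat m) = t" by simp
    then show ?thesis using nat[of "t - 2 * pi * of_int m" "nat m"] by simp
  next
    case False
    then have "t - 2 * pi * of_int m = t + 2 * pi * real (nat (- m))" by simp
    then show ?thesis using nat[of t "nat (- m)"] by (simp only:)
  qed
  then show ?thesis using b[OF mem] by simp
qed

section \<open>Universal discretization by Halton points\<close>

text \<open>
  The van der Corput sequence: the base \<open>b\<close> digits of \<open>i\<close> are reflected at the point. The case
  \<open>b < 2\<close> makes the recursion well-founded.
\<close>

fun radical_inverse :: "nat \<Rightarrow> nat \<Rightarrow> real" where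
  "radical_inverse b i = (if b < 2 \<or> i = 0 then 0 else (real (i mod b) + radical_inverse b (i div b)) / real b)"

declare radical_inverse.simps [simp del]

lemma radical_inverse_rec:
  "b \<ge> 2 \<Longrightarrow> radical_inverse b i = (real (i mod b) + radical_inverse b (i div b)) / real b"
  by (cases "i = 0") (simp_all add: radical_inverse.simps[of b i] radical_inverse.simps[of b 0])

lemma radical_inverse_unit: "b \<ge> 2 \<Longrightarrow> radical_inverse b i \<in> {0..1}"
proof (induction i rule: less_induct)
  case (less i)
  show ?case
  proof (cases "i = 0")
    case False
    then have "radical_inverse b (i div b) \<in> {0..1}" using less by (intro less.IH) auto
    moreover have "real (i mod b) \<le> real b - 1"
      using less.prems mod_less_divisor[of b i] by linarith
    ultimately show ?thesis using less.prems
      by (auto simp: radical_inverse_rec[of b i] divide_le_eq)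
  qed (simp add: radical_inverse.simps)
qed

text \<open>
  The first \<open>k\<close> digits of the radical inverse are the last \<open>k\<close> digits of \<open>i\<close>. They depend on \<open>i\<close> modulo
  \<open>b ^ k\<close> only, and every digit string occurs.
\<close>

lemma radical_inverse_interval:
  assumes b: "b \<ge> 2" and "a < b ^ k"
  shows "\<exists>u. \<forall>i. [i = u] (mod b ^ k) \<longrightarrow>
     radical_inverse b i \<in> {real a / real b ^ k..(real a + 1) / real b ^ k}"
  using assms(2)
proof (induction k arbitrary: a)
  case 0
  then show ?case using radical_inverse_unit[OF b] by auto
next
  case (Suc k)
  define a1 a2 where "a1 = a div b ^ k" and "a2 = a mod b ^ k"
  have a: "a = a1 * b ^ k + a2" unfolding a1_def a2_def by (rule div_mult_mod_eq[symmetric])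
  have a1: "a1 < b" using Suc.prems b by (simp add: a1_def less_mult_imp_div_less)
  have "a2 < b ^ k" using b by (simp add: a2_def)
  then obtain u2 where u2: "\<And>i. [i = u2] (mod b ^ k) \<Longrightarrow>
      radical_inverse b i \<in> {real a2 / real b ^ k..(real a2 + 1) / real b ^ k}"
    using Suc.IH by blast
  show ?case
  proof (intro exI allI impI)
    fix i assume i: "[i = a1 + b * u2] (mod b ^ Suc k)"
    have "b * (i div b mod b ^ k) + i mod b = b * (u2 mod b ^ k) + a1"
      using i[unfolded cong_def power_Suc mod_mult2_eq] a1 b by simp
    moreover have "(b * X + r) div b = X" "(b * X + r) mod b = r" if "r < b" for X r
      using that by simp_all
    moreover have "i mod b < b" using b by simp
    ultimately have "i mod b = a1" "i div b mod b ^ k = u2 mod b ^ k"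
      using a1 by metis+
    then have rec: "radical_inverse b i = (real a1 + radical_inverse b (i div b)) / real b"
      and mem: "radical_inverse b (i div b) \<in> {real a2 / real b ^ k..(real a2 + 1) / real b ^ k}"
      using radical_inverse_rec[OF b, of i] u2 by (auto simp: cong_def)
    have e: "real a / real b ^ Suc k = (real a1 + real a2 / real b ^ k) / real b"
      "(real a + 1) / real b ^ Suc k = (real a1 + (real a2 + 1) / real b ^ k) / real b"
      unfolding a using b by (simp_all add: field_simps)
    show "radical_inverse b i \<in> {real a / real b ^ Suc k..(real a + 1) / real b ^ Suc k}"
      unfolding e rec using mem b by (auto intro!: divide_right_mono)
  qed
qed

lemma radical_inverse_hits:
  assumes b: "b \<ge> 2" and y: "y \<in> {0..1}"
  shows "\<exists>u. \<forall>i. [i = u] (mod b ^ k) \<longrightarrow> \<bar>radical_inverse b i - y\<bar> \<le> 1 / real b ^ k"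
proof -
  define a where "a = min (nat \<lfloor>y * real b ^ k\<rfloor>) (b ^ k - 1)"
  have bk: "b ^ k > 0" using b by simp
  then have a: "a < b ^ k" by (simp add: a_def min_less_iff_disj)
  have fl: "real (nat \<lfloor>y * real b ^ k\<rfloor>) \<le> y * real b ^ k" "y * real b ^ k \<le> real (nat \<lfloor>y * real b ^ k\<rfloor>) + 1"
    using y by (simp_all add: of_nat_nat)
  have yb: "y * real b ^ k \<le> real b ^ k" using y by (simp add: mult_left_le_one_le)
  have "real a \<le> y * real b ^ k" "y * real b ^ k \<le> real a + 1"
    using fl yb bk by (auto simp: a_def min_def of_nat_diff)
  then have "y \<in> {real a / real b ^ k..(real a + 1) / real b ^ k}"
    using b by (simp add: field_simps)
  moreover have "(real a + 1) / real b ^ k = real a / real b ^ k + 1 / real b ^ k"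
    by (simp add: add_divide_distrib)
  moreover obtain u where "\<And>i. [i = u] (mod b ^ k) \<Longrightarrow>
     radical_inverse b i \<in> {real a / real b ^ k..(real a + 1) / real b ^ k}"
    using radical_inverse_interval[OF b a] by blast
  ultimately have "\<bar>radical_inverse b i - y\<bar> \<le> 1 / real b ^ k" if "[i = u] (mod b ^ k)" for i
    using that by (fastforce simp: abs_le_iff)
  then show ?thesis by blast
qed

text \<open>
  With pairwise coprime bases, these are the points of the Halton sequence, scaled to the torus.
\<close>

definition halton :: "('d \<Rightarrow> nat) \<Rightarrow> nat \<Rightarrow> real^'d" where
  "halton p i = (\<chi> j. 2 * pi * radical_inverse (p j) i)"

lemma halton_torus: "(\<And>j. p j \<ge> 2) \<Longrightarrow> halton p i \<in> torus"
  using radical_inverse_unit by (auto simp: mem_torus halton_def mult_left_le)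

text \<open>
  In each coordinate, closeness to \<open>x\<close> within \<open>2 * pi / p j ^ k j\<close> holds on a full residue class modulo
  \<open>p j ^ k j\<close>. The Chinese remainder theorem meets all these conditions at once by an index below the
  product of the moduli. With \<open>k j\<close> minimal, this product is at most a constant times \<open>2 ^ n\<close> for every
  \<open>s\<close> with sum \<open>n\<close>: the same points hit boxes of all shapes of volume about \<open>2 ^ (- n)\<close>.
\<close>

lemma halton_dispersion:
  fixes p :: "'d::finite \<Rightarrow> nat" and s :: "nat^'d"
  assumes p: "\<And>j. p j \<ge> 2" and cop: "\<And>i j. i \<noteq> j \<Longrightarrow> coprime (p i) (p j)"
    and c: "c > 0" and x: "x \<in> torus"
  shows "\<exists>i < (\<Prod>j\<in>UNIV. p j * c) * 2 ^ (\<Sum>j\<in>UNIV. s $ j).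
    \<forall>j. \<bar>halton p i $ j - x $ j\<bar> \<le> 2 * pi / (real c * 2 ^ (s $ j))"
proof -
  have "\<exists>k. c * 2 ^ (s $ j) \<le> p j ^ k \<and> p j ^ k \<le> p j * (c * 2 ^ (s $ j))" for j
  proof -
    define k where "k = (LEAST k. c * 2 ^ (s $ j) \<le> p j ^ k)"
    have "c * 2 ^ (s $ j) \<le> p j ^ (c * 2 ^ (s $ j))"
      using p[of j] by (meson less_exp less_imp_le order_trans power_mono zero_le)
    then have k: "c * 2 ^ (s $ j) \<le> p j ^ k" unfolding k_def by (rule LeastI)
    have "p j ^ k \<le> p j * (c * 2 ^ (s $ j))"
    proof (cases k)
      case 0
      have "1 \<le> p j * (c * 2 ^ (s $ j))" using p[of j] c by (simp add: Suc_le_eq)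
      then show ?thesis by (simp add: 0)
    next
      case (Suc k')
      then have "k' < k" by simp
      then have "\<not> c * 2 ^ (s $ j) \<le> p j ^ k'"
        unfolding k_def by (rule not_less_Least)
      then show ?thesis by (simp add: Suc)
    qed
    with k show ?thesis by blast
  qed
  then obtain k where k: "\<And>j. c * 2 ^ (s $ j) \<le> p j ^ k j" "\<And>j. p j ^ k j \<le> p j * (c * 2 ^ (s $ j))"
    by metis
  have "\<exists>u. \<forall>i. [i = u] (mod p j ^ k j) \<longrightarrow> \<bar>radical_inverse (p j) i - x $ j / (2 * pi)\<bar> \<le> 1 / real (p j) ^ k j" for j
    using x by (intro radical_inverse_hits p) (simp add: mem_torus)
  then obtain u where u: "\<And>j i. [i = u j] (mod p j ^ k j) \<Longrightarrow>
      \<bar>radical_inverse (p j) i - x $ j / (2 * pi)\<bar> \<le> 1 / real (p j) ^ k j"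
    by metis
  obtain i0 where i0: "\<And>j. [i0 = u j] (mod p j ^ k j)"
    using chinese_remainder_nat[of UNIV "\<lambda>j. p j ^ k j" u] cop by auto
  define Q where "Q = (\<Prod>j\<in>UNIV. p j ^ k j)"
  have p0: "p j > 0" for j using p[of j] by simp
  have Q: "Q > 0" unfolding Q_def using p0 by (intro prod_pos) auto
  define i where "i = i0 mod Q"
  have "Q \<le> (\<Prod>j\<in>UNIV. p j * c * 2 ^ (s $ j))"
    unfolding Q_def by (intro prod_mono) (use k(2) in \<open>auto simp: mult.assoc\<close>)
  also have "\<dots> = (\<Prod>j\<in>UNIV. p j * c) * 2 ^ (\<Sum>j\<in>UNIV. s $ j)"
    by (simp add: prod.distrib power_sum)
  finally have "i < (\<Prod>j\<in>UNIV. p j * c) * 2 ^ (\<Sum>j\<in>UNIV. s $ j)"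
    using mod_less_divisor[OF Q, of i0] unfolding i_def by linarith
  moreover have "\<bar>halton p i $ j - x $ j\<bar> \<le> 2 * pi / (real c * 2 ^ (s $ j))" for j
  proof -
    have "p j ^ k j dvd Q" unfolding Q_def by (intro dvd_prodI) auto
    then have "[i = i0] (mod p j ^ k j)" by (simp add: i_def cong_def mod_mod_cancel)
    then have "[i = u j] (mod p j ^ k j)" using i0 cong_trans by blast
    then have 1: "\<bar>radical_inverse (p j) i - x $ j / (2 * pi)\<bar> \<le> 1 / real (p j) ^ k j" by (rule u)
    have "real (c * 2 ^ (s $ j)) \<le> real (p j ^ k j)" using k(1) by (simp only: of_nat_le_iff)
    then have "1 / real (p j) ^ k j \<le> 1 / (real c * 2 ^ (s $ j))"
      using c by (intro divide_left_mono) (auto simp: p0)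
    with 1 have "2 * pi * \<bar>radical_inverse (p j) i - x $ j / (2 * pi)\<bar> \<le> 2 * pi * (1 / (real c * 2 ^ (s $ j)))"
      by (intro mult_left_mono) auto
    moreover have "\<bar>halton p i $ j - x $ j\<bar> = 2 * pi * \<bar>radical_inverse (p j) i - x $ j / (2 * pi)\<bar>"
    proof -
      have "halton p i $ j - x $ j = 2 * pi * (radical_inverse (p j) i - x $ j / (2 * pi))"
        by (simp add: halton_def right_diff_distrib)
      then show ?thesis by (simp only: abs_mult) simp
    qed
    ultimately show ?thesis by simp
  qed
  ultimately show ?thesis by blast
qed

lemma coprime_bases_exist: "\<exists>p :: 'd::finite \<Rightarrow> nat. (\<forall>j. p j \<ge> 2) \<and> (\<forall>i j. i \<noteq> j \<longrightarrow> coprime (p i) (p j))"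
proof -
  obtain B where B: "finite B" "card B = CARD('d)" "B \<subseteq> {p::nat. prime p}"
    using infinite_arbitrarily_large[OF primes_infinite, of "CARD('d)"] by blast
  then obtain p :: "'d \<Rightarrow> nat" where p: "bij_betw p UNIV B"
    using finite_same_card_bij[of "UNIV :: 'd set" B] by auto
  have pr: "prime (p j)" for j using p B by (auto simp: bij_betw_def)
  have "coprime (p i) (p j)" if "i \<noteq> j" for i j
    using primes_coprime[OF pr pr] p that by (metis bij_betw_def injD)
  with pr prime_ge_2_nat show ?thesis by blast
qed

text \<open>
  By Bernstein's inequality a polynomial with frequencies in \<open>freq_box s\<close> keeps at least half of its
  maximal absolute value on a box around a point of maximum whose sides are proportional to
  \<open>2 powr (- s $ j)\<close>. Every such box contains a Halton point.
\<close>

theorem universal_discretization_exists: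
  "\<exists>C::nat. C > 0 \<and> (\<forall>n. \<exists>\<xi> :: (real^'d) set. finite \<xi> \<and> \<xi> \<noteq> {} \<and> \<xi> \<subseteq> torus \<and>
     card \<xi> \<le> C * 2 ^ n \<and> universal_discretization \<xi> 2 (H_coll n))"
proof -
  obtain p :: "'d \<Rightarrow> nat" where p: "\<And>j. p j \<ge> 2" "\<And>i j. i \<noteq> j \<Longrightarrow> coprime (p i) (p j)"
    using coprime_bases_exist by blast
  \<comment> \<open>Bernstein's inequality costs at most \<open>4 * pi * B / c\<close> in each coordinate, and half of \<open>B\<close> may be lost in total.\<close>
  define c where "c = 32 * CARD('d)"
  have c: "c > 0" by (simp add: c_def)
  define C where "C = (\<Prod>j\<in>UNIV. p j * c)"
  have p0: "p j > 0" for j using p(1)[of j] by simp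
  have C: "C > 0" unfolding C_def using p0 c by (intro prod_pos) auto
  show ?thesis
  proof (intro exI[of _ C] conjI C allI)
    fix n
    define \<xi> where "\<xi> = halton p ` {..<C * 2 ^ n}"
    have "halton p 0 \<in> \<xi>" unfolding \<xi>_def using C by (intro imageI) simp
    then have \<xi>: "finite \<xi>" "\<xi> \<noteq> {}" by (auto simp: \<xi>_def)
    have "universal_discretization \<xi> 2 (H_coll n)"
      unfolding universal_discretization_def
    proof
      fix f :: "real^'d \<Rightarrow> complex" assume "f \<in> \<Union> (H_coll n)"
      then obtain s :: "nat^'d" where s: "(\<Sum>j\<in>UNIV. s $ j) = n" and f: "f \<in> trig_polys (freq_box s)"
        by (auto simp: H_coll_def)
      define B where "B = sup_norm f"
      have fc: "continuous_on S f" for S by (rule continuous_trig_poly[OF f])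
      have fB: "norm (f x) \<le> B" if "x \<in> torus" for x
        unfolding B_def by (rule norm_le_sup_norm[OF fc that])
      have "continuous_on torus (\<lambda>x. norm (f x))" by (intro continuous_intros fc)
      moreover have "compact (torus :: (real^'d) set)" by (simp add: torus_def)
      ultimately obtain x where x: "x \<in> torus" "\<And>y. y \<in> torus \<Longrightarrow> norm (f y) \<le> norm (f x)"
        using continuous_attains_sup[OF _ torus_nonempty] by metis
      have B: "B = norm (f x)" using fB[OF x(1)] x(2) sup_norm_le[of f "norm (f x)"] by (simp add: B_def)
      then have B0: "B \<ge> 0" by simp
      obtain i where i: "i < C * 2 ^ n" "\<And>j. \<bar>halton p i $ j - x $ j\<bar> \<le> 2 * pi / (real c * 2 ^ (s $ j))"
        using halton_dispersion[where p = p and s = s, OF p c x(1)] unfolding C_def s by blast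
      define y where "y = halton p i"
      have y: "y \<in> \<xi>" "y \<in> torus" using i halton_torus[of p, OF p(1)] by (auto simp: \<xi>_def y_def)
      have "norm (f x - f y) \<le> real CARD('d) * (B / (2 * real CARD('d)))"
      proof (rule coordinatewise_bound)
        fix z j assume z: "\<And>i. z $ i = x $ i \<or> z $ i = y $ i"
        have zt: "z \<in> torus" unfolding mem_torus
        proof
          fix i show "0 \<le> z $ i \<and> z $ i \<le> 2 * pi"
            using z[of i] x(1) y(2) by (auto simp: mem_torus)
        qed
        define P where "P = (\<lambda>t. f (upd_coord z j t))"
        have P: "P \<in> tpoly (2 ^ (s $ j) - 1)" unfolding P_def by (rule slice_tpoly[OF f])
        have "norm (P t) \<le> B" for t
          by (rule tpoly_bound_extend[OF P]) (auto simp: P_def intro!: fB upd_coord_torus[OF zt])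
        then have "norm (P (x $ j) - P (y $ j)) \<le> 2 * real (2 ^ (s $ j) - 1) * B * \<bar>x $ j - y $ j\<bar>"
          by (rule bernstein[OF P])
        also have "\<dots> \<le> 2 * 2 ^ (s $ j) * B * (2 * pi / (real c * 2 ^ (s $ j)))"
          using i(2)[of j] B0 by (intro mult_mono) (auto simp: y_def abs_minus_commute)
        also have "\<dots> = 4 * pi * B / real c" by simp
        also have "\<dots> \<le> 16 * B / real c"
          using B0 pi_less_4 by (intro divide_right_mono mult_right_mono) auto
        also have "\<dots> = B / (2 * real CARD('d))" by (simp add: c_def)
        finally show "norm (f (upd_coord z j (x $ j)) - f (upd_coord z j (y $ j))) \<le> B / (2 * real CARD('d))"
          by (simp add: P_def)
      qed
      then have "norm (f x - f y) \<le> B / 2" by simp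
      then have "norm (f y) \<ge> B / 2"
        using norm_triangle_ineq2[of "f x" "f y"] unfolding B by linarith
      moreover have "norm (f y) \<le> discr_norm \<xi> f" by (rule norm_le_discr_norm[OF \<xi>(1) y(1)])
      ultimately show "sup_norm f \<le> 2 * discr_norm \<xi> f" by (simp add: B_def)
    qed
    moreover have "card \<xi> \<le> C * 2 ^ n" unfolding \<xi>_def using card_image_le[of "{..<C * 2 ^ n}" "halton p"] by simp
    moreover have "\<xi> \<subseteq> torus" using halton_torus[of p, OF p(1)] by (auto simp: \<xi>_def)
    ultimately show "\<exists>\<xi> :: (real^'d) set. finite \<xi> \<and> \<xi> \<noteq> {} \<and> \<xi> \<subseteq> torus \<and>
     card \<xi> \<le> C * 2 ^ n \<and> universal_discretization \<xi> 2 (H_coll n)"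
      using \<xi> by blast
  qed
qed

section \<open>Mixed and pure differences\<close>

lemma norm_one_minus_cis: "norm (1 - cis t) = 2 * \<bar>sin (t / 2)\<bar>"
proof -
  have "(norm (1 - cis t))\<^sup>2 = (1 - cos t)\<^sup>2 + (sin t)\<^sup>2"
    by (simp add: cmod_power2)
  also have "\<dots> = 2 - 2 * cos (2 * (t / 2))"
    using sin_cos_squared_add[of t] by (simp add: power2_eq_square algebra_simps)
  also have "\<dots> = (2 * \<bar>sin (t / 2)\<bar>)\<^sup>2"
    unfolding cos_double_sin by (simp add: power_mult_distrib)
  finally show ?thesis by (rule power2_eq_imp_eq) auto
qed

text \<open>
  Jordan's inequality, from the concavity of the sine.
\<close>

lemma sin_ge_chord:
  assumes "0 \<le> x" "x \<le> pi / 2"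
  shows "2 * x / pi \<le> sin x"
proof -
  have "concave_on {0..pi / 2} sin"
  proof (rule f''_le0_imp_concave)
    show "DERIV sin x :> cos x" "DERIV cos x :> - sin x" for x :: real
      by (auto intro!: derivative_eq_intros)
    show "x \<in> {0..pi / 2} \<Longrightarrow> - sin x \<le> 0" for x
      using sin_ge_zero[of x] by auto
  qed simp
  from concave_onD[OF this, of "2 * x / pi" 0 "pi / 2"] show ?thesis
    using assms by (simp add: field_simps)
qed

lemma norm_one_minus_cis_ge:
  assumes "\<bar>t\<bar> \<le> pi"
  shows "2 * \<bar>t\<bar> / pi \<le> norm (1 - cis t)"
proof -
  have "2 * (\<bar>t\<bar> / 2) / pi \<le> sin (\<bar>t\<bar> / 2)" using assms by (intro sin_ge_chord) auto
  moreover have "\<bar>sin (t / 2)\<bar> = \<bar>sin (\<bar>t\<bar> / 2)\<bar>" by (simp add: abs_if)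
  ultimately show ?thesis unfolding norm_one_minus_cis by linarith
qed

definition forward_diff :: "real \<Rightarrow> (real \<Rightarrow> complex) \<Rightarrow> real \<Rightarrow> complex" where
  "forward_diff \<delta> f = (\<lambda>x. f (x + \<delta>) - f x)"

fun mixed_diff :: "(nat \<Rightarrow> real) \<Rightarrow> nat \<Rightarrow> (real \<Rightarrow> complex) \<Rightarrow> real \<Rightarrow> complex" where
  "mixed_diff a 0 f x = f x"
| "mixed_diff a (Suc l) f x = mixed_diff a l f (x + a l) - mixed_diff a l f x"

text \<open>
  The coefficients are binomial, but only the one at \<open>i = 0\<close> is ever evaluated: in the identity below
  all other terms cancel.
\<close>

lemma forward_diff_power_expand:
  "\<exists>c :: nat \<Rightarrow> complex. c 0 = (- 1) ^ l \<and>
     (\<forall>\<delta> f x. (forward_diff \<delta> ^^ l) f x = (\<Sum>i\<le>l. c i * f (x + real i * \<delta>)))"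
proof (induction l)
  case (Suc l)
  then obtain c :: "nat \<Rightarrow> complex" where c: "c 0 = (- 1) ^ l"
    "\<And>\<delta> f x. (forward_diff \<delta> ^^ l) f x = (\<Sum>i\<le>l. c i * f (x + real i * \<delta>))" by blast
  define c' where "c' i = (if i = 0 then 0 else c (i - 1)) - (if i \<le> l then c i else 0)" for i
  have "(forward_diff \<delta> ^^ Suc l) f x = (\<Sum>i\<le>Suc l. c' i * f (x + real i * \<delta>))" for \<delta> f x
  proof -
    have "(\<Sum>i\<le>Suc l. (if i = 0 then 0 else c (i - 1)) * f (x + real i * \<delta>))
        = (\<Sum>i\<le>l. c i * f (x + \<delta> + real i * \<delta>))"
      by (subst sum.atMost_Suc_shift) (simp add: algebra_simps)
    moreover have "(\<Sum>i\<le>Suc l. (if i \<le> l then c i else 0) * f (x + real i * \<delta>))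
        = (\<Sum>i\<le>l. c i * f (x + real i * \<delta>))" by simp
    ultimately show ?thesis
      unfolding funpow.simps comp_def forward_diff_def[of \<delta> "(forward_diff \<delta> ^^ l) f"] c c'_def left_diff_distrib sum_subtractf
      by simp
  qed
  moreover have "c' 0 = (- 1) ^ Suc l" by (simp add: c'_def c)
  ultimately show ?case by blast
qed (simp add: exI[of _ "\<lambda>_. 1"])

lemma sum_Pow_insert:
  assumes "finite A" "i \<notin> A"
  shows "(\<Sum>e\<in>Pow (insert i A). F e) = (\<Sum>e\<in>Pow A. F e + F (insert i e))"
proof -
  have inj: "inj_on (insert i) (Pow A)" using assms by (auto simp: inj_on_def)
  have "(\<Sum>e\<in>Pow (insert i A). F e) = (\<Sum>e\<in>Pow A. F e) + (\<Sum>e\<in>insert i ` Pow A. F e)"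
    unfolding Pow_insert using assms by (intro sum.union_disjoint) auto
  then show ?thesis by (simp add: sum.reindex[OF inj] sum.distrib)
qed

lemma mixed_diff_expand:
  "mixed_diff a l f x = (- 1) ^ l * (\<Sum>e\<in>Pow {..<l}. (- 1) ^ card e * f (x + (\<Sum>k\<in>e. a k)))"
proof (induction l arbitrary: x)
  case (Suc l)
  have e: "card (insert l e) = Suc (card e) \<and> (\<Sum>k\<in>insert l e. a k) = a l + (\<Sum>k\<in>e. a k)"
    if "e \<in> Pow {..<l}" for e
  proof -
    have "finite e" "l \<notin> e" using that by (auto intro: finite_subset)
    then show ?thesis by simp
  qed
  have "(\<Sum>e\<in>Pow {..<Suc l}. (- 1) ^ card e * f (x + (\<Sum>k\<in>e. a k)))
     = (\<Sum>e\<in>Pow {..<l}. (- 1) ^ card e * f (x + (\<Sum>k\<in>e. a k))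
          + (- 1) ^ card (insert l e) * f (x + (\<Sum>k\<in>insert l e. a k)))"
    unfolding lessThan_Suc by (subst sum_Pow_insert) auto
  also have "\<dots> = (\<Sum>e\<in>Pow {..<l}. (- 1) ^ card e * f (x + (\<Sum>k\<in>e. a k)))
      - (\<Sum>e\<in>Pow {..<l}. (- 1) ^ card e * f (x + a l + (\<Sum>k\<in>e. a k)))"
    unfolding sum_subtractf[symmetric] by (intro sum.cong refl) (simp add: e add.assoc)
  finally have *: "(\<Sum>e\<in>Pow {..<Suc l}. (- 1) ^ card e * f (x + (\<Sum>k\<in>e. a k))) = \<dots>" .
  show ?case unfolding * mixed_diff.simps Suc.IH by (simp only: power_Suc) (simp add: right_diff_distrib)
qed simp

text \<open>
  Kemperman's identity. After expanding the pure differences, the terms with index \<open>i\<close> have arguments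
  \<open>x + (\<Sum>k\<in>e. a k * (1 - i / (k + 1)))\<close>. For \<open>i = j + 1\<close> the summand \<open>k = j\<close> vanishes, so the sets \<open>e\<close> with
  and without \<open>j\<close> cancel in pairs; only \<open>i = 0\<close> survives and gives the mixed difference. The identity is
  needed because iterated averaging produces mixed differences, whereas a Nikol'skii class controls
  pure differences only.
\<close>

lemma mixed_difference_by_pure_differences:
  "mixed_diff a l f x = (\<Sum>e\<in>Pow {..<l}. (- 1) ^ card e *
     (forward_diff (- (\<Sum>k\<in>e. a k / real (Suc k))) ^^ l) f (x + (\<Sum>k\<in>e. a k)))"
proof -
  obtain c :: "nat \<Rightarrow> complex" where c: "c 0 = (- 1) ^ l"
    "\<And>\<delta> f x. (forward_diff \<delta> ^^ l) f x = (\<Sum>i\<le>l. c i * f (x + real i * \<delta>))"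
    using forward_diff_power_expand by blast
  define S where "S i = (\<Sum>e\<in>Pow {..<l}. (- 1) ^ card e *
      f (x + (\<Sum>k\<in>e. a k * (1 - real i / real (Suc k)))))" for i
  have arg: "x + (\<Sum>k\<in>e. a k) + real i * - (\<Sum>k\<in>e. a k / real (Suc k))
      = x + (\<Sum>k\<in>e. a k * (1 - real i / real (Suc k)))" for e i
    by (simp add: sum_subtractf sum_distrib_left algebra_simps)
  have "(\<Sum>e\<in>Pow {..<l}. (- 1) ^ card e *
     (forward_diff (- (\<Sum>k\<in>e. a k / real (Suc k))) ^^ l) f (x + (\<Sum>k\<in>e. a k))) = (\<Sum>i\<le>l. c i * S i)"
    unfolding c arg S_def sum_distrib_left by (subst sum.swap) (simp add: mult_ac)
  also have "\<dots> = (\<Sum>i\<in>{0}. c i * S i)"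
  proof (rule sum.mono_neutral_right)
    show "\<forall>i\<in>{..l} - {0}. c i * S i = 0"
    proof
      fix i assume i: "i \<in> {..l} - {0}"
      then obtain j where j: "i = Suc j" "j < l" by (cases i) auto
      let ?b = "\<lambda>k. a k * (1 - real i / real (Suc k))"
      have b0: "?b j = 0" by (simp add: j)
      have A: "{..<l} = insert j ({..<l} - {j})" using j by auto
      have e: "(- 1) ^ card (insert j e) * f (x + sum ?b (insert j e)) = - ((- 1) ^ card e * f (x + sum ?b e))"
        if "e \<in> Pow ({..<l} - {j})" for e
      proof -
        have "finite e" "j \<notin> e" using that finite_subset[of e "{..<l} - {j}"] by auto
        then have "sum ?b (insert j e) = ?b j + sum ?b e" "card (insert j e) = Suc (card e)"
          by (rule sum.insert, intro card_insert_disjoint)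
        then show ?thesis unfolding b0 by (simp only: power_Suc) simp
      qed
      have "S i = 0" unfolding S_def
        by (subst A, subst sum_Pow_insert) (auto simp: e simp del: of_nat_Suc)
      then show "c i * S i = 0" by simp
    qed
  qed auto
  also have "\<dots> = mixed_diff a l f x" by (simp add: c(1) S_def mixed_diff_expand)
  finally show ?thesis by simp
qed

lemma mixed_diff_bound:
  assumes "r > 0" "l > 0" and d: "\<And>\<delta> x. norm ((forward_diff \<delta> ^^ l) f x) \<le> \<bar>\<delta>\<bar> powr r"
  shows "norm (mixed_diff a l f x) \<le> 2 ^ l * real l powr r * (\<Sum>k<l. \<bar>a k\<bar> powr r)"
proof -
  define b where "b = Max ((\<lambda>k. \<bar>a k\<bar>) ` {..<l})"
  have "b \<in> (\<lambda>k. \<bar>a k\<bar>) ` {..<l}" unfolding b_def using assms by (intro Max_in) auto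
  then obtain j where j: "j < l" "b = \<bar>a j\<bar>" by auto
  have ab: "\<bar>a k\<bar> \<le> b" if "k < l" for k unfolding b_def using that by (intro Max_ge) auto
  have e: "\<bar>- (\<Sum>k\<in>e. a k / real (Suc k))\<bar> \<le> real l * b" if "e \<in> Pow {..<l}" for e
  proof -
    have "\<bar>- (\<Sum>k\<in>e. a k / real (Suc k))\<bar> \<le> (\<Sum>k\<in>e. \<bar>a k / real (Suc k)\<bar>)"
      unfolding abs_minus_cancel by (rule sum_abs)
    also have "\<dots> \<le> (\<Sum>k\<in>e. b)"
    proof (rule sum_mono)
      fix k assume "k \<in> e"
      then have "\<bar>a k\<bar> \<le> b" using that ab by auto
      moreover have "\<bar>a k\<bar> / real (Suc k) \<le> \<bar>a k\<bar> / 1" by (intro divide_left_mono) auto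
      ultimately show "\<bar>a k / real (Suc k)\<bar> \<le> b" by simp
    qed
    also have "\<dots> \<le> real l * b"
      using card_mono[of "{..<l}" e] that j by (auto intro!: mult_right_mono)
    finally show ?thesis .
  qed
  have "norm (mixed_diff a l f x) \<le> (\<Sum>e\<in>Pow {..<l}. norm ((- 1) ^ card e *
     (forward_diff (- (\<Sum>k\<in>e. a k / real (Suc k))) ^^ l) f (x + (\<Sum>k\<in>e. a k))))"
    unfolding mixed_difference_by_pure_differences by (rule norm_sum)
  also have "\<dots> \<le> (\<Sum>e\<in>Pow {..<l}. (real l * b) powr r)"
    using e \<open>r > 0\<close>
    by (intro sum_mono order_trans[OF eq_refl[OF norm_mult]])
       (auto simp: norm_power intro!: order_trans[OF d] powr_mono2)
  also have "\<dots> = 2 ^ l * real l powr r * \<bar>a j\<bar> powr r"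
    by (simp add: card_Pow powr_mult j)
  also have "\<dots> \<le> 2 ^ l * real l powr r * (\<Sum>k<l. \<bar>a k\<bar> powr r)"
    using j by (intro mult_left_mono member_le_sum) auto
  finally show ?thesis .
qed

section \<open>Jackson's theorem under a condition on differences\<close>

definition avg_op :: "nat \<Rightarrow> (nat \<Rightarrow> real) \<Rightarrow> (nat \<Rightarrow> real) \<Rightarrow> (real \<Rightarrow> complex) \<Rightarrow> real \<Rightarrow> complex" where
  "avg_op M w \<tau> u x = (\<Sum>m<M. of_real (w m) * u (x + \<tau> m))"

definition res_op :: "nat \<Rightarrow> (nat \<Rightarrow> real) \<Rightarrow> (nat \<Rightarrow> real) \<Rightarrow> (real \<Rightarrow> complex) \<Rightarrow> real \<Rightarrow> complex" where
  "res_op M w \<tau> u = (\<lambda>x. u x - avg_op M w \<tau> u x)"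

lemma mixed_diff_res_op:
  "mixed_diff a l (res_op M w \<tau> u) x = mixed_diff a l u x - (\<Sum>m<M. of_real (w m) * mixed_diff a l u (x + \<tau> m))"
proof (induction l arbitrary: x)
  case (Suc l)
  show ?case unfolding mixed_diff.simps Suc.IH by (simp add: sum_subtractf right_diff_distrib add_ac)
qed (simp add: res_op_def avg_op_def)

lemma mixed_diff_cong: "(\<And>k. k < l \<Longrightarrow> a k = b k) \<Longrightarrow> mixed_diff a l f x = mixed_diff b l f x"
  by (induction l arbitrary: x) auto

text \<open>
  As the weights sum to 1, the residual is an average of differences:
  \<open>res_op M w \<tau> u = - (\<Sum>m<M. w m * forward_diff (\<tau> m) u)\<close>. So \<open>l\<close> residuals amount to an average of mixed
  differences of order \<open>l\<close>; the induction trades one residual for one difference with step \<open>\<tau> m\<close>.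
\<close>

lemma res_op_power_bound:
  assumes w: "\<And>m. m < M \<Longrightarrow> w m \<ge> 0" "(\<Sum>m<M. w m) = 1" and "C \<ge> 0"
    and f: "\<And>a x. norm (mixed_diff a l f x) \<le> C * (\<Sum>k<l. \<bar>a k\<bar> powr r)"
  shows "norm ((res_op M w \<tau> ^^ l) f x) \<le> C * (real l * (\<Sum>m<M. w m * \<bar>\<tau> m\<bar> powr r))"
proof -
  let ?R = "res_op M w \<tau>" and ?\<mu> = "\<Sum>m<M. w m * \<bar>\<tau> m\<bar> powr r"
  have "norm (mixed_diff a (l - b) ((?R ^^ b) f) x) \<le> C * ((\<Sum>k<l - b. \<bar>a k\<bar> powr r) + real b * ?\<mu>)"
    if "b \<le> l" for a b x
    using that
  proof (induction b arbitrary: a x)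
    case (Suc b)
    define b' u where "b' = l - Suc b" and "u = (?R ^^ b) f"
    have lb: "l - b = Suc b'" using Suc.prems by (simp add: b'_def)
    have step: "norm (mixed_diff a b' u (x + t) - mixed_diff a b' u x)
        \<le> C * ((\<Sum>k<b'. \<bar>a k\<bar> powr r) + \<bar>t\<bar> powr r + real b * ?\<mu>)" for t
    proof -
      have "mixed_diff (a(b' := t)) b' u y = mixed_diff a b' u y" for y by (rule mixed_diff_cong) auto
      then have "mixed_diff a b' u (x + t) - mixed_diff a b' u x = mixed_diff (a(b' := t)) (l - b) u x"
        by (simp add: lb)
      also have "norm \<dots> \<le> C * ((\<Sum>k<l - b. \<bar>(a(b' := t)) k\<bar> powr r) + real b * ?\<mu>)"
        unfolding u_def by (rule Suc.IH) (use Suc.prems in simp)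
      finally show ?thesis by (simp add: lb)
    qed
    have "mixed_diff a b' (?R u) x = - (\<Sum>m<M. of_real (w m) * (mixed_diff a b' u (x + \<tau> m) - mixed_diff a b' u x))"
    proof -
      have "(\<Sum>m<M. of_real (w m) * mixed_diff a b' u x) = mixed_diff a b' u x"
        unfolding sum_distrib_right[symmetric] of_real_sum[symmetric] w by simp
      then show ?thesis by (simp add: mixed_diff_res_op right_diff_distrib sum_subtractf)
    qed
    then have "norm (mixed_diff a b' (?R u) x)
        \<le> (\<Sum>m<M. w m * (C * ((\<Sum>k<b'. \<bar>a k\<bar> powr r) + \<bar>\<tau> m\<bar> powr r + real b * ?\<mu>)))"
      using w step by (auto simp: norm_mult intro!: order_trans[OF norm_sum] sum_mono mult_left_mono)
    also have "\<dots> = (\<Sum>m<M. w m) * (C * ((\<Sum>k<b'. \<bar>a k\<bar> powr r) + real b * ?\<mu>)) + C * ?\<mu>"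
    proof -
      have "w m * (C * (A + T + B)) = w m * (C * (A + B)) + C * (w m * T)" for m A B T
        by (simp add: algebra_simps)
      then show ?thesis by (simp only: sum.distrib sum_distrib_right sum_distrib_left)
    qed
    also have "\<dots> = C * ((\<Sum>k<b'. \<bar>a k\<bar> powr r) + real (Suc b) * ?\<mu>)"
      unfolding w by (simp add: algebra_simps)
    finally show ?case unfolding b'_def u_def by simp
  qed (use f in auto)
  from this[of l "\<lambda>_. 0" x] show ?thesis by simp
qed

text \<open>
  For an operator \<open>K\<close>, the difference \<open>1 - (1 - K) ^ l\<close> factors as \<open>K\<close> times a sum of powers of \<open>1 - K\<close>;
  hence what is subtracted from \<open>f\<close> is again an average, and becomes a polynomial if \<open>K\<close> is a
  convolution with a polynomial kernel.
\<close>

lemma res_op_power_eq: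
  assumes "\<And>x. f (x + 2 * pi) = f x"
  shows "\<exists>u. (\<forall>x. u (x + 2 * pi) = u x) \<and> (\<forall>x. (res_op M w \<tau> ^^ l) f x = f x - avg_op M w \<tau> u x)"
proof -
  let ?R = "res_op M w \<tau>"
  have per: "(?R ^^ b) f (x + 2 * pi) = (?R ^^ b) f x" for b x
  proof (induction b arbitrary: x)
    case (Suc b)
    have "(?R ^^ b) f (x + 2 * pi + \<tau> m) = (?R ^^ b) f (x + \<tau> m)" for m
      using Suc.IH[of "x + \<tau> m"] by (simp add: add_ac)
    then show ?case by (simp add: res_op_def[of _ _ _ "(_ ^^ _) _"] avg_op_def[of _ _ _ "(_ ^^ _) _"] Suc.IH)
  qed (use assms in simp)
  show ?thesis
  proof (induction l)
    case 0
    show ?case by (intro exI[of _ "\<lambda>_. 0"]) (simp add: avg_op_def)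
  next
    case (Suc l)
    then obtain u where u: "\<And>x. u (x + 2 * pi) = u x" "\<And>x. (?R ^^ l) f x = f x - avg_op M w \<tau> u x" by blast
    show ?case
    proof (intro exI[of _ "\<lambda>x. u x + (?R ^^ l) f x"] conjI allI)
      show "(?R ^^ Suc l) f x = f x - avg_op M w \<tau> (\<lambda>x. u x + (?R ^^ l) f x) x" for x
      proof -
        have "(?R ^^ Suc l) f x = (?R ^^ l) f x - avg_op M w \<tau> ((?R ^^ l) f) x"
          by (simp add: res_op_def)
        also have "\<dots> = f x - (avg_op M w \<tau> u x + avg_op M w \<tau> ((?R ^^ l) f) x)"
          by (simp only: u(2)) simp
        finally show ?thesis by (simp add: avg_op_def sum.distrib algebra_simps)
      qed
    qed (simp add: u per)
  qed
qed

lemma node_shift_sum: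
  assumes per: "\<And>x. F (x + 2 * pi) = (F x :: complex)" and "M > 0"
  shows "(\<Sum>m<M. F (node M q + node M m)) = (\<Sum>m<M. F (node M m))"
proof (induction q)
  case 0
  show ?case by (simp add: node_def)
next
  case (Suc q)
  have "node M (Suc q) + node M m = node M q + node M (Suc m)" for m
    by (simp add: node_def add_divide_distrib algebra_simps)
  then have "(\<Sum>m<M. F (node M (Suc q) + node M m)) = (\<Sum>m<M. F (node M q + node M (Suc m)))" by simp
  also have "F (node M q + node M 0) + \<dots> = (\<Sum>m<Suc M. F (node M q + node M m))"
    by (simp only: sum.lessThan_Suc_shift)
  also have "\<dots> = (\<Sum>m<M. F (node M q + node M m)) + F (node M q + node M M)" by simp
  also have "F (node M q + node M M) = F (node M q + node M 0)"
    using per[of "node M q"] \<open>M > 0\<close> by (simp add: node_def)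
  finally show ?case using Suc by simp
qed

lemma sum_inverse_squares_le: "(\<Sum>m<k. 1 / (real (Suc m))\<^sup>2) \<le> 2"
proof -
  have "(\<Sum>m<k. 1 / (real (Suc m))\<^sup>2) \<le> 2 - 1 / real k"
  proof (induction k)
    case (Suc k)
    show ?case
    proof (cases "k = 0")
      case False
      have "1 / (real (Suc k))\<^sup>2 \<le> 1 / (real k * real (Suc k))"
        using False by (intro divide_left_mono) (auto simp: power2_eq_square)
      also have "\<dots> = 1 / real k - 1 / real (Suc k)"
        using False by (simp add: field_simps)
      finally show ?thesis using Suc.IH by simp
    qed simp
  qed simp
  also have "\<dots> \<le> 2" by simp
  finally show ?thesis .
qed

text \<open>
  The nodes, moved by a period into \<open>[- pi, pi]\<close>, where the decay of the kernel is expressed by \<open>\<bar>t\<bar>\<close>.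
\<close>

definition signed_node :: "nat \<Rightarrow> nat \<Rightarrow> real" where
  "signed_node M m = (if 2 * m \<le> M then node M m else node M m - 2 * pi)"

lemma abs_signed_node:
  assumes "m < M"
  shows "\<bar>signed_node M m\<bar> = 2 * pi / real M * real (min m (M - m))"
proof (cases "2 * m \<le> M")
  case True
  then show ?thesis by (simp add: signed_node_def node_def)
next
  case False
  then have "signed_node M m = - (2 * pi / real M * real (M - m))"
    using assms by (simp add: signed_node_def node_def field_simps of_nat_diff)
  then show ?thesis using False assms by (simp add: abs_mult abs_minus_commute)
qed

lemma fejer_decay:
  assumes "t \<noteq> 0" "\<bar>t\<bar> \<le> pi"
  shows "fejer q t \<le> pi\<^sup>2 / t\<^sup>2"
proof -
  have c: "2 * \<bar>t\<bar> / pi \<le> norm (1 - cis t)" by (rule norm_one_minus_cis_ge) fact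
  then have "norm (1 - cis t) > 0" using assms by (smt (verit) divide_pos_pos pi_gt_zero zero_less_abs_iff)
  then have ne: "cis t \<noteq> 1" by auto
  have "norm (\<Sum>j<q. wave (int j) t) = norm (1 - cis t ^ q) / norm (1 - cis t)"
    using ne by (simp add: wave_eq_power geometric_sum norm_divide norm_minus_commute)
  also have "\<dots> \<le> 2 / (2 * \<bar>t\<bar> / pi)"
    using c assms by (intro frac_le order_trans[OF norm_triangle_ineq4]) (auto simp: norm_power)
  finally have "norm (\<Sum>j<q. wave (int j) t) \<le> pi / \<bar>t\<bar>" using assms by simp
  then have "fejer q t \<le> (pi / \<bar>t\<bar>)\<^sup>2" unfolding fejer_def by (rule power_mono) simp
  then show ?thesis by (simp add: power_divide)
qed

text \<open>
  The kernel decays like \<open>\<bar>t\<bar> powr (- 2 * p)\<close>, and \<open>2 * p \<ge> r + 2\<close> leaves a summable factor \<open>1 / m\<^sup>2\<close>,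
  counted from both ends of the period. The node 0, where the kernel is largest, contributes nothing
  since \<open>r > 0\<close>.
\<close>

lemma jackson_moment:
  assumes "r > 0" "real (2 * p) \<ge> r + 2" "M > 0"
  shows "(\<Sum>m<M. fejer q (signed_node M m) ^ p * \<bar>signed_node M m\<bar> powr r)
     \<le> 4 * pi ^ (2 * p) * (2 * pi / real M) powr (r - real (2 * p))"
proof -
  let ?t = "signed_node M" and ?D = "pi ^ (2 * p) * (2 * pi / real M) powr (r - real (2 * p))"
  obtain M' where M': "M = Suc M'" using assms(3) by (cases M) auto
  have main: "fejer q (?t m) ^ p * \<bar>?t m\<bar> powr r \<le> ?D * (1 / (real m)\<^sup>2 + 1 / (real (M - m))\<^sup>2)"
    if m: "0 < m" "m < M" for m
  proof -
    define \<mu> where "\<mu> = min m (M - m)"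
    have mu: "\<mu> \<ge> 1" using m by (auto simp: \<mu>_def)
    have at: "\<bar>?t m\<bar> = 2 * pi / real M * real \<mu>" using abs_signed_node[OF m(2)] by (simp add: \<mu>_def)
    have pos: "\<bar>?t m\<bar> > 0" unfolding at using mu assms by (intro mult_pos_pos) auto
    have "2 * real \<mu> \<le> real M" by (auto simp: \<mu>_def)
    then have le: "\<bar>?t m\<bar> \<le> pi" unfolding at using assms by (simp add: field_simps)
    have "fejer q (?t m) ^ p \<le> (pi\<^sup>2 / (?t m)\<^sup>2) ^ p"
      using pos le by (intro power_mono fejer_decay fejer_nonneg) auto
    also have "\<dots> = pi ^ (2 * p) * \<bar>?t m\<bar> powr (- real (2 * p))"
      unfolding powr_minus powr_realpow[OF pos]
      by (simp add: power_mult divide_inverse power_mult_distrib power_inverse)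
    finally have "fejer q (?t m) ^ p * \<bar>?t m\<bar> powr r
        \<le> pi ^ (2 * p) * \<bar>?t m\<bar> powr (- real (2 * p)) * \<bar>?t m\<bar> powr r"
      by (intro mult_right_mono) auto
    also have "\<dots> = pi ^ (2 * p) * \<bar>?t m\<bar> powr (r - real (2 * p))"
      by (simp add: powr_add[symmetric] mult.assoc)
    also have "\<dots> = ?D * real \<mu> powr (r - real (2 * p))"
      unfolding at powr_mult by (simp only: mult.assoc)
    also have "\<dots> \<le> ?D * real \<mu> powr (- 2)"
      using mu assms by (intro mult_left_mono powr_mono) auto
    also have "real \<mu> powr (- 2) = 1 / (real \<mu>)\<^sup>2"
      using mu powr_realpow[of "real \<mu>" 2] by (simp add: powr_minus divide_inverse)
    also have "?D * (1 / (real \<mu>)\<^sup>2) \<le> ?D * (1 / (real m)\<^sup>2 + 1 / (real (M - m))\<^sup>2)"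
      by (intro mult_left_mono) (auto simp: \<mu>_def min_def)
    finally show ?thesis .
  qed
  have "(\<Sum>m<M. fejer q (?t m) ^ p * \<bar>?t m\<bar> powr r)
      = (\<Sum>m<M'. fejer q (?t (Suc m)) ^ p * \<bar>?t (Suc m)\<bar> powr r)"
    unfolding M' by (subst sum.lessThan_Suc_shift) (simp add: signed_node_def node_def)
  also have "\<dots> \<le> (\<Sum>m<M'. ?D * (1 / (real (Suc m))\<^sup>2 + 1 / (real (M - Suc m))\<^sup>2))"
    by (intro sum_mono main) (auto simp: M')
  also have "\<dots> = ?D * ((\<Sum>m<M'. 1 / (real (Suc m))\<^sup>2) + (\<Sum>m<M'. 1 / (real (M' - m))\<^sup>2))"
    unfolding sum_distrib_left[symmetric] sum.distrib by (simp add: M')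
  also have "(\<Sum>m<M'. 1 / (real (M' - m))\<^sup>2) = (\<Sum>m<M'. 1 / (real (Suc m))\<^sup>2)"
    by (subst sum.nat_diff_reindex[symmetric]) (auto intro!: sum.cong simp: Suc_diff_Suc)
  also have "?D * ((\<Sum>m<M'. 1 / (real (Suc m))\<^sup>2) + (\<Sum>m<M'. 1 / (real (Suc m))\<^sup>2)) \<le> ?D * (2 + 2)"
    by (intro mult_left_mono add_mono sum_inverse_squares_le) auto
  finally show ?thesis by (simp add: mult_ac)
qed

text \<open>
  Jackson's theorem on a grid of \<open>4 * n\<close> nodes. The average against the normalized kernel \<open>fejer q ^ p\<close>
  is a translation average for arbitrary arguments, so its residual of order \<open>l\<close> is bounded by the
  moment of order \<open>r\<close> through mixed differences; at grid points it is also a discrete convolution, so it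
  agrees there with a polynomial. Since the number of nodes is comparable with \<open>n\<close>, the single summand
  at 0 bounds the normalizing sum \<open>Z\<close> from below well enough.
\<close>

lemma jackson_on_grid:
  assumes r: "r > 0"
  shows "\<exists>C>0. \<forall>n>0. \<forall>f. (\<forall>x. f (x + 2 * pi) = f x) \<longrightarrow>
     (\<forall>\<delta> x. norm ((forward_diff \<delta> ^^ (nat \<lfloor>r\<rfloor> + 1)) f x) \<le> \<bar>\<delta>\<bar> powr r) \<longrightarrow>
     (\<exists>P\<in>tpoly (n div 2). \<forall>m. norm (f (node (4 * n) m) - P (node (4 * n) m)) \<le> C * real n powr (- r))"
proof -
  define l where "l = nat \<lfloor>r\<rfloor> + 1"
  \<comment> \<open>the power of the Fejer kernel for which the moment of order \<open>r\<close> converges\<close>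
  define p where "p = nat \<lceil>r\<rceil> + 1"
  have p: "real (2 * p) \<ge> r + 2" "p > 0"
  proof -
    define c where "c = nat \<lceil>r\<rceil>"
    have "r \<le> real c" "p = c + 1" unfolding c_def p_def by (rule real_nat_ceiling_ge) simp
    then show "real (2 * p) \<ge> r + 2" "p > 0" using r by auto
  qed
  define C0 where "C0 = 2 ^ l * real l powr r * real l"
  define C where "C = C0 * (4 * pi ^ (2 * p) * (pi / 2) powr (r - real (2 * p)) * real (2 * p) ^ (2 * p))"
  have C: "C > 0" unfolding C_def C0_def l_def using p by (auto intro!: mult_pos_pos)
  show ?thesis
  proof (intro exI[of _ C] conjI C allI impI)
    fix n :: nat and f :: "real \<Rightarrow> complex"
    assume n: "n > 0" and per: "\<forall>x. f (x + 2 * pi) = f x"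
      and d: "\<forall>\<delta> x. norm ((forward_diff \<delta> ^^ (nat \<lfloor>r\<rfloor> + 1)) f x) \<le> \<bar>\<delta>\<bar> powr r"
    \<comment> \<open>The kernel has degree \<open>p * (q - 1) \<le> n div 2\<close>, and yet \<open>q\<close> is comparable with \<open>n\<close>.\<close>
    define M q where "M = 4 * n" and "q = (n div 2) div p + 1"
    have M: "M > 0" using n by (simp add: M_def)
    let ?J = "\<lambda>t. fejer q t ^ p"
    define Z where "Z = (\<Sum>m<M. ?J (node M m))"
    have q_ge: "real q \<ge> real n / real (2 * p)"
    proof -
      have "n div 2 < q * p" using p(2) unfolding q_def by (simp add: dividend_less_div_times add.commute)
      then have "n \<le> 2 * (q * p)" by linarith
      then have "real n \<le> real (2 * (q * p))" by (simp only: of_nat_le_iff)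
      then have "real n \<le> real q * real (2 * p)" by simp
      then show ?thesis using p(2) by (simp add: field_simps)
    qed
    have Z: "Z \<ge> (real n / real (2 * p)) ^ (2 * p)"
    proof -
      have "(real n / real (2 * p)) ^ (2 * p) \<le> real q ^ (2 * p)"
        using q_ge by (intro power_mono) auto
      also have "\<dots> = ?J (node M 0)" by (simp add: fejer_def node_def power_mult)
      also have "\<dots> \<le> Z" unfolding Z_def using M by (intro member_le_sum) (auto simp: fejer_nonneg)
      finally show ?thesis .
    qed
    moreover have "(real n / real (2 * p)) ^ (2 * p) > 0" using n p by simp
    ultimately have Zpos: "Z > 0" by linarith
    define w where "w m = ?J (node M m) / Z" for m
    let ?t = "signed_node M"
    have fejer_per: "fejer q (x + 2 * pi) = fejer q x" for x
      by (simp add: fejer_def wave_periodic)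
    have w_alt: "w m = ?J (?t m) / Z" for m
      using fejer_per[of "node M m - 2 * pi"] by (simp add: w_def signed_node_def)
    have w0: "w m \<ge> 0" for m using Zpos by (simp add: w_def fejer_nonneg)
    have w1: "(\<Sum>m<M. w m) = 1" using Zpos by (simp add: w_def sum_divide_distrib[symmetric] Z_def)
    have mom: "(\<Sum>m<M. w m * \<bar>?t m\<bar> powr r)
       \<le> (4 * pi ^ (2 * p) * (pi / 2) powr (r - real (2 * p)) * real (2 * p) ^ (2 * p)) * real n powr (- r)"
    proof -
      have "(\<Sum>m<M. w m * \<bar>?t m\<bar> powr r) = (\<Sum>m<M. ?J (?t m) * \<bar>?t m\<bar> powr r) / Z"
        by (simp add: w_alt sum_divide_distrib)
      also have "\<dots> \<le> (4 * pi ^ (2 * p) * (2 * pi / real M) powr (r - real (2 * p)))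
           / (real n / real (2 * p)) ^ (2 * p)"
        using Z n p by (intro frac_le jackson_moment r p M) auto
      also have "2 * pi / real M = pi / 2 / real n" by (simp add: M_def)
      also have "(pi / 2 / real n) powr (r - real (2 * p))
          = (pi / 2) powr (r - real (2 * p)) * real n ^ (2 * p) * real n powr (- r)"
      proof -
        have "real n powr (r - real (2 * p)) = real n powr r / real n ^ (2 * p)"
          using n by (simp add: powr_diff powr_realpow[symmetric])
        then show ?thesis unfolding powr_divide using n by (simp add: powr_minus field_simps)
      qed
      finally show ?thesis using n p by (simp add: power_divide field_simps)
    qed
    have near: "norm ((res_op M w ?t ^^ l) f x) \<le> C * real n powr (- r)" for x
    proof -
      have "norm ((res_op M w ?t ^^ l) f x)
          \<le> (2 ^ l * real l powr r) * (real l * (\<Sum>m<M. w m * \<bar>?t m\<bar> powr r))"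
        using d r by (intro res_op_power_bound w0 w1 mixed_diff_bound) (auto simp: l_def)
      also have "\<dots> = C0 * (\<Sum>m<M. w m * \<bar>?t m\<bar> powr r)" by (simp add: C0_def)
      also have "\<dots> \<le> C0 * ((4 * pi ^ (2 * p) * (pi / 2) powr (r - real (2 * p)) * real (2 * p) ^ (2 * p)) * real n powr (- r))"
        by (intro mult_left_mono mom) (simp add: C0_def)
      finally show ?thesis by (simp add: C_def mult.assoc)
    qed
    obtain u where u: "\<And>x. u (x + 2 * pi) = u x" "\<And>x. (res_op M w ?t ^^ l) f x = f x - avg_op M w ?t u x"
      using res_op_power_eq[of f l M w ?t] per by blast
    define P where "P = (\<lambda>x. \<Sum>m<M. (u (node M m) / of_real Z) * complex_of_real (?J (node M m - x)))"
    show "\<exists>P\<in>tpoly (n div 2). \<forall>m. norm (f (node (4 * n) m) - P (node (4 * n) m)) \<le> C * real n powr (- r)"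
    proof (intro bexI allI)
      have "p * (q - 1) \<le> n div 2" by (simp add: q_def)
      then have "(\<lambda>t. complex_of_real (?J t)) \<in> tpoly (n div 2)"
        using tpoly_mono[OF tpoly_power[OF tpoly_fejer[of q], of p]] by simp
      then show "P \<in> tpoly (n div 2)" unfolding P_def
        by (intro tpoly_sum tpoly_cmult tpoly_reflect)
      fix k
      define x where "x = node M k"
      have "avg_op M w ?t u x = (\<Sum>m<M. of_real (w m) * u (x + node M m))"
        unfolding avg_op_def signed_node_def using u(1)[of "x + node M _ - 2 * pi"]
        by (intro sum.cong refl) (simp add: algebra_simps)
      also have "\<dots> = (\<Sum>m<M. of_real (?J (x + node M m - x) / Z) * u (x + node M m))"
        by (simp add: w_def)
      also have "\<dots> = P x" unfolding P_def x_def
        by (subst node_shift_sum[OF _ M, of "\<lambda>y. of_real (?J (y - node M k) / Z) * u y"])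
           (use u(1) fejer_per[of "_ - node M k"] in \<open>auto simp: algebra_simps\<close>)
      finally have "f x - P x = (res_op M w ?t ^^ l) f x" by (simp add: u)
      then show "norm (f (node (4 * n) k) - P (node (4 * n) k)) \<le> C * real n powr (- r)"
        using near[of x] by (simp add: x_def M_def)
    qed
  qed
qed

lemma node_refine: "a > 0 \<Longrightarrow> node M m = node (a * M) (a * m)"
  by (simp add: node_def)

text \<open>
  Both operators fix \<open>P\<close> and use only nodes of the grid of size \<open>4 * n\<close>, so an error bound on that grid
  bounds their difference everywhere.
\<close>

lemma vp_double_step:
  assumes "n > 0" and P: "P \<in> tpoly (n div 2)"
    and e: "\<And>m. norm (f (node (4 * n) m) - P (node (4 * n) m)) \<le> \<epsilon>"
  shows "norm (vp (2 * n) f x - vp n f x) \<le> 6 * \<epsilon>"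
    and "norm (f (node (4 * n) m) - vp n f (node (4 * n) m)) \<le> 4 * \<epsilon>"
proof -
  let ?d = "\<lambda>t. f t - P t"
  have b1: "norm (vp n ?d y) \<le> 3 * \<epsilon>" for y
    by (rule vp_bound[OF \<open>n > 0\<close>]) (use e node_refine[of 2 "2 * n"] in auto)
  have b2: "norm (vp (2 * n) ?d y) \<le> 3 * \<epsilon>" for y
    by (rule vp_bound) (use e \<open>n > 0\<close> in auto)
  have r1: "vp n f y = vp n ?d y + P y" for y
    using vp_reproduces[OF \<open>n > 0\<close> P] by (simp add: vp_diff)
  have "P \<in> tpoly (2 * n div 2)" by (rule tpoly_mono[OF P]) auto
  then have r2: "vp (2 * n) f y = vp (2 * n) ?d y + P y" for y
    using vp_reproduces[of "2 * n" P] \<open>n > 0\<close> by (simp add: vp_diff)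
  show "norm (vp (2 * n) f x - vp n f x) \<le> 6 * \<epsilon>"
    unfolding r1 r2 using norm_triangle_ineq4[of "vp (2 * n) ?d x" "vp n ?d x"] b1[of x] b2[of x] by simp
  let ?y = "node (4 * n) m"
  have "f ?y - vp n f ?y = ?d ?y - vp n ?d ?y" unfolding r1 by simp
  then have "norm (f ?y - vp n f ?y) = norm (?d ?y - vp n ?d ?y)" by (rule arg_cong)
  then show "norm (f ?y - vp n f ?y) \<le> 4 * \<epsilon>"
    using norm_triangle_ineq4[of "?d ?y" "vp n ?d ?y"] b1[of ?y] e[of m] by linarith
qed

lemma nodes_dense:
  assumes "0 \<le> x"
  shows "\<exists>m. (\<lambda>q. node (4 * 2 ^ q) (m q)) \<longlonglongrightarrow> x"
proof -
  define m where "m q = nat \<lfloor>x / (2 * pi) * real (4 * 2 ^ q)\<rfloor>" for q :: nat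
  have "\<bar>node (4 * 2 ^ q) (m q) - x\<bar> \<le> 2 * pi * (1 / 2) ^ q" for q
  proof -
    let ?M = "real (4 * 2 ^ q)" and ?y = "x / (2 * pi) * real (4 * 2 ^ q)"
    have y0: "?y \<ge> 0" using assms by simp
    then have "\<bar>real (m q) - ?y\<bar> \<le> 1" unfolding m_def by linarith
    moreover have "node (4 * 2 ^ q) (m q) - x = (2 * pi / ?M) * (real (m q) - ?y)"
      by (simp add: node_def field_simps)
    ultimately have "\<bar>node (4 * 2 ^ q) (m q) - x\<bar> \<le> (2 * pi / ?M) * 1"
      by (simp only: abs_mult) (intro mult_mono, auto)
    also have "\<dots> \<le> 2 * pi * (1 / 2) ^ q" by (simp add: power_one_over field_simps)
    finally show ?thesis .
  qed
  then have b: "\<forall>\<^sub>F q in sequentially. norm (node (4 * 2 ^ q) (m q) - x) \<le> 2 * pi * (1 / 2) ^ q"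
    by simp
  have "(\<lambda>q. 2 * pi * (1 / 2 :: real) ^ q) \<longlonglongrightarrow> 2 * pi * 0"
    by (intro tendsto_mult tendsto_const LIMSEQ_power_zero) simp
  then have "(\<lambda>q. node (4 * 2 ^ q) (m q) - x) \<longlonglongrightarrow> 0"
    by (intro Lim_null_comparison[OF b]) simp
  then have "(\<lambda>q. node (4 * 2 ^ q) (m q)) \<longlonglongrightarrow> x" by (rule LIM_zero_cancel)
  then show ?thesis by blast
qed

lemma tpoly_continuous: "P \<in> tpoly n \<Longrightarrow> continuous_on S P"
  unfolding tpoly_def wave_def by clarify (intro continuous_intros)

text \<open>
  A grid point of level \<open>q\<close> is treated by the Jackson estimate at this level and by telescoping the
  doubling steps from \<open>s\<close> to \<open>q\<close>; the errors form a geometric series, so the bound is independent of \<open>q\<close>.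
  The grid points of all levels are dense, and continuity gives the remaining points.
\<close>

lemma nikolskii_vp_rate:
  assumes r: "r > 0"
  shows "\<exists>C>0. \<forall>f. continuous_on UNIV f \<longrightarrow> (\<forall>x. f (x + 2 * pi) = f x) \<longrightarrow>
     (\<forall>\<delta> x. norm ((forward_diff \<delta> ^^ (nat \<lfloor>r\<rfloor> + 1)) f x) \<le> \<bar>\<delta>\<bar> powr r) \<longrightarrow>
     (\<forall>s x. 0 \<le> x \<longrightarrow> norm (f x - vp (2 ^ s) f x) \<le> C * 2 powr (- r * real s))"
proof -
  obtain C where C: "C > 0" and J: "\<And>n f. n > 0 \<Longrightarrow> (\<forall>x. f (x + 2 * pi) = f x) \<Longrightarrow>
     (\<forall>\<delta> x. norm ((forward_diff \<delta> ^^ (nat \<lfloor>r\<rfloor> + 1)) f x) \<le> \<bar>\<delta>\<bar> powr r) \<Longrightarrow>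
     (\<exists>P\<in>tpoly (n div 2). \<forall>m. norm (f (node (4 * n) m) - P (node (4 * n) m)) \<le> C * real n powr (- r))"
    using jackson_on_grid[OF r] by metis
  define \<rho> where "\<rho> = 2 powr (- r)"
  have \<rho>: "0 < \<rho>" "\<rho> < 1" using r by (auto simp: \<rho>_def powr_less_one)
  have \<rho>s: "2 powr (- r * real s) = \<rho> ^ s" for s
    unfolding \<rho>_def by (simp add: powr_powr powr_realpow[symmetric])
  have \<rho>s': "real (2 ^ s) powr (- r) = \<rho> ^ s" for s
    by (simp add: \<rho>s[symmetric] powr_powr powr_realpow[symmetric] mult.commute)
  show ?thesis
  proof (intro exI[of _ "10 * C / (1 - \<rho>)"] conjI allI impI)
    show "10 * C / (1 - \<rho>) > 0" using C \<rho> by simp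
    fix f :: "real \<Rightarrow> complex" and s and x :: real
    assume cont: "continuous_on UNIV f" and per: "\<forall>x. f (x + 2 * pi) = f x"
      and d: "\<forall>\<delta> x. norm ((forward_diff \<delta> ^^ (nat \<lfloor>r\<rfloor> + 1)) f x) \<le> \<bar>\<delta>\<bar> powr r" and x: "0 \<le> x"
    have "\<exists>P. P \<in> tpoly (2 ^ i div 2) \<and>
        (\<forall>m. norm (f (node (4 * 2 ^ i) m) - P (node (4 * 2 ^ i) m)) \<le> C * \<rho> ^ i)" for i
      using J[of "2 ^ i" f] per d unfolding \<rho>s' by auto
    then have step: "norm (vp (2 * 2 ^ i) f y - vp (2 ^ i) f y) \<le> 6 * (C * \<rho> ^ i)"
      and grid: "norm (f (node (4 * 2 ^ i) m) - vp (2 ^ i) f (node (4 * 2 ^ i) m)) \<le> 4 * (C * \<rho> ^ i)" for i y m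
      using vp_double_step[of "2 ^ i"] by (metis zero_less_numeral zero_less_power)+
    have tele: "norm (vp (2 ^ (s + j)) f y - vp (2 ^ s) f y) \<le> 6 * C * \<rho> ^ s * (\<Sum>i<j. \<rho> ^ i)" for j y
    proof (induction j)
      case (Suc j)
      have "norm (vp (2 ^ (s + Suc j)) f y - vp (2 ^ s) f y)
          \<le> norm (vp (2 * 2 ^ (s + j)) f y - vp (2 ^ (s + j)) f y) + norm (vp (2 ^ (s + j)) f y - vp (2 ^ s) f y)"
        using norm_triangle_ineq[of "vp (2 * 2 ^ (s + j)) f y - vp (2 ^ (s + j)) f y"
          "vp (2 ^ (s + j)) f y - vp (2 ^ s) f y"] by simp
      also have "\<dots> \<le> 6 * (C * \<rho> ^ (s + j)) + 6 * C * \<rho> ^ s * (\<Sum>i<j. \<rho> ^ i)"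
        by (intro add_mono step Suc)
      finally show ?case by (simp add: power_add algebra_simps)
    qed simp
    have geo: "(\<Sum>i<j. \<rho> ^ i) \<le> 1 / (1 - \<rho>)" for j
      using \<rho> by (simp add: geometric_sum divide_right_mono_neg field_simps)
    have bound: "norm (f y - vp (2 ^ s) f y) \<le> 10 * C / (1 - \<rho>) * \<rho> ^ s"
      if y: "y = node (4 * 2 ^ q) m" "s \<le> q" for y q m
    proof -
      obtain j where j: "q = s + j" using y(2) le_iff_add by blast
      have "norm (f y - vp (2 ^ s) f y) \<le> norm (f y - vp (2 ^ q) f y) + norm (vp (2 ^ q) f y - vp (2 ^ s) f y)"
        using norm_triangle_ineq[of "f y - vp (2 ^ q) f y" "vp (2 ^ q) f y - vp (2 ^ s) f y"] by simp
      also have "\<dots> \<le> 4 * (C * \<rho> ^ q) + 6 * C * \<rho> ^ s * (1 / (1 - \<rho>))"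
      proof (rule add_mono)
        show "norm (f y - vp (2 ^ q) f y) \<le> 4 * (C * \<rho> ^ q)" unfolding y(1) by (rule grid)
        have "norm (vp (2 ^ q) f y - vp (2 ^ s) f y) \<le> 6 * C * \<rho> ^ s * (\<Sum>i<j. \<rho> ^ i)"
          unfolding j by (rule tele)
        also have "\<dots> \<le> 6 * C * \<rho> ^ s * (1 / (1 - \<rho>))"
          using C \<rho> by (intro mult_left_mono geo) auto
        finally show "norm (vp (2 ^ q) f y - vp (2 ^ s) f y) \<le> 6 * C * \<rho> ^ s * (1 / (1 - \<rho>))" .
      qed
      also have "4 * (C * \<rho> ^ q) \<le> 4 * C * \<rho> ^ s * (1 / (1 - \<rho>))"
      proof -
        have "1 / (1 - \<rho>) \<ge> 1" using \<rho> by simp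
        then have "\<rho> ^ q * 1 \<le> \<rho> ^ s * (1 / (1 - \<rho>))"
          using \<rho> y(2) by (intro mult_mono power_decreasing) auto
        then have "(4 * C) * (\<rho> ^ q * 1) \<le> (4 * C) * (\<rho> ^ s * (1 / (1 - \<rho>)))"
          using C by (intro mult_left_mono) auto
        then show ?thesis by (simp only: mult.assoc mult_1_right)
      qed
      finally show ?thesis by (simp add: field_simps)
    qed
    obtain m where m: "(\<lambda>q. node (4 * 2 ^ q) (m q)) \<longlonglongrightarrow> x" using nodes_dense[OF x] by blast
    have c: "continuous_on UNIV (\<lambda>y. norm (f y - vp (2 ^ s) f y))"
      by (intro continuous_intros cont tpoly_continuous[OF vp_tpoly])
    have "(\<lambda>q. norm (f (node (4 * 2 ^ q) (m q)) - vp (2 ^ s) f (node (4 * 2 ^ q) (m q))))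
        \<longlonglongrightarrow> norm (f x - vp (2 ^ s) f x)"
      by (rule isCont_tendsto_compose[OF _ m]) (use c in \<open>simp add: continuous_on_eq_continuous_at\<close>)
    then show "norm (f x - vp (2 ^ s) f x) \<le> 10 * C / (1 - \<rho>) * 2 powr (- r * real s)"
      unfolding \<rho>s by (rule LIMSEQ_le_const2) (intro exI[of _ s] allI impI, rule bound, rule refl)
  qed
qed

section \<open>Dyadic blocks of the Bernoulli kernel\<close>

text \<open>
  Coefficients of the Bernoulli kernel, with \<open>k\<close> belonging to the frequency \<open>k + 1\<close>: this keeps the base of the power
  positive, and the kernel is \<open>cis t\<close> times a power series in \<open>cis t\<close>.
\<close>

definition cf :: "real \<Rightarrow> nat \<Rightarrow> real" where "cf r k = real (Suc k) powr (- r)"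

lemma powr_neg_convex:
  assumes "r > 0"
  shows "x > 0 \<Longrightarrow> y > 0 \<Longrightarrow> - r * x powr (- r - 1) * (y - x) \<le> y powr (- r) - x powr (- r)"
    and "convex_on {0<..} (\<lambda>x. x powr (- r))"
proof -
  have 1: "((\<lambda>x. x powr (- r)) has_real_derivative - r * x powr (- r - 1)) (at x)" if "x \<in> {0<..}" for x
    using that by (auto intro!: derivative_eq_intros)
  have 2: "((\<lambda>x. - r * x powr (- r - 1)) has_real_derivative - r * ((- r - 1) * x powr (- r - 1 - 1))) (at x)"
    if "x \<in> {0<..}" for x
    using that by (auto intro!: derivative_eq_intros)
  have 3: "- r * ((- r - 1) * x powr (- r - 1 - 1)) \<ge> 0" for x
  proof -
    have "- r * ((- r - 1) * x powr (- r - 1 - 1)) = r * (r + 1) * x powr (- r - 1 - 1)"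
      by (simp add: algebra_simps)
    then show ?thesis using assms by simp
  qed
  show "- r * x powr (- r - 1) * (y - x) \<le> y powr (- r) - x powr (- r)" if "x > 0" "y > 0"
    by (rule f''_imp_f'[where C = "{0<..}", OF _ 1 2 3]) (use that in auto)
  show "convex_on {0<..} (\<lambda>x. x powr (- r))"
    by (rule f''_ge0_imp_convex[OF _ 1 2 3]) auto
qed

lemma cf_pos: "cf r k > 0" by (simp add: cf_def)

lemma cf_decreasing:
  assumes "r > 0" shows "cf r (Suc k) \<le> cf r k"
  unfolding cf_def using assms by (intro powr_mono2') auto

lemma cf_antimono: "r > 0 \<Longrightarrow> j \<le> k \<Longrightarrow> cf r k \<le> cf r j"
  unfolding cf_def by (intro powr_mono2') auto

lemma cf_convex:
  assumes "r > 0" shows "cf r (Suc k) - cf r (Suc (Suc k)) \<le> cf r k - cf r (Suc k)"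
proof -
  have "real (Suc (Suc k)) powr (- r) \<le> (1 - 1 / 2) * real (Suc k) powr (- r) + 1 / 2 * real (Suc (Suc (Suc k))) powr (- r)"
  proof -
    have "(1 - 1 / 2) *\<^sub>R real (Suc k) + (1 / 2) *\<^sub>R real (Suc (Suc (Suc k))) = real (Suc (Suc k))"
      by (simp add: field_simps)
    then show ?thesis
      using convex_onD[OF powr_neg_convex(2)[OF assms], of "1 / 2" "real (Suc k)" "real (Suc (Suc (Suc k)))"]
      by (simp only:) auto
  qed
  then show ?thesis by (simp add: cf_def)
qed

lemma cf_step_le:
  assumes "r > 0" shows "cf r k - cf r (Suc k) \<le> r * real (Suc k) powr (- r - 1)"
  using powr_neg_convex(1)[OF assms, of "real (Suc k)" "real (Suc (Suc k))"] by (simp add: cf_def)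

lemma abel_sum:
  fixes z :: complex and a :: "nat \<Rightarrow> real"
  assumes "p \<le> q"
  shows "(1 - z) * (\<Sum>k\<in>{p..q}. of_real (a k) * z ^ k)
     = of_real (a p) * z ^ p - of_real (a q) * z ^ Suc q - (\<Sum>k\<in>{p..<q}. of_real (a k - a (Suc k)) * z ^ Suc k)"
  using assms
proof (induction q rule: dec_induct)
  case base
  show ?case by (simp add: algebra_simps)
next
  case (step q)
  then have "(1 - z) * (\<Sum>k\<in>{p..Suc q}. of_real (a k) * z ^ k)
      = (1 - z) * (\<Sum>k\<in>{p..q}. of_real (a k) * z ^ k) + (1 - z) * (of_real (a (Suc q)) * z ^ Suc q)"
    by (simp add: distrib_left)
  with step show ?case by (simp add: algebra_simps)
qed

lemma abel_sum_0:
  fixes z :: complex and a :: "nat \<Rightarrow> real"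
  shows "(1 - z) * (\<Sum>k<Suc q. of_real (a k) * z ^ k)
     = of_real (a 0) - of_real (a q) * z ^ Suc q - (\<Sum>k<q. of_real (a k - a (Suc k)) * z ^ Suc k)"
proof -
  have "{..<Suc q} = {0..q}" "{..<q} = {0..<q}" by auto
  with abel_sum[of 0 q z a] show ?thesis by (simp only: le0 simp_thms power_0 mult_1_right)
qed

text \<open>
  Summation by parts: for decreasing coefficients the differences telescope.
\<close>

lemma abel_bound:
  fixes z :: complex
  assumes a: "\<And>k. a (Suc k) \<le> a k" "\<And>k. 0 \<le> a k" and z: "norm z = 1"
  shows "norm ((1 - z) * (\<Sum>k\<in>{p..<q}. of_real (a k) * z ^ k)) \<le> 2 * a p"
proof (cases "p < q")
  case True
  then obtain q' where q: "q = Suc q'" "p \<le> q'" by (cases q) auto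
  have "norm (\<Sum>k\<in>{p..<q'}. of_real (a k - a (Suc k)) * z ^ Suc k) \<le> (\<Sum>k\<in>{p..<q'}. a k - a (Suc k))"
    using a z by (intro order_trans[OF norm_sum] sum_mono) (simp add: norm_mult norm_power del: of_real_diff)
  also have "\<dots> = a p - a q'"
    using sum_Suc_diff'[of p q' a] q(2) by (simp add: sum_subtractf)
  finally have "norm (\<Sum>k\<in>{p..<q'}. of_real (a k - a (Suc k)) * z ^ Suc k) \<le> a p - a q'" .
  moreover have "norm (of_real (a p) * z ^ p) = a p" "norm (of_real (a q') * z ^ Suc q') = a q'"
    using a z by (simp_all add: norm_mult norm_power)
  moreover have "{p..<q} = {p..q'}" using q by auto
  ultimately show ?thesis
    using abel_sum[OF q(2), of z a] norm_triangle_ineq4[of "of_real (a p) * z ^ p - of_real (a q') * z ^ Suc q'"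
       "\<Sum>k\<in>{p..<q'}. of_real (a k - a (Suc k)) * z ^ Suc k"]
      norm_triangle_ineq4[of "of_real (a p) * z ^ p" "of_real (a q') * z ^ Suc q'"] by simp
qed (use a in simp)

definition psum :: "real \<Rightarrow> complex \<Rightarrow> nat \<Rightarrow> complex" where
  "psum r z K = (\<Sum>k<K. of_real (cf r k) * z ^ k)"

lemma cf_tendsto_0: "r > 0 \<Longrightarrow> cf r \<longlonglongrightarrow> 0"
  unfolding cf_def[abs_def] by (rule LIMSEQ_Suc[OF tendsto_neg_powr[OF _ filterlim_real_sequentially]]) auto

text \<open>
  Dirichlet's test.
\<close>

lemma psum_convergent:
  fixes z :: complex
  assumes r: "r > 0" and z: "norm z = 1" "z \<noteq> 1"
  shows "summable (\<lambda>k. of_real (cf r k) * z ^ k)"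
proof -
  let ?d = "\<lambda>k. of_real (cf r k - cf r (Suc k)) * z ^ Suc k"
  have "summable (\<lambda>k. cf r k - cf r (Suc k))"
    using telescope_summable'[OF cf_tendsto_0[OF r]] .
  then have "summable ?d"
    by (rule summable_comparison_test'[where N = 0])
       (use z cf_decreasing[OF r] in \<open>simp add: norm_mult norm_power del: of_real_diff\<close>)
  then have d: "(\<lambda>q. \<Sum>k<q. ?d k) \<longlonglongrightarrow> suminf ?d" by (rule summable_LIMSEQ)
  have c: "(\<lambda>q. of_real (cf r q) * z ^ Suc q) \<longlonglongrightarrow> 0"
    by (rule tendsto_norm_zero_cancel)
       (use z cf_tendsto_0[OF r] cf_pos[of r] in \<open>simp add: norm_mult norm_power less_imp_le\<close>)
  have eq: "(\<Sum>k<Suc q. of_real (cf r k) * z ^ k)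
     = (of_real (cf r 0) - of_real (cf r q) * z ^ Suc q - (\<Sum>k<q. ?d k)) / (1 - z)" for q
  proof -
    have "(1 - z) * (\<Sum>k<Suc q. of_real (cf r k) * z ^ k)
        = of_real (cf r 0) - of_real (cf r q) * z ^ Suc q - (\<Sum>k<q. ?d k)"
      by (rule abel_sum_0)
    moreover have "1 - z \<noteq> 0" using z by simp
    ultimately show ?thesis by (simp add: field_simps)
  qed
  have "(\<lambda>q. \<Sum>k<Suc q. of_real (cf r k) * z ^ k) \<longlonglongrightarrow> (of_real (cf r 0) - 0 - suminf ?d) / (1 - z)"
    unfolding eq using z by (intro tendsto_intros c d) auto
  then have "(\<lambda>q. \<Sum>k<q. of_real (cf r k) * z ^ k) \<longlonglongrightarrow> (of_real (cf r 0) - 0 - suminf ?d) / (1 - z)"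
    by (rule LIMSEQ_imp_Suc)
  then show ?thesis by (auto simp: summable_def sums_def)
qed

text \<open>
  The mean of \<open>f\<close> over \<open>M \<le> K < 2 * M\<close>. For partial sums of a series this tapers the coefficients linearly,
  which is what the decay of second order in the estimates below needs.
\<close>

definition dyavg :: "nat \<Rightarrow> (nat \<Rightarrow> complex) \<Rightarrow> complex" where
  "dyavg M f = (\<Sum>i<M. f (M + i)) / of_nat M"

lemma dyavg_bound:
  assumes "M > 0" and b: "\<And>K. M \<le> K \<Longrightarrow> K < 2 * M \<Longrightarrow> norm (f K - c) \<le> b"
  shows "norm (dyavg M f - c) \<le> b"
proof -
  have "dyavg M f - c = (\<Sum>i<M. f (M + i) - c) / of_nat M"
    using assms by (simp add: dyavg_def sum_subtractf diff_divide_distrib)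
  also have "norm \<dots> \<le> (\<Sum>i<M. b) / real M"
    unfolding norm_divide norm_of_nat
    by (intro divide_right_mono order_trans[OF norm_sum] sum_mono b) auto
  finally show ?thesis using assms by simp
qed

lemma dyavg_cmult: "dyavg M (\<lambda>K. w * f K) = w * dyavg M f"
  by (simp add: dyavg_def sum_distrib_left)

lemma dyavg_add: "dyavg M (\<lambda>K. f K + h K) = dyavg M f + dyavg M h"
  by (simp add: dyavg_def sum.distrib add_divide_distrib)

lemma dyavg_const: "M > 0 \<Longrightarrow> dyavg M (\<lambda>K. c) = c"
  by (simp add: dyavg_def)

lemma psum_diff: "M \<le> K \<Longrightarrow> psum r z K - psum r z M = (\<Sum>k\<in>{M..<K}. of_real (cf r k) * z ^ k)"
  unfolding psum_def using sum_diff_nat_ivl[of 0 M K "\<lambda>k. of_real (cf r k) * z ^ k"] by (simp add: lessThan_atLeast0)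

definition block :: "real \<Rightarrow> complex \<Rightarrow> nat \<Rightarrow> complex" where
  "block r z M = dyavg (2 * M) (psum r z) - dyavg M (psum r z)"

lemma block_bound:
  assumes r: "r > 0" and z: "norm z = 1" and M: "M > 0"
  shows "norm (block r z M) \<le> 4 * real M powr (1 - r)"
proof -
  have Mp: "real M * real M powr (- r) = real M powr (1 - r)"
    using M by (simp add: powr_mult_base)
  have *: "norm (psum r z K - psum r z M) \<le> real N * real M powr (- r)" if "M \<le> K" "K \<le> M + N" for K N
  proof -
    have "norm (psum r z K - psum r z M) \<le> (\<Sum>k\<in>{M..<K}. real M powr (- r))"
      unfolding psum_diff[OF that(1)] using r M z cf_pos[of r]
      by (intro order_trans[OF norm_sum] sum_mono)
         (auto simp: norm_mult norm_power less_imp_le cf_def intro!: powr_mono2')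
    also have "\<dots> = real (K - M) * real M powr (- r)" by simp
    also have "\<dots> \<le> real N * real M powr (- r)"
      using that by (intro mult_right_mono) auto
    finally show ?thesis .
  qed
  have "norm (dyavg (2 * M) (psum r z) - psum r z M) \<le> real (3 * M) * real M powr (- r)"
    using M by (intro dyavg_bound *) auto
  moreover have "norm (dyavg M (psum r z) - psum r z M) \<le> real M * real M powr (- r)"
    using M by (intro dyavg_bound *) auto
  moreover have "block r z M = (dyavg (2 * M) (psum r z) - psum r z M) - (dyavg M (psum r z) - psum r z M)"
    by (simp add: block_def)
  ultimately have "norm (block r z M) \<le> real (3 * M) * real M powr (- r) + real M * real M powr (- r)"
    by (simp only:) (rule order_trans[OF norm_triangle_ineq4 add_mono])
  then show ?thesis using Mp by (simp add: mult.assoc)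
qed

text \<open>
  Summation by parts twice. The first one writes \<open>(1 - z) * psum r z K\<close> as a constant minus a boundary
  term \<open>p K\<close> and a sum \<open>e K\<close> over the differences of the coefficients. The second one acts on the mean of
  the boundary terms over \<open>K\<close> and on the sums \<open>e K\<close>, whose coefficients decrease by convexity. The constant
  drops out of the difference of two means.
\<close>

lemma block_decay:
  assumes r: "r > 0" and z: "norm z = 1" and M: "M > 0"
  shows "norm (block r z M) * (norm (1 - z))\<^sup>2 \<le> (3 + 4 * r) * real M powr (- 1 - r)"
proof -
  define w where "w = 1 - z"
  define d where "d k = cf r k - cf r (Suc k)" for k
  define e where "e K = (\<Sum>k<K - 1. of_real (d k) * z ^ k)" for K
  define p where "p K = of_real (cf r (K - 1)) * z ^ K" for K
  define c where "c = complex_of_real (cf r 0)"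
  have d_dec: "d (Suc k) \<le> d k" "d k \<ge> 0" for k
    using cf_convex[OF r] cf_decreasing[OF r] by (auto simp: d_def)
  have d_anti: "j \<le> k \<Longrightarrow> d k \<le> d j" for j k by (rule lift_Suc_antimono_le[of d]) (use d_dec in auto)
  have wS: "w * psum r z K = c - p K - z * e K" if "K > 0" for K
  proof -
    obtain q where q: "K = Suc q" using gr0_implies_Suc[OF \<open>K > 0\<close>] by blast
    show ?thesis
      unfolding q psum_def w_def abel_sum_0
      by (simp add: c_def p_def e_def d_def sum_distrib_left mult.left_commute del: of_real_diff)
  qed
  have e_bound: "norm (w * e K' - w * e K) \<le> 2 * d (M - 1)" if "M \<le> K" "K \<le> K'" for K K'
  proof -
    have "e K' - e K = (\<Sum>k\<in>{K - 1..<K' - 1}. of_real (d k) * z ^ k)"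
      unfolding e_def using sum_diff_nat_ivl[of 0 "K - 1" "K' - 1" "\<lambda>k. of_real (d k) * z ^ k"] that
      by (simp add: lessThan_atLeast0)
    then have "w * e K' - w * e K = (1 - z) * (\<Sum>k\<in>{K - 1..<K' - 1}. of_real (d k) * z ^ k)"
      by (simp add: w_def right_diff_distrib[symmetric])
    also have "norm \<dots> \<le> 2 * d (K - 1)" using d_dec z by (intro abel_bound) auto
    also have "\<dots> \<le> 2 * d (M - 1)" using that d_anti by simp
    finally show ?thesis .
  qed
  have av_p: "norm (w * dyavg N p) \<le> 2 * cf r (M - 1) / real N" if "N \<ge> M" for N
  proof -
    have "(\<Sum>i<N. p (N + i)) = z * (\<Sum>i<N. of_real (cf r (N - 1 + i)) * z ^ (N - 1 + i))"
      unfolding sum_distrib_left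
    proof (intro sum.cong refl)
      fix i
      obtain N' where "N = Suc N'" using \<open>N \<ge> M\<close> M by (metis gr0_implies_Suc less_le_trans)
      then show "p (N + i) = z * (of_real (cf r (N - 1 + i)) * z ^ (N - 1 + i))" by (simp add: p_def)
    qed
    also have "(\<Sum>i<N. of_real (cf r (N - 1 + i)) * z ^ (N - 1 + i))
        = (\<Sum>k\<in>{N - 1..<N - 1 + N}. of_real (cf r k) * z ^ k)"
      using sum.shift_bounds_nat_ivl[of "\<lambda>k. of_real (cf r k) * z ^ k" 0 "N - 1" N]
      by (simp add: lessThan_atLeast0 add.commute)
    finally have "w * dyavg N p = z * ((1 - z) * (\<Sum>k\<in>{N - 1..<N - 1 + N}. of_real (cf r k) * z ^ k)) / of_nat N"
      by (simp add: dyavg_def w_def)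
    also have "norm \<dots> = norm ((1 - z) * (\<Sum>k\<in>{N - 1..<N - 1 + N}. of_real (cf r k) * z ^ k)) / real N"
      using z by (simp add: norm_mult norm_divide)
    also have "\<dots> \<le> 2 * cf r (N - 1) / real N"
      using z cf_pos[of r] cf_decreasing[OF r] by (intro divide_right_mono abel_bound) (auto simp: less_imp_le)
    also have "\<dots> \<le> 2 * cf r (M - 1) / real N"
      using that cf_antimono[OF r] by (intro divide_right_mono mult_left_mono) auto
    finally show ?thesis .
  qed
  have av_S: "w * w * dyavg N (psum r z) = w * c - w * dyavg N p - z * dyavg N (\<lambda>K. w * e K)" if "N > 0" for N
  proof -
    have "w * dyavg N (psum r z) = dyavg N (\<lambda>K. w * psum r z K)" by (simp add: dyavg_cmult)
    also have "\<dots> = dyavg N (\<lambda>K. (c + (- 1) * p K) + (- z) * e K)"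
      unfolding dyavg_def using that by (intro arg_cong2[of _ _ _ _ "(/)"] sum.cong refl) (subst wS, auto)
    also have "\<dots> = c - dyavg N p - z * dyavg N e"
      unfolding dyavg_add dyavg_cmult using that by (simp add: dyavg_const)
    finally have *: "w * dyavg N (psum r z) = c - dyavg N p - z * dyavg N e" .
    show ?thesis unfolding mult.assoc[of w] * dyavg_cmult by (simp add: algebra_simps)
  qed
  have ea: "norm (dyavg (2 * M) (\<lambda>K. w * e K) - w * e (2 * M)) \<le> 2 * d (M - 1)"
    using M by (intro dyavg_bound e_bound) auto
  have eb: "norm (dyavg M (\<lambda>K. w * e K) - w * e (2 * M)) \<le> 2 * d (M - 1)"
    using M by (intro dyavg_bound) (use e_bound in \<open>auto simp: norm_minus_commute\<close>)
  have "w * w * block r z M = (w * dyavg M p - w * dyavg (2 * M) p)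
      - z * ((dyavg (2 * M) (\<lambda>K. w * e K) - w * e (2 * M)) - (dyavg M (\<lambda>K. w * e K) - w * e (2 * M)))"
    using M by (simp add: block_def right_diff_distrib av_S)
  also have "norm \<dots> \<le> (2 * cf r (M - 1) / real M + 2 * cf r (M - 1) / real (2 * M))
      + (2 * d (M - 1) + 2 * d (M - 1))"
  proof -
    have tri: "norm ((a - b) - z * (a' - b')) \<le> (\<alpha> + \<beta>) + (\<alpha>' + \<beta>')"
      if "norm a \<le> \<alpha>" "norm b \<le> \<beta>" "norm a' \<le> \<alpha>'" "norm b' \<le> \<beta>'" for a b a' b' \<alpha> \<beta> \<alpha>' \<beta>'
      using that z norm_triangle_ineq4[of "a - b" "z * (a' - b')"] norm_triangle_ineq4[of a b]
        norm_triangle_ineq4[of a' b'] by (simp add: norm_mult)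
    show ?thesis by (rule tri[OF av_p av_p ea eb]) auto
  qed
  also have "\<dots> = 3 * (cf r (M - 1) / real M) + 4 * d (M - 1)" by simp
  also have "cf r (M - 1) / real M = real M powr (- 1 - r)"
    using M by (simp add: cf_def powr_diff powr_minus field_simps)
  also have "d (M - 1) \<le> r * real M powr (- 1 - r)"
  proof -
    have "- 1 - r = - r - 1" by simp
    then show ?thesis using cf_step_le[OF r, of "M - 1"] M by (simp only: d_def) simp
  qed
  finally have "norm (w * w * block r z M) \<le> 3 * real M powr (- 1 - r) + 4 * (r * real M powr (- 1 - r))"
    by simp
  moreover have "norm (w * w * block r z M) = norm (block r z M) * (norm (1 - z))\<^sup>2"
    unfolding w_def norm_mult by (simp add: power2_eq_square)
  ultimately show ?thesis by (simp add: distrib_right)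
qed

text \<open>
  Starting the means with 0 makes the blocks sum to the whole series and gives \<open>cis t * dymean r (cis t) i\<close>
  a degree below \<open>2 ^ i\<close> for \<open>i = 0\<close> as well.
\<close>

definition dyblock :: "real \<Rightarrow> complex \<Rightarrow> nat \<Rightarrow> complex" where
  "dyblock r z i = (case i of 0 \<Rightarrow> dyavg 1 (psum r z) | Suc m \<Rightarrow> block r z (2 ^ m))"

definition dymean :: "real \<Rightarrow> complex \<Rightarrow> nat \<Rightarrow> complex" where
  "dymean r z i = (case i of 0 \<Rightarrow> 0 | Suc m \<Rightarrow> dyavg (2 ^ m) (psum r z))"

lemma dyblock_eq: "dyblock r z i = dymean r z (Suc i) - dymean r z i"
  by (auto simp: dyblock_def dymean_def block_def split: nat.split)

lemma dymean_tendsto: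
  assumes "r > 0" "norm z = 1" "z \<noteq> 1"
  shows "dymean r z \<longlonglongrightarrow> (\<Sum>k. of_real (cf r k) * z ^ k)"
proof -
  let ?L = "\<Sum>k. of_real (cf r k) * z ^ k"
  have L: "psum r z \<longlonglongrightarrow> ?L"
    unfolding psum_def[abs_def] by (rule summable_LIMSEQ[OF psum_convergent[OF assms]])
  have "(\<lambda>m. dyavg (2 ^ m) (psum r z)) \<longlonglongrightarrow> ?L"
  proof (rule LIMSEQ_I)
    fix \<epsilon> :: real assume "\<epsilon> > 0"
    then obtain K0 where K0: "\<And>K. K \<ge> K0 \<Longrightarrow> norm (psum r z K - ?L) < \<epsilon> / 2"
      using LIMSEQ_D[OF L, of "\<epsilon> / 2"] by auto
    show "\<exists>m0. \<forall>m\<ge>m0. norm (dyavg (2 ^ m) (psum r z) - ?L) < \<epsilon>"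
    proof (intro exI[of _ K0] allI impI)
      fix m assume "m \<ge> K0"
      then have "K0 \<le> 2 ^ m" by (meson less_exp less_imp_le order_trans)
      then have "norm (dyavg (2 ^ m) (psum r z) - ?L) \<le> \<epsilon> / 2"
        by (intro dyavg_bound less_imp_le[OF K0]) auto
      then show "norm (dyavg (2 ^ m) (psum r z) - ?L) < \<epsilon>" using \<open>\<epsilon> > 0\<close> by simp
    qed
  qed
  then show ?thesis by (intro LIMSEQ_imp_Suc[of "dymean r z"]) (simp add: dymean_def)
qed

lemma dyblock_sums:
  assumes "r > 0" "norm z = 1" "z \<noteq> 1"
  shows "dyblock r z sums (\<Sum>k. of_real (cf r k) * z ^ k)"
  using telescope_sums[OF dymean_tendsto[OF assms]] by (simp add: dyblock_eq[abs_def] dymean_def)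

lemma tpoly_dymean: "(\<lambda>t. cis t * dymean r (cis t) i) \<in> tpoly (2 ^ i - 1)"
proof (cases i)
  case 0
  then show ?thesis by (simp add: dymean_def tpoly_zero)
next
  case (Suc m)
  have "(\<lambda>t. \<Sum>j<2 ^ m. \<Sum>k<2 ^ m + j. (of_real (cf r k) / 2 ^ m) * wave (int (Suc k)) t) \<in> tpoly (2 ^ Suc m - 1)"
  proof (intro tpoly_sum tpoly_cmult tpoly_wave)
    fix j k :: nat assume "j \<in> {..<2 ^ m}" "k \<in> {..<2 ^ m + j}"
    then have "Suc k \<le> 2 ^ Suc m - 1" by auto
    then show "\<bar>int (Suc k)\<bar> \<le> int (2 ^ Suc m - 1)" by (simp only: abs_of_nat of_nat_le_iff)
  qed
  moreover have "cis t * dymean r (cis t) (Suc m)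
      = (\<Sum>j<2 ^ m. \<Sum>k<2 ^ m + j. (of_real (cf r k) / 2 ^ m) * wave (int (Suc k)) t)" for t
    unfolding wave_eq_power dymean_def dyavg_def psum_def
    by (simp add: sum_distrib_left sum_divide_distrib field_simps)
  ultimately show ?thesis by (simp add: Suc)
qed

section \<open>Approximation of convolutions with the Bernoulli kernel\<close>

abbreviation "period \<equiv> lebesgue_on {0..2 * pi}"

definition kblock :: "real \<Rightarrow> real \<Rightarrow> nat \<Rightarrow> real \<Rightarrow> real" where
  "kblock r \<alpha> i t = 2 * Re (cis (- \<alpha> * pi / 2) * (cis t * dyblock r (cis t) i))"

lemma bernoulli_kernel_sums:
  assumes "r > 0" "cis t \<noteq> 1"
  shows "(\<lambda>i. kblock r \<alpha> i t) sums (bernoulli_kernel r t \<alpha> - 1)"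
proof -
  let ?L = "\<Sum>k. of_real (cf r k) * cis t ^ k"
  let ?w = "cis (- \<alpha> * pi / 2)"
  have "(\<lambda>k. of_real (cf r k) * cis t ^ k) sums ?L"
    using psum_convergent[of r "cis t"] assms by (simp add: summable_sums)
  from sums_Re[OF sums_mult[OF sums_mult[OF this]]]
  have "(\<lambda>k. Re (?w * (cis t * (of_real (cf r k) * cis t ^ k)))) sums Re (?w * (cis t * ?L))" .
  moreover have "Re (?w * (cis t * (of_real (cf r k) * cis t ^ k)))
      = real (Suc k) powr (- r) * cos (real (Suc k) * t - \<alpha> * pi / 2)" for k
  proof -
    have "?w * (cis t * (of_real (cf r k) * cis t ^ k)) = of_real (cf r k) * (?w * cis t ^ Suc k)"
      by (simp add: mult_ac)
    also have "?w * cis t ^ Suc k = cis (real (Suc k) * t - \<alpha> * pi / 2)"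
      unfolding Complex.DeMoivre cis_mult by (simp add: algebra_simps)
    finally have *: "?w * (cis t * (of_real (cf r k) * cis t ^ k))
        = of_real (cf r k) * cis (real (Suc k) * t - \<alpha> * pi / 2)" .
    show ?thesis unfolding * by (simp add: cf_def)
  qed
  ultimately have 1: "bernoulli_kernel r t \<alpha> - 1 = 2 * Re (?w * (cis t * ?L))"
    by (simp add: bernoulli_kernel_def sums_iff)
  have "dyblock r (cis t) sums ?L" using assms by (intro dyblock_sums) auto
  from sums_mult[OF sums_Re[OF sums_mult[OF sums_mult[OF this]]], of 2 ?w "cis t"]
  show ?thesis unfolding 1 kblock_def .
qed

lemma kblock_sum: "(\<Sum>i<n. kblock r \<alpha> i t) = 2 * Re (cis (- \<alpha> * pi / 2) * (cis t * dymean r (cis t) n))"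
  by (induction n) (simp_all add: kblock_def dyblock_eq dymean_def algebra_simps)

lemma abs_kblock_le: "\<bar>kblock r \<alpha> i t\<bar> \<le> 2 * norm (dyblock r (cis t) i)"
proof -
  have "\<bar>Re (cis (- \<alpha> * pi / 2) * (cis t * dyblock r (cis t) i))\<bar>
      \<le> norm (cis (- \<alpha> * pi / 2) * (cis t * dyblock r (cis t) i))" by (rule abs_Re_le_cmod)
  then show ?thesis by (simp add: kblock_def norm_mult)
qed

lemma continuous_kblock: "continuous_on S (kblock r \<alpha> i)"
proof -
  have *: "kblock r \<alpha> i = (\<lambda>t. 2 * Re (cis (- \<alpha> * pi / 2) * (cis t * dymean r (cis t) (Suc i) - cis t * dymean r (cis t) i)))"
    by (simp add: fun_eq_iff kblock_def dyblock_eq right_diff_distrib)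
  show ?thesis unfolding * by (intro continuous_intros tpoly_continuous[OF tpoly_dymean])
qed

definition cauchy_bump :: "real \<Rightarrow> real \<Rightarrow> real" where
  "cauchy_bump a t = 1 / (1 + (a * t)\<^sup>2)"

lemma continuous_cauchy_bump: "continuous_on S (\<lambda>y. cauchy_bump a (c - y))"
  unfolding cauchy_bump_def
  by (intro continuous_intros) (metis add_pos_nonneg less_irrefl zero_le_power2 zero_less_one)

lemma integral_cauchy_bump:
  assumes "a > 0"
  shows "(LINT y|period. cauchy_bump a (c - y)) \<le> pi / a"
proof -
  have "((\<lambda>y. cauchy_bump a (c - y)) has_integral
     (- arctan (a * (c - 2 * pi)) / a - (- arctan (a * (c - 0)) / a))) {0..2 * pi}"
  proof (rule fundamental_theorem_of_calculus)
    show "((\<lambda>y. - arctan (a * (c - y)) / a) has_vector_derivative cauchy_bump a (c - y)) (at y within {0..2 * pi})" for y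
      unfolding has_real_derivative_iff_has_vector_derivative[symmetric]
    proof (rule DERIV_cong)
      show "((\<lambda>y. - arctan (a * (c - y)) / a) has_real_derivative
          - (inverse (1 + (a * (c - y))\<^sup>2) * (a * (0 - 1))) / a) (at y within {0..2 * pi})"
        using assms by (auto intro!: derivative_eq_intros)
      show "- (inverse (1 + (a * (c - y))\<^sup>2) * (a * (0 - 1))) / a = cauchy_bump a (c - y)"
        using assms by (simp add: cauchy_bump_def inverse_eq_divide)
    qed
  qed simp
  moreover have "integrable period (\<lambda>y. cauchy_bump a (c - y))"
    by (rule continuous_imp_integrable_real[OF continuous_cauchy_bump])
  ultimately have "(LINT y|period. cauchy_bump a (c - y)) = (arctan (a * c) - arctan (a * (c - 2 * pi))) / a"
    by (subst lebesgue_integral_eq_integral) (auto dest: integral_unique simp: diff_divide_distrib)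
  also have "\<dots> \<le> pi / a"
    using arctan_bounded[of "a * c"] arctan_bounded[of "a * (c - 2 * pi)"] assms
    by (intro divide_right_mono) auto
  finally show ?thesis .
qed

text \<open>
  One of \<open>t - 2 * pi\<close>, \<open>t\<close>, \<open>t + 2 * pi\<close> lies in \<open>[- pi, pi]\<close>, where \<open>norm (1 - cis t)\<close> is comparable with the
  argument. Summing over the three translates spares any reduction modulo the period.
\<close>

lemma bump_majorant:
  assumes M: "M > 0" and t: "\<bar>t\<bar> \<le> 2 * pi" and "a = 2 * M / pi"
  shows "1 / (1 + M\<^sup>2 * (norm (1 - cis t))\<^sup>2)
     \<le> cauchy_bump a (t - 2 * pi) + cauchy_bump a t + cauchy_bump a (t + 2 * pi)"
proof -
  have pos: "cauchy_bump a s \<ge> 0" for s by (simp add: cauchy_bump_def)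
  have le: "1 / (1 + M\<^sup>2 * (norm (1 - cis t))\<^sup>2) \<le> cauchy_bump a s"
    if "\<bar>s\<bar> \<le> pi" "cis s = cis t" for s
  proof -
    have "a * \<bar>s\<bar> \<le> M * norm (1 - cis s)"
      using mult_left_mono[OF norm_one_minus_cis_ge[OF that(1)], of M] M assms(3) by (simp add: mult_ac)
    then have "(a * \<bar>s\<bar>)\<^sup>2 \<le> (M * norm (1 - cis s))\<^sup>2"
      using M assms(3) by (intro power_mono) auto
    then show ?thesis unfolding cauchy_bump_def using that(2)
      by (intro divide_left_mono) (auto simp: power_mult_distrib intro!: mult_pos_pos add_pos_nonneg)
  qed
  have c: "cis (t - 2 * pi) = cis t" "cis (t + 2 * pi) = cis t"
    by (simp_all add: complex_eq_iff sin_diff cos_diff)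
  consider "t > pi" | "\<bar>t\<bar> \<le> pi" | "t < - pi" by linarith
  then show ?thesis
  proof cases
    case 1
    then have "\<bar>t - 2 * pi\<bar> \<le> pi" using t by linarith
    from le[OF this c(1)] show ?thesis using pos[of t] pos[of "t + 2 * pi"] by linarith
  next
    case 2
    from le[OF this refl] show ?thesis using pos[of "t - 2 * pi"] pos[of "t + 2 * pi"] by linarith
  next
    case 3
    then have "\<bar>t + 2 * pi\<bar> \<le> pi" using t by linarith
    from le[OF this c(2)] show ?thesis using pos[of t] pos[of "t - 2 * pi"] by linarith
  qed
qed

text \<open>
  The two block estimates combine into the bound \<open>A * M powr (1 - r) / (1 + M\<^sup>2 * (norm (1 - cis t))\<^sup>2)\<close> with
  \<open>M = 2 ^ m\<close>, a bump of height \<open>M powr (1 - r)\<close> and width \<open>1 / M\<close>. Its integral is of order \<open>M powr (- r)\<close>.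
\<close>

lemma kblock_L1:
  assumes r: "r > 0"
  shows "\<exists>C>0. \<forall>\<alpha> i. \<forall>x\<in>{0..2 * pi}. (LINT y|period. \<bar>kblock r \<alpha> i (x - y)\<bar>) \<le> C * (2 powr (- r)) ^ i"
proof -
  define A where "A = 7 + 4 * r"
  define C where "C = 4 * pi + 3 * A * pi\<^sup>2 * 2 powr r"
  have C: "C > 0" "4 * pi \<le> C" using r by (auto simp: C_def A_def intro!: add_pos_nonneg)
  have int: "integrable period (\<lambda>y. \<bar>kblock r \<alpha> i (x - y)\<bar>)" for \<alpha> i x
    by (intro continuous_imp_integrable_real continuous_intros continuous_on_compose2[OF continuous_kblock[of UNIV]]) auto
  show ?thesis
  proof (intro exI[of _ C] conjI C allI ballI)
    fix \<alpha> i x assume x: "x \<in> {0..2 * pi}"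
    show "(LINT y|period. \<bar>kblock r \<alpha> i (x - y)\<bar>) \<le> C * (2 powr (- r)) ^ i"
    proof (cases i)
      case 0
      have "(LINT y|period. \<bar>kblock r \<alpha> i (x - y)\<bar>) \<le> (LINT y|period. 2)"
      proof (rule integral_mono[OF int])
        show "\<bar>kblock r \<alpha> i (x - y)\<bar> \<le> 2" for y
          using abs_kblock_le[of r \<alpha> i "x - y"] by (simp add: 0 dyblock_def dyavg_def psum_def cf_def)
      qed (auto intro!: continuous_imp_integrable_real continuous_intros)
      also have "\<dots> = 4 * pi" by (simp add: measure_restrict_space)
      finally show ?thesis using C by (simp add: 0)
    next
      case (Suc m)
      define M where "M = real (2 ^ m)"
      have M: "M > 0" by (simp add: M_def)
      define a where "a = 2 * M / pi"
      have a: "a > 0" using M by (simp add: a_def)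
      let ?b = "\<lambda>c y. cauchy_bump a (c - y)"
      have pt: "\<bar>kblock r \<alpha> i (x - y)\<bar> \<le> 2 * A * M powr (1 - r) * (?b (x - 2 * pi) y + ?b x y + ?b (x + 2 * pi) y)"
        if y: "y \<in> {0..2 * pi}" for y
      proof -
        let ?B = "norm (block r (cis (x - y)) (2 ^ m))" and ?w = "norm (1 - cis (x - y))"
        have "?B \<le> 4 * M powr (1 - r)" unfolding M_def by (rule block_bound[OF r]) auto
        moreover have "M\<^sup>2 * (?B * ?w\<^sup>2) \<le> M\<^sup>2 * ((3 + 4 * r) * M powr (- 1 - r))"
          unfolding M_def by (intro mult_left_mono block_decay[OF r]) auto
        moreover have "M\<^sup>2 * M powr (- 1 - r) = M powr (1 - r)"
          using M powr_add[of M 2 "- 1 - r"] powr_realpow[of M 2] by simp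
        ultimately have "?B * (1 + M\<^sup>2 * ?w\<^sup>2) \<le> A * M powr (1 - r)"
          by (simp add: A_def algebra_simps)
        moreover have "1 + M\<^sup>2 * ?w\<^sup>2 > 0" by (intro add_pos_nonneg) auto
        ultimately have "?B \<le> A * M powr (1 - r) * (1 / (1 + M\<^sup>2 * ?w\<^sup>2))"
          by (simp add: field_simps)
        also have "\<dots> \<le> A * M powr (1 - r) * (cauchy_bump a (x - y - 2 * pi) + cauchy_bump a (x - y) + cauchy_bump a (x - y + 2 * pi))"
          using x y r M by (intro mult_left_mono bump_majorant) (auto simp: A_def a_def)
        finally show ?thesis using abs_kblock_le[of r \<alpha> i "x - y"]
          by (simp add: Suc dyblock_def algebra_simps)
      qed
      have ib: "integrable period (?b c)" for c by (rule continuous_imp_integrable_real[OF continuous_cauchy_bump])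
      have "(LINT y|period. \<bar>kblock r \<alpha> i (x - y)\<bar>)
          \<le> (LINT y|period. 2 * A * M powr (1 - r) * (?b (x - 2 * pi) y + ?b x y + ?b (x + 2 * pi) y))"
        by (rule integral_mono[OF int]) (use pt in \<open>auto intro!: integrable_add integrable_mult_right ib\<close>)
      also have "\<dots> = 2 * A * M powr (1 - r) * ((LINT y|period. ?b (x - 2 * pi) y) + (LINT y|period. ?b x y) + (LINT y|period. ?b (x + 2 * pi) y))"
        by (simp add: ib)
      also have "\<dots> \<le> 2 * A * M powr (1 - r) * (pi / a + pi / a + pi / a)"
        using r by (intro mult_left_mono add_mono integral_cauchy_bump a) (auto simp: A_def)
      also have "\<dots> = 3 * A * pi\<^sup>2 * M powr (- r)"
        using M by (simp add: a_def powr_diff powr_minus field_simps power2_eq_square)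
      also have "M powr (- r) = 2 powr r * (2 powr (- r)) ^ i"
        by (simp add: M_def Suc powr_realpow[symmetric] powr_powr powr_add[symmetric] algebra_simps)
      also have "3 * A * pi\<^sup>2 * (2 powr r * (2 powr (- r)) ^ i) \<le> C * (2 powr (- r)) ^ i"
        by (simp add: C_def algebra_simps)
      finally show ?thesis .
    qed
  qed
qed

lemma AE_period_cis: 
  assumes "x \<in> {0..2 * pi}"
  shows "AE y in period. cis (x - y) \<noteq> 1"
proof -
  have "AE y in lebesgue. y \<notin> {x, x + 2 * pi, x - 2 * pi}"
    by (intro AE_not_in finite_imp_null_set_lborel[THEN null_sets_completionI]) auto
  then have "AE y in period. y \<notin> {x, x + 2 * pi, x - 2 * pi}"
    by (subst AE_restrict_space_iff) (auto elim: eventually_mono)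
  then show ?thesis
  proof (rule lebesgue_on_mono)
    fix y assume y: "y \<notin> {x, x + 2 * pi, x - 2 * pi}" "y \<in> {0..2 * pi}"
    show "cis (x - y) \<noteq> 1"
    proof
      assume "cis (x - y) = 1"
      then have "cos (x - y) = 1" by (simp add: complex_eq_iff)
      then obtain j :: int where j: "x - y = of_int j * 2 * pi" by (auto simp: cos_one_2pi_int)
      have "\<bar>x - y\<bar> \<le> 2 * pi" using assms y by auto
      then have "\<bar>of_int j :: real\<bar> \<le> 1" unfolding j by (simp add: abs_mult)
      then have "j = 0 \<or> j = 1 \<or> j = - 1" by linarith
      then show False using j y by auto
    qed
  qed
qed

text \<open>
  A nonempty relatively open subset of a box with interior is not a null set.
\<close>

lemma AE_le_imp_le_on_cbox:
  fixes F :: "'a::euclidean_space \<Rightarrow> real"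
  assumes cont: "continuous_on (cbox a b) F" and ae: "AE x in lebesgue_on (cbox a b). F x \<le> c"
    and ne: "box a b \<noteq> {}" and x: "x \<in> cbox a b"
  shows "F x \<le> c"
proof (rule ccontr)
  assume "\<not> F x \<le> c"
  then obtain \<delta> where \<delta>: "\<delta> > 0" "\<And>y. y \<in> cbox a b \<Longrightarrow> dist y x < \<delta> \<Longrightarrow> dist (F y) (F x) < F x - c"
    using cont x unfolding continuous_on_iff by (metis diff_gt_0_iff_gt not_le)
  define U where "U = box a b \<inter> ball x \<delta>"
  have "x \<in> closure (box a b)" using x ne by (simp add: closure_box)
  then obtain y where "y \<in> box a b" "dist y x < \<delta>" using \<delta>(1) closure_approachable by blast
  then have "U \<noteq> {}" by (auto simp: U_def dist_commute)
  moreover have "open U" by (auto simp: U_def)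
  ultimately have not_neg: "\<not> negligible U" by (rule open_not_negligible[rotated])
  have "AE y in lebesgue. y \<in> cbox a b \<longrightarrow> F y \<le> c"
    using ae by (simp add: AE_restrict_space_iff)
  then have "AE y in lebesgue. y \<notin> U"
  proof eventually_elim
    case (elim y)
    show ?case
    proof
      assume "y \<in> U"
      then have y: "y \<in> cbox a b" "dist y x < \<delta>" using box_subset_cbox[of a b] by (auto simp: U_def dist_commute)
      then show False using elim \<delta>(2)[OF y] by (auto simp: dist_real_def)
    qed
  qed
  then have "U \<in> null_sets lebesgue"
    using \<open>open U\<close> by (subst AE_iff_null_sets) auto
  then show False using not_neg by (simp add: negligible_iff_null_sets)
qed

lemma tpoly_convolution:
  assumes int: "\<And>k. integrable M (\<lambda>y. \<psi> y * wave k (- y))" and Q: "Q \<in> tpoly n"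
  shows "(\<lambda>x. LINT y|M. \<psi> y * Q (x - y)) \<in> tpoly n"
proof -
  obtain c where c: "Q = (\<lambda>t. \<Sum>k\<in>{- int n..int n}. c k * wave k t)"
    using Q by (auto simp: tpoly_def)
  have "(LINT y|M. \<psi> y * Q (x - y)) = (\<Sum>k\<in>{- int n..int n}. (c k * (LINT y|M. \<psi> y * wave k (- y))) * wave k x)" for x
  proof -
    have "\<psi> y * Q (x - y) = (\<Sum>k\<in>{- int n..int n}. (c k * wave k x) * (\<psi> y * wave k (- y)))" for y
      unfolding c sum_distrib_left by (intro sum.cong refl) (simp add: wave_arg_add[of _ x "- y", simplified])
    then have "(LINT y|M. \<psi> y * Q (x - y))
        = (\<Sum>k\<in>{- int n..int n}. LINT y|M. (c k * wave k x) * (\<psi> y * wave k (- y)))"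
      by (simp only: Bochner_Integration.integral_sum integrable_mult_right int)
    also have "\<dots> = (\<Sum>k\<in>{- int n..int n}. (c k * wave k x) * (LINT y|M. \<psi> y * wave k (- y)))"
      by (simp only: integral_mult_right_zero)
    finally show ?thesis by (simp only: mult_ac)
  qed
  then show ?thesis unfolding tpoly_def
    by (auto intro!: exI[of _ "\<lambda>k. c k * (LINT y|M. \<psi> y * wave k (- y))"])
qed

lemma borel_measurable_period:
  "f \<in> borel_measurable borel \<Longrightarrow> f \<in> borel_measurable period"
  by (intro measurable_restrict_space1 measurable_completion) simp

text \<open>
  Inserting the block series of the kernel under the integral represents \<open>h\<close> almost everywhere as a
  series whose terms decrease geometrically. Its partial sums are polynomials \<open>P\<close>; continuity of \<open>h - P\<close>
  turns the bound almost everywhere into a bound everywhere, and \<open>vp\<close> is as good as \<open>P\<close> up to the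
  factor 4.
\<close>

lemma convolution_rate:
  assumes r: "r > 0"
  shows "\<exists>C>0. \<forall>\<alpha> \<psi> h s. \<psi> \<in> borel_measurable period \<longrightarrow> (AE y in period. norm (\<psi> y :: complex) \<le> 1) \<longrightarrow>
     continuous_on {0..2 * pi} h \<longrightarrow>
     (AE x in period. h x = of_real (1 / (2 * pi)) * (LINT y|period. \<psi> y * of_real (bernoulli_kernel r (x - y) \<alpha>))) \<longrightarrow>
     (\<forall>x\<in>{0..2 * pi}. norm (h x - vp (2 ^ s) h x) \<le> C * 2 powr (- r * real s))"
proof -
  define \<rho> where "\<rho> = 2 powr (- r)"
  have \<rho>: "0 < \<rho>" "\<rho> < 1" using r by (auto simp: \<rho>_def powr_less_one)
  obtain C1 where C1: "C1 > 0"
    and L1: "\<And>\<alpha> i x. x \<in> {0..2 * pi} \<Longrightarrow> (LINT y|period. \<bar>kblock r \<alpha> i (x - y)\<bar>) \<le> C1 * \<rho> ^ i"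
    using kblock_L1[OF r] unfolding \<rho>_def by blast
  define C where "C = 4 * (C1 / (\<rho> * (1 - \<rho>)))"
  show ?thesis
  proof (intro exI[of _ C] conjI allI impI)
    show "C > 0" using C1 \<rho> by (simp add: C_def)
    fix \<alpha> :: real and \<psi> h :: "real \<Rightarrow> complex" and s :: nat
    assume \<psi>m: "\<psi> \<in> borel_measurable period" and \<psi>1: "AE y in period. norm (\<psi> y) \<le> 1"
      and hc: "continuous_on {0..2 * pi} h"
      and rep: "AE x in period. h x = of_real (1 / (2 * pi)) * (LINT y|period. \<psi> y * of_real (bernoulli_kernel r (x - y) \<alpha>))"
    interpret finite_measure period by (rule finite_measure_lebesgue_on) simp
    let ?f = "\<lambda>x i y. \<psi> y * of_real (kblock r \<alpha> i (x - y))"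
    have kint: "integrable period (\<lambda>y. kblock r \<alpha> i (x - y))" for i x
      by (intro continuous_imp_integrable_real continuous_intros continuous_on_compose2[OF continuous_kblock[of UNIV]]) auto
    have fm: "?f x i \<in> borel_measurable period" for x i
      using \<psi>m kint[of i x, THEN borel_measurable_integrable] by simp
    have fle: "AE y in period. norm (?f x i y) \<le> \<bar>kblock r \<alpha> i (x - y)\<bar>" for x i
      using \<psi>1 by eventually_elim (simp add: norm_mult mult_left_le_one_le)
    have fint: "integrable period (?f x i)" for x i
      by (rule Bochner_Integration.integrable_bound[OF kint[of i x] fm]) (use fle in simp)
    have fL1: "(LINT y|period. norm (?f x i y)) \<le> C1 * \<rho> ^ i" if "x \<in> {0..2 * pi}" for x i
      by (rule order_trans[OF integral_mono_AE L1[OF that]]) (use fint kint fle in \<open>auto intro!: integrable_abs integrable_norm\<close>)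
    have \<psi>int: "integrable period \<psi>" by (rule integrable_const_bound[OF \<psi>1 \<psi>m])
    have geo: "summable (\<lambda>i. C1 * \<rho> ^ i)" using \<rho> by (intro summable_mult summable_geometric) simp
    have sumL1: "summable (\<lambda>i. LINT y|period. norm (?f x i y))" if "x \<in> {0..2 * pi}" for x
      by (rule summable_comparison_test'[OF geo, where N = 0]) (use fL1[OF that] in simp)
    have pointwise: "summable (\<lambda>i. norm (?f x i y))" if "cis (x - y) \<noteq> 1" for x y
    proof -
      let ?w = "norm (1 - cis (x - y))"
      define A where "A = 3 + 4 * r"
      define q where "q = (2::real) powr (- 1 - r)"
      have q: "0 < q" "q < 1" using r by (auto simp: q_def powr_less_one)
      have w: "?w > 0" using that by simp
      have "norm (?f x (Suc m) y) \<le> norm (\<psi> y) * (2 * A / ?w\<^sup>2) * q ^ m" for m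
      proof -
        have "norm (block r (cis (x - y)) (2 ^ m)) * ?w\<^sup>2 \<le> A * real (2 ^ m) powr (- 1 - r)"
          unfolding A_def by (rule block_decay[OF r]) auto
        also have "real (2 ^ m) powr (- 1 - r) = q ^ m"
          by (simp add: q_def powr_realpow[symmetric] powr_powr mult.commute)
        finally have "norm (dyblock r (cis (x - y)) (Suc m)) \<le> A / ?w\<^sup>2 * q ^ m"
          using w by (simp add: dyblock_def field_simps)
        then have "\<bar>kblock r \<alpha> (Suc m) (x - y)\<bar> \<le> 2 * (A / ?w\<^sup>2 * q ^ m)"
          using abs_kblock_le[of r \<alpha> "Suc m" "x - y"] by linarith
        from mult_left_mono[OF this, of "norm (\<psi> y)"] show ?thesis by (simp add: norm_mult mult_ac)
      qed
      then have le: "norm (norm (?f x (Suc m) y)) \<le> norm (\<psi> y) * (2 * A / ?w\<^sup>2) * q ^ m" for m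
        by (simp only: real_norm_def abs_norm_cancel)
      have "summable (\<lambda>m. norm (\<psi> y) * (2 * A / ?w\<^sup>2) * q ^ m)"
        using q by (intro summable_mult summable_geometric) simp
      then have "summable (\<lambda>m. norm (?f x (Suc m) y))"
        by (rule summable_comparison_test'[where N = 0]) (rule le)
      then show ?thesis by (subst (asm) summable_Suc_iff)
    qed
    have expand: "(\<lambda>i. LINT y|period. ?f x i y) sums
        ((LINT y|period. \<psi> y * of_real (bernoulli_kernel r (x - y) \<alpha>)) - (LINT y|period. \<psi> y))"
      if x: "x \<in> {0..2 * pi}" for x
    proof -
      have ps: "AE y in period. summable (\<lambda>i. norm (?f x i y))"
        using AE_period_cis[OF x] by eventually_elim (rule pointwise)
      note sums = integrable_suminf[OF fint ps sumL1[OF x]] sums_integral[OF fint ps sumL1[OF x]]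
      have bm: "(\<lambda>y. bernoulli_kernel r (x - y) \<alpha>) \<in> borel_measurable period"
        unfolding bernoulli_kernel_def by (rule borel_measurable_period) measurable
      have "(LINT y|period. \<psi> y * of_real (bernoulli_kernel r (x - y) \<alpha>)) = (LINT y|period. \<psi> y + (\<Sum>i. ?f x i y))"
      proof (rule integral_cong_AE)
        show "AE y in period. \<psi> y * of_real (bernoulli_kernel r (x - y) \<alpha>) = \<psi> y + (\<Sum>i. ?f x i y)"
          using AE_period_cis[OF x]
        proof eventually_elim
          case (elim y)
          have "(\<lambda>i. ?f x i y) sums (\<psi> y * of_real (bernoulli_kernel r (x - y) \<alpha> - 1))"
            by (intro sums_mult sums_of_real bernoulli_kernel_sums r elim)
          then show ?case by (simp add: sums_iff algebra_simps)
        qed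
      qed (use \<psi>m bm \<psi>int sums(1) in auto)
      also have "\<dots> = (LINT y|period. \<psi> y) + (LINT y|period. (\<Sum>i. ?f x i y))"
        by (rule Bochner_Integration.integral_add[OF \<psi>int sums(1)])
      finally show ?thesis using sums(2) by simp
    qed
    \<comment> \<open>The degree \<open>2 ^ L - 1\<close> must not exceed \<open>2 ^ s div 2\<close>; for \<open>s = 0\<close> no block is taken.\<close>
    define L where "L = s - 1"
    define T where "T t = cis (- \<alpha> * pi / 2) * (cis t * dymean r (cis t) L)" for t
    define Q where "Q t = 1 + (T t + cnj (T t))" for t
    have Q_eq: "Q t = 1 + of_real (\<Sum>i<L. kblock r \<alpha> i t)" for t
      unfolding kblock_sum Q_def T_def complex_add_cnj by (rule refl)
    define P where "P x = of_real (1 / (2 * pi)) * (LINT y|period. \<psi> y * Q (x - y))" for x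
    have deg: "2 ^ L - 1 \<le> 2 ^ s div (2 :: nat)" by (cases s) (auto simp: L_def)
    have "T \<in> tpoly (2 ^ s div 2)"
      unfolding T_def[abs_def] by (intro tpoly_cmult tpoly_mono[OF tpoly_dymean deg])
    then have Q: "Q \<in> tpoly (2 ^ s div 2)"
      unfolding Q_def[abs_def] by (intro tpoly_add tpoly_const tpoly_cnj)
    have P: "P \<in> tpoly (2 ^ s div 2)"
      unfolding P_def[abs_def]
    proof (intro tpoly_cmult tpoly_convolution Q)
      show "integrable period (\<lambda>y. \<psi> y * wave k (- y))" for k
      proof (rule integrable_const_bound)
        show "AE y in period. norm (\<psi> y * wave k (- y)) \<le> 1" using \<psi>1 by (simp add: norm_mult)
        have "(\<lambda>y. wave k (- y)) \<in> borel_measurable period"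
          unfolding wave_def by (intro continuous_imp_measurable_on_sets_lebesgue continuous_intros) auto
        then show "(\<lambda>y. \<psi> y * wave k (- y)) \<in> borel_measurable period" using \<psi>m by simp
      qed
    qed
    have P_eq: "P x = of_real (1 / (2 * pi)) * ((LINT y|period. \<psi> y) + (\<Sum>i<L. LINT y|period. ?f x i y))" for x
    proof -
      have "(LINT y|period. \<psi> y * Q (x - y)) = (LINT y|period. \<psi> y + (\<Sum>i<L. ?f x i y))"
        by (simp add: Q_eq distrib_left sum_distrib_left)
      also have "\<dots> = (LINT y|period. \<psi> y) + (\<Sum>i<L. LINT y|period. ?f x i y)"
        using \<psi>int fint by simp
      finally show ?thesis by (simp add: P_def)
    qed
    define \<epsilon> where "\<epsilon> = C1 / (\<rho> * (1 - \<rho>)) * \<rho> ^ s"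
    have ae: "AE x in period. norm (h x - P x) \<le> \<epsilon>"
    proof -
      have "AE x in period. x \<in> {0..2 * pi}" using AE_space[of period] by simp
      with rep show ?thesis
      proof eventually_elim
        case (elim x)
        have tail: "(\<lambda>i. LINT y|period. ?f x (i + L) y) sums
            ((LINT y|period. \<psi> y * of_real (bernoulli_kernel r (x - y) \<alpha>)) - (LINT y|period. \<psi> y)
              - (\<Sum>i<L. LINT y|period. ?f x i y))"
          by (rule sums_split_initial_segment[OF expand[OF elim(2)]])
        have "h x - P x = of_real (1 / (2 * pi)) * ((LINT y|period. \<psi> y * of_real (bernoulli_kernel r (x - y) \<alpha>))
            - (LINT y|period. \<psi> y) - (\<Sum>i<L. LINT y|period. ?f x i y))" (is "_ = _ * ?S")
          unfolding elim(1) P_eq by (simp add: algebra_simps)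
        then have "norm (h x - P x) = norm (complex_of_real (1 / (2 * pi)) * ?S)"
          by (rule arg_cong)
        also have "\<dots> = (1 / (2 * pi)) * norm ?S"
          unfolding norm_mult norm_of_real by simp
        also have "\<dots> \<le> 1 * norm ?S"
        proof (intro mult_right_mono)
          show "1 / (2 * pi) \<le> 1" using pi_gt3 by simp
        qed simp
        also have "norm ?S \<le> C1 * \<rho> ^ L * (1 / (1 - \<rho>))"
        proof (rule norm_sums_le[OF tail])
          show "(\<lambda>i. C1 * \<rho> ^ L * \<rho> ^ i) sums (C1 * \<rho> ^ L * (1 / (1 - \<rho>)))"
            using \<rho> by (intro sums_mult geometric_sums) simp
          fix i
          have "norm (LINT y|period. ?f x (i + L) y) \<le> (LINT y|period. norm (?f x (i + L) y))"
            by (rule integral_norm_bound)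
          also have "\<dots> \<le> C1 * \<rho> ^ (i + L)" by (rule fL1[OF elim(2)])
          finally show "norm (LINT y|period. ?f x (i + L) y) \<le> C1 * \<rho> ^ L * \<rho> ^ i"
            by (simp add: power_add mult_ac)
        qed
        also have "\<dots> \<le> \<epsilon>"
        proof -
          have "\<rho> * \<rho> ^ L \<le> \<rho> ^ s" using \<rho> by (cases s) (auto simp: L_def)
          then have "\<rho> ^ L \<le> \<rho> ^ s / \<rho>" using \<rho> by (simp add: field_simps)
          then have "C1 / (1 - \<rho>) * \<rho> ^ L \<le> C1 / (1 - \<rho>) * (\<rho> ^ s / \<rho>)"
            using C1 \<rho> by (intro mult_left_mono) auto
          then show ?thesis by (simp add: \<epsilon>_def mult_ac)
        qed
        finally show ?case by simp
      qed
    qed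
    have all: "norm (h x - P x) \<le> \<epsilon>" if "x \<in> {0..2 * pi}" for x
    proof -
      have "continuous_on (cbox 0 (2 * pi)) (\<lambda>x. norm (h x - P x))"
        using hc tpoly_continuous[OF P] by (auto intro!: continuous_intros)
      from AE_le_imp_le_on_cbox[OF this, of \<epsilon> x] ae that show ?thesis unfolding cbox_interval by (simp add: not_le)
    qed
    have \<rho>s: "2 powr (- r * real s) = \<rho> ^ s"
      unfolding \<rho>_def by (simp add: powr_powr powr_realpow[symmetric])
    show "\<forall>x\<in>{0..2 * pi}. norm (h x - vp (2 ^ s) h x) \<le> C * 2 powr (- r * real s)"
    proof
      fix x assume "x \<in> {0..2 * pi}"
      then have "norm (h x - vp (2 ^ s) h x) \<le> 4 * \<epsilon>"
        by (intro vp_near_best[OF _ P all]) auto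
      then show "norm (h x - vp (2 ^ s) h x) \<le> C * 2 powr (- r * real s)"
        unfolding \<rho>s C_def \<epsilon>_def by (simp add: mult.assoc)
    qed
  qed
qed

section \<open>Approximation in several variables\<close>

definition vp_coord :: "nat \<Rightarrow> 'd \<Rightarrow> (real^'d \<Rightarrow> complex) \<Rightarrow> real^'d \<Rightarrow> complex" where
  "vp_coord n j f x = vp n (\<lambda>t. f (upd_coord x j t)) (x $ j)"

text \<open>
  Polynomials in the coordinates of \<open>J\<close>, with frequencies from \<open>freq_box s\<close>, whose coefficients are
  arbitrary functions of the other coordinates. They are the intermediate stages when operators are
  applied to one coordinate after the other.
\<close>

inductive_set partial_trig :: "nat^'d \<Rightarrow> 'd set \<Rightarrow> (real^'d \<Rightarrow> complex) set"
  for s :: "nat^'d" and J :: "'d set" where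
  single: "k \<in> freq_box s \<Longrightarrow> (\<And>j. j \<notin> J \<Longrightarrow> k $ j = 0) \<Longrightarrow>
     (\<And>x j t. j \<in> J \<Longrightarrow> c (upd_coord x j t) = c x) \<Longrightarrow> (\<lambda>x. c x * trig_char k x) \<in> partial_trig s J"
| zero: "(\<lambda>x. 0) \<in> partial_trig s J"
| add: "u \<in> partial_trig s J \<Longrightarrow> v \<in> partial_trig s J \<Longrightarrow> (\<lambda>x. u x + v x) \<in> partial_trig s J"

lemma partial_trig_sum:
  "(\<And>i. i \<in> A \<Longrightarrow> u i \<in> partial_trig s J) \<Longrightarrow> (\<lambda>x. \<Sum>i\<in>A. u i x) \<in> partial_trig s J"
  by (induction A rule: infinite_finite_induct) (auto intro: partial_trig.zero partial_trig.add)

lemma partial_trig_start: "f \<in> partial_trig s {}"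
proof -
  have "(\<lambda>x. f x * trig_char 0 x) \<in> partial_trig s {}"
    by (rule partial_trig.single) (auto simp: freq_box_def)
  then show ?thesis by (simp add: trig_char_def)
qed

lemma partial_trig_end: "u \<in> partial_trig s UNIV \<Longrightarrow> u \<in> trig_polys (freq_box s)"
proof (induction rule: partial_trig.induct)
  case (single k c)
  have "c x = c 0" for x
    using coordinatewise_bound[of x 0 c 0] single.hyps(3) by simp
  then have "(\<lambda>x. c x * trig_char k x) = (\<lambda>x. \<Sum>i\<in>freq_box s. (if i = k then c 0 else 0) * trig_char i x)"
    using single.hyps(1) finite_freq_box[of s] by (simp add: fun_eq_iff if_distrib[of "\<lambda>a. a * _"] cong: if_cong)
  then show ?case unfolding trig_polys_def by (auto intro!: exI[of _ "\<lambda>i. if i = k then c 0 else 0"])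
next
  case zero
  show ?case by (rule zero_in_trig_polys)
next
  case (add u v)
  then show ?case using trig_polys_add_scaled[of u _ v 1] by simp
qed

lemma vp_coord_add: "vp_coord n j (\<lambda>x. u x + v x) x = vp_coord n j u x + vp_coord n j v x"
  by (simp add: vp_coord_def vp_def algebra_simps sum.distrib add_divide_distrib)

lemma trig_char_shift: "trig_char (k + (\<chi> i. if i = j then a else 0)) x = trig_char k x * wave a (x $ j)"
proof -
  have "(\<Sum>i\<in>UNIV. real_of_int ((k + (\<chi> i. if i = j then a else 0)) $ i) * x $ i)
      = (\<Sum>i\<in>UNIV. real_of_int (k $ i) * x $ i + (if i = j then real_of_int a * x $ j else 0))"
    by (intro sum.cong) (auto simp: algebra_simps)
  also have "\<dots> = (\<Sum>i\<in>UNIV. real_of_int (k $ i) * x $ i) + real_of_int a * x $ j"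
    by (simp only: sum.distrib sum.delta finite_class.finite_UNIV UNIV_I if_True)
  finally show ?thesis
    unfolding trig_char_def wave_def cis_conv_exp by (simp only: of_real_add distrib_left exp_add)
qed

text \<open>
  In direction \<open>j\<close> the operator evaluates the coefficients at nodes, which makes them independent of the
  \<open>j\<close>-th coordinate, and multiplies them by the kernel, a polynomial in this coordinate.
\<close>

lemma vp_coord_partial_trig:
  assumes "u \<in> partial_trig s J" "j \<notin> J"
  shows "vp_coord (2 ^ (s $ j)) j u \<in> partial_trig s (insert j J)"
  using assms(1)
proof (induction rule: partial_trig.induct)
  case (single k c)
  define n where "n = (2::nat) ^ (s $ j)"
  have n: "n > 0" by (simp add: n_def)
  let ?I = "{- int (n - 1)..int (n - 1)}"
  have kj: "k $ j = 0" using single.hyps(2) assms(2) by blast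
  have "\<exists>b. \<forall>t. complex_of_real (vp_kernel n (node (2 * n) m - t)) = (\<Sum>a\<in>?I. b a * wave a t)" for m
  proof -
    have "(\<lambda>t. complex_of_real (vp_kernel n (node (2 * n) m - t))) \<in> tpoly (n - 1)"
      by (rule tpoly_reflect[OF tpoly_vp_kernel])
    then show ?thesis unfolding tpoly_def by (auto simp: fun_eq_iff)
  qed
  then obtain b where b: "\<And>m t. complex_of_real (vp_kernel n (node (2 * n) m - t)) = (\<Sum>a\<in>?I. b m a * wave a t)"
    by metis
  have kc: "trig_char k (upd_coord x j t) = trig_char k x" for x t
    using trig_char_upd[of k x j t] trig_char_upd[of k x j "x $ j"] kj by simp
  have "vp_coord n j (\<lambda>x. c x * trig_char k x)
     = (\<lambda>x. \<Sum>m<2 * n. \<Sum>a\<in>?I. (c (upd_coord x j (node (2 * n) m)) * b m a / of_nat (2 * n))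
          * trig_char (k + (\<chi> i. if i = j then a else 0)) x)"
    unfolding vp_coord_def vp_def b kc trig_char_shift
    by (simp add: fun_eq_iff sum_distrib_left sum_divide_distrib mult_ac)
  also have "\<dots> \<in> partial_trig s (insert j J)"
  proof (intro partial_trig_sum partial_trig.single)
    fix m a assume a: "a \<in> ?I"
    show "k + (\<chi> i. if i = j then a else 0) \<in> freq_box s"
      unfolding freq_box_def
    proof (clarify)
      fix i
      have "\<bar>a\<bar> < int n" using a n by auto
      then show "\<bar>(k + (\<chi> i. if i = j then a else 0)) $ i\<bar> < 2 ^ (s $ i)"
        using single.hyps(1) kj by (auto simp: freq_box_def n_def)
    qed
    show "(k + (\<chi> i. if i = j then a else 0)) $ i = 0" if "i \<notin> insert j J" for i
      using that single.hyps(2) by simp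
    show "c (upd_coord (upd_coord x i t) j (node (2 * n) m)) * b m a / of_nat (2 * n)
        = c (upd_coord x j (node (2 * n) m)) * b m a / of_nat (2 * n)" if i: "i \<in> insert j J" for x i t
    proof (cases "i = j")
      case False
      then have "upd_coord (upd_coord x i t) j (node (2 * n) m) = upd_coord (upd_coord x j (node (2 * n) m)) i t"
        by (auto simp: vec_eq_iff)
      then show ?thesis using single.hyps(3) i False by simp
    qed simp
  qed
  finally show ?case unfolding n_def .
next
  case zero
  have "vp_coord (2 ^ (s $ j)) j (\<lambda>x. 0) = (\<lambda>x. 0)" by (simp add: vp_coord_def vp_def fun_eq_iff)
  then show ?case by (simp add: partial_trig.zero)
next
  case (add u v)
  have "vp_coord (2 ^ (s $ j)) j (\<lambda>x. u x + v x) = (\<lambda>x. vp_coord (2 ^ (s $ j)) j u x + vp_coord (2 ^ (s $ j)) j v x)"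
    by (simp add: fun_eq_iff vp_coord_add)
  then show ?case using partial_trig.add[OF add.IH] by simp
qed

lemma vp_coord_diff_bound:
  assumes "n > 0" and b: "\<And>x. x \<in> torus \<Longrightarrow> norm (f x - u x) \<le> B" and "x \<in> torus"
  shows "norm (vp_coord n j f x - vp_coord n j u x) \<le> 3 * B"
  unfolding vp_coord_def vp_diff[symmetric]
  by (intro vp_bound assms upd_coord_torus node_mem)

text \<open>
  Each further coordinate adds its own error and multiplies the accumulated one by the operator norm 3;
  the factor 4 per coordinate covers both.
\<close>

lemma anisotropic_approximation:
  fixes f :: "real^'d \<Rightarrow> complex"
  assumes e: "\<And>j x. x \<in> torus \<Longrightarrow> norm (f x - vp_coord (2 ^ (s $ j)) j f x) \<le> e j"
  shows "\<exists>u\<in>trig_polys (freq_box s). \<forall>x\<in>torus. norm (f x - u x) \<le> 4 ^ CARD('d) * (\<Sum>j\<in>UNIV. e j)"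
proof -
  have e0: "e j \<ge> 0" for j
    using e torus_nonempty by (meson all_not_in_conv norm_ge_zero order_trans)
  have "\<exists>u\<in>partial_trig s J. \<forall>x\<in>torus. norm (f x - u x) \<le> 4 ^ card J * (\<Sum>j\<in>J. e j)" if "finite J" for J
    using that
  proof (induction J)
    case empty
    show ?case by (rule bexI[OF _ partial_trig_start[of f]]) simp
  next
    case (insert j J)
    then obtain u where u: "u \<in> partial_trig s J"
      "\<And>x. x \<in> torus \<Longrightarrow> norm (f x - u x) \<le> 4 ^ card J * (\<Sum>j\<in>J. e j)" by blast
    let ?n = "2 ^ (s $ j) :: nat"
    show ?case
    proof (rule bexI[OF ballI vp_coord_partial_trig[OF u(1) insert.hyps(2)]])
      fix x :: "real^'d" assume x: "x \<in> torus"
      have "norm (f x - vp_coord ?n j u x) \<le> norm (f x - vp_coord ?n j f x) + norm (vp_coord ?n j f x - vp_coord ?n j u x)"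
        using norm_triangle_ineq[of "f x - vp_coord ?n j f x" "vp_coord ?n j f x - vp_coord ?n j u x"] by simp
      also have "\<dots> \<le> e j + 3 * (4 ^ card J * (\<Sum>j\<in>J. e j))"
        by (intro add_mono e x vp_coord_diff_bound u) auto
      also have "\<dots> \<le> 4 ^ card (insert j J) * (\<Sum>j\<in>insert j J. e j)"
      proof -
        have S: "(\<Sum>j\<in>J. e j) \<ge> 0" by (intro sum_nonneg e0)
        have "1 * e j \<le> 4 * 4 ^ card J * e j"
          using e0 one_le_power[of "4::real" "Suc (card J)"] by (intro mult_right_mono) auto
        moreover have "3 * (4 ^ card J * (\<Sum>j\<in>J. e j)) \<le> 4 * 4 ^ card J * (\<Sum>j\<in>J. e j)"
          using S by simp
        moreover have "4 ^ card (insert j J) * (\<Sum>j\<in>insert j J. e j)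
            = 4 * 4 ^ card J * e j + 4 * 4 ^ card J * (\<Sum>j\<in>J. e j)"
          using insert.hyps by (simp add: distrib_left)
        ultimately show ?thesis by linarith
      qed
      finally show "norm (f x - vp_coord ?n j u x) \<le> 4 ^ card (insert j J) * (\<Sum>j\<in>insert j J. e j)" .
    qed
  qed
  from this[of UNIV] show ?thesis using partial_trig_end by auto
qed

section \<open>Periodic functions and Nikol'skii classes\<close>

lemma periodic_shift_int:
  fixes f :: "real^'d \<Rightarrow> complex"
  assumes "periodic f" shows "f (x + axis j (2 * pi * of_int m)) = f x"
proof -
  have nat: "f (x + axis j (2 * pi * real m)) = f x" for x m
  proof (induction m)
    case 0
    have "x + axis j (2 * pi * real 0) = x" by (simp add: axis_def vec_eq_iff)
    then show ?case by (simp only:)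
  next
    case (Suc m)
    have "x + axis j (2 * pi * real (Suc m)) = (x + axis j (2 * pi * real m)) + axis j (2 * pi)"
      by (simp add: axis_def vec_eq_iff algebra_simps)
    then show ?case using assms Suc by (simp only: periodic_def)
  qed
  show ?thesis
  proof (cases "m \<ge> 0")
    case True
    then show ?thesis using nat[of x "nat m"] by simp
  next
    case False
    have "x + axis j (2 * pi * of_int m) + axis j (2 * pi * real (nat (- m))) = x"
      using False by (simp add: axis_def vec_eq_iff)
    then show ?thesis using nat[of "x + axis j (2 * pi * of_int m)" "nat (- m)"] by (simp only:)
  qed
qed

definition lattice_shift :: "int^'d \<Rightarrow> real^'d" where
  "lattice_shift k = (\<chi> j. 2 * pi * of_int (k $ j))"

lemma periodic_lattice:
  fixes f :: "real^'d \<Rightarrow> complex"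
  assumes "periodic f" shows "f (x + lattice_shift k) = f x"
proof -
  have "f (x + (\<chi> j. if j \<in> J then 2 * pi * of_int (k $ j) else 0)) = f x" if "finite J" for J
    using that
  proof (induction J)
    case empty
    have "(\<chi> j. 0) = (0 :: real^'d)" by (simp add: vec_eq_iff)
    then show ?case by simp
  next
    case (insert i J)
    have "x + (\<chi> j. if j \<in> insert i J then 2 * pi * of_int (k $ j) else 0)
        = (x + (\<chi> j. if j \<in> J then 2 * pi * of_int (k $ j) else 0)) + axis i (2 * pi * of_int (k $ i))"
      using insert.hyps by (auto simp: vec_eq_iff axis_def)
    then show ?case using periodic_shift_int[OF assms] insert.IH by (simp only:)
  qed
  from this[of UNIV] show ?thesis by (simp add: lattice_shift_def)
qed

text \<open>
  The bound on \<open>k\<close> makes the cover of space by translates of the torus locally finite.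
\<close>

lemma torus_representative:
  fixes x :: "real^'d"
  shows "\<exists>k. x - lattice_shift k \<in> torus \<and> (\<forall>j. \<bar>of_int (k $ j)\<bar> \<le> \<bar>x $ j\<bar> + 1)"
proof -
  define k :: "int^'d" where "k = (\<chi> j. \<lfloor>x $ j / (2 * pi)\<rfloor>)"
  have b: "of_int (k $ j) \<le> x $ j / (2 * pi)" "x $ j / (2 * pi) < of_int (k $ j) + 1" for j
    unfolding k_def by (simp_all add: floor_correct)
  have "x - lattice_shift k \<in> torus"
    unfolding mem_torus
  proof
    fix j
    show "0 \<le> (x - lattice_shift k) $ j \<and> (x - lattice_shift k) $ j \<le> 2 * pi"
      using b[of j] by (simp add: lattice_shift_def field_simps)
  qed
  moreover have "\<bar>of_int (k $ j)\<bar> \<le> \<bar>x $ j\<bar> + 1" for j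
  proof -
    have "\<bar>x $ j / (2 * pi)\<bar> \<le> \<bar>x $ j\<bar>"
      using pi_gt3 by (simp add: divide_le_eq mult_le_cancel_left1)
    then show ?thesis using b[of j] by linarith
  qed
  ultimately show ?thesis by blast
qed

text \<open>
  Every ball is covered by finitely many lattice translates of the torus. These are closed and \<open>f\<close> is
  continuous on each of them.
\<close>

lemma periodic_continuous:
  fixes f :: "real^'d \<Rightarrow> complex"
  assumes per: "periodic f" and cont: "continuous_on torus f"
  shows "continuous_on UNIV f"
proof -
  have "isCont f x" for x
  proof -
    define R where "R = norm x + 1"
    define K where "K = {k :: int^'d. \<forall>j. k $ j \<in> {- \<lceil>R + 1\<rceil>..\<lceil>R + 1\<rceil>}}"
    define T where "T k = (\<lambda>y. y - lattice_shift k) -` torus" for k :: "int^'d"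
    have T: "closed (T k)" for k
      unfolding T_def torus_def by (intro closed_vimage continuous_intros closed_cbox)
    have cT: "continuous_on (T k) f" for k
    proof -
      have "continuous_on (T k) (\<lambda>y. f (y - lattice_shift k))"
        by (rule continuous_on_compose2[OF cont]) (auto simp: T_def intro!: continuous_intros)
      moreover have "f (y - lattice_shift k) = f y" for y
        using periodic_lattice[OF per, of "y - lattice_shift k" k] by simp
      ultimately show ?thesis by simp
    qed
    have "finite K" unfolding K_def by (rule finite_vec_of_finite) simp
    then have "continuous_on (\<Union>k\<in>K. T k) f" by (intro continuous_on_closed_Union T cT)
    moreover have "ball 0 R \<subseteq> (\<Union>k\<in>K. T k)"
    proof
      fix y :: "real^'d" assume y: "y \<in> ball 0 R"
      obtain k where k: "y - lattice_shift k \<in> torus" "\<And>j. \<bar>of_int (k $ j)\<bar> \<le> \<bar>y $ j\<bar> + 1"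
        using torus_representative by blast
      have "k \<in> K" unfolding K_def
      proof (clarify)
        fix j
        have "\<bar>y $ j\<bar> \<le> R" using y component_le_norm_cart[of y j] by simp
        then have "\<bar>of_int (k $ j)\<bar> \<le> R + 1" using k(2)[of j] by linarith
        then show "k $ j \<in> {- \<lceil>R + 1\<rceil>..\<lceil>R + 1\<rceil>}" by (auto simp: abs_le_iff) linarith+
      qed
      with k(1) show "y \<in> (\<Union>k\<in>K. T k)" by (auto simp: T_def)
    qed
    ultimately have "continuous_on (ball 0 R) f" by (rule continuous_on_subset)
    moreover have "x \<in> ball 0 R" by (simp add: R_def)
    ultimately show ?thesis using continuous_on_eq_continuous_at[OF open_ball] by blast
  qed
  then show ?thesis by (simp add: continuous_at_imp_continuous_on)
qed

lemma diff_op_slice: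
  "(diff_op \<delta> j ^^ l) f (upd_coord x j t) = (forward_diff \<delta> ^^ l) (\<lambda>t. f (upd_coord x j t)) t"
proof (induction l arbitrary: t)
  case (Suc l)
  have "upd_coord x j t + axis j \<delta> = upd_coord x j (t + \<delta>)" by (auto simp: vec_eq_iff axis_def)
  then show ?case using Suc[of t] Suc[of "t + \<delta>"] by (simp add: diff_op_def forward_diff_def)
qed simp

lemma diff_op_power:
  fixes f :: "real^'d \<Rightarrow> complex"
  assumes "periodic f" "continuous_on UNIV f"
  shows "periodic ((diff_op \<delta> j ^^ l) f) \<and> continuous_on UNIV ((diff_op \<delta> j ^^ l) f)"
proof (induction l)
  case (Suc l)
  let ?g = "(diff_op \<delta> j ^^ l) f"
  have "periodic (diff_op \<delta> j ?g)"
    unfolding periodic_def diff_op_def[of _ _ ?g]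
  proof (intro allI)
    fix i and x :: "real^'d"
    have "?g (x + axis i (2 * pi) + axis j \<delta>) = ?g (x + axis j \<delta>)"
      using Suc unfolding periodic_def by (metis add.assoc add.commute)
    then show "?g (x + axis i (2 * pi) + axis j \<delta>) - ?g (x + axis i (2 * pi)) = ?g (x + axis j \<delta>) - ?g x"
      using Suc unfolding periodic_def by simp
  qed
  moreover have "continuous_on UNIV (diff_op \<delta> j ?g)"
  proof -
    have "continuous_on UNIV (\<lambda>x. ?g (x + axis j \<delta>))"
      by (rule continuous_on_compose2[of UNIV ?g]) (use Suc in \<open>auto intro!: continuous_intros\<close>)
    then show ?thesis unfolding diff_op_def[of _ _ ?g] by (intro continuous_on_diff) (use Suc in auto)
  qed
  ultimately show ?case by simp
qed (use assms in simp)

lemma continuous_upd_coord: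
  assumes "continuous_on S a" "continuous_on S b"
  shows "continuous_on S (\<lambda>z. upd_coord (a z) j (b z))"
  unfolding upd_coord_def
proof (rule continuous_on_vec_lambda)
  show "continuous_on S (\<lambda>z. if i = j then b z else a z $ i)" for i
    by (cases "i = j") (use assms in \<open>auto intro!: continuous_on_component\<close>)
qed

lemma torus_AE_le:
  assumes "continuous_on torus F" "AE x in lebesgue_on torus. norm (F x) \<le> c" "x \<in> torus"
  shows "norm (F x) \<le> c"
proof (rule AE_le_imp_le_on_cbox[where F = "\<lambda>x. norm (F x)" and a = 0 and b = "\<chi> j. 2 * pi"])
  show "box 0 (\<chi> j. 2 * pi :: real^'a) \<noteq> {}"
    by (simp add: interval_eq_empty_cart not_le)
qed (use assms[unfolded torus_def] in \<open>auto intro!: continuous_intros\<close>)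

text \<open>
  The differences of \<open>f\<close> are continuous and periodic, so their bounds hold at every point, and on each line
  parallel to the \<open>j\<close>-th axis the univariate estimate applies.
\<close>

lemma H_class_rate:
  assumes "\<rho> > 0"
  shows "\<exists>C>0. \<forall>(f :: real^'d \<Rightarrow> complex) r j. f \<in> H_class r \<longrightarrow> continuous_on torus f \<longrightarrow> r $ j = \<rho> \<longrightarrow>
     (\<forall>s. \<forall>x\<in>torus. norm (f x - vp_coord (2 ^ s) j f x) \<le> C * 2 powr (- \<rho> * real s))"
proof -
  obtain C where C: "C > 0" and N: "\<And>f s x. continuous_on UNIV f \<Longrightarrow> (\<forall>x. f (x + 2 * pi) = f x) \<Longrightarrow>
     (\<forall>\<delta> x. norm ((forward_diff \<delta> ^^ (nat \<lfloor>\<rho>\<rfloor> + 1)) f x) \<le> \<bar>\<delta>\<bar> powr \<rho>) \<Longrightarrow> 0 \<le> x \<Longrightarrow>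
     norm (f x - vp (2 ^ s) f x) \<le> C * 2 powr (- \<rho> * real s)"
    using nikolskii_vp_rate[OF assms] by metis
  show ?thesis
  proof (intro exI[of _ C] conjI C allI impI ballI)
    fix f :: "real^'d \<Rightarrow> complex" and r j s and x :: "real^'d"
    assume f: "f \<in> H_class r" and cont: "continuous_on torus f" and r: "r $ j = \<rho>" and x: "x \<in> torus"
    let ?l = "nat \<lfloor>\<rho>\<rfloor> + 1"
    have per: "periodic f" using f by (simp add: H_class_def)
    have fc: "continuous_on UNIV f" by (rule periodic_continuous[OF per cont])
    have D: "norm ((diff_op \<delta> j ^^ ?l) f y) \<le> \<bar>\<delta>\<bar> powr \<rho>" for \<delta> y
    proof -
      let ?g = "(diff_op \<delta> j ^^ ?l) f"
      have g: "periodic ?g" "continuous_on UNIV ?g" using diff_op_power[OF per fc] by blast+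
      obtain k where k: "y - lattice_shift k \<in> torus" using torus_representative by blast
      have "Linf_le ?g (\<bar>\<delta>\<bar> powr \<rho>)" using f unfolding H_class_def r[symmetric] by blast
      then have "AE z in lebesgue_on torus. norm (?g z) \<le> \<bar>\<delta>\<bar> powr \<rho>"
        by (simp only: Linf_le_def)
      then have "norm (?g (y - lattice_shift k)) \<le> \<bar>\<delta>\<bar> powr \<rho>"
        using g(2) k by (intro torus_AE_le) (auto intro: continuous_on_subset)
      moreover have "?g (y - lattice_shift k) = ?g y"
        using periodic_lattice[OF g(1), of "y - lattice_shift k" k] by simp
      ultimately show ?thesis by simp
    qed
    let ?h = "\<lambda>t. f (upd_coord x j t)"
    have "norm (?h (x $ j) - vp (2 ^ s) ?h (x $ j)) \<le> C * 2 powr (- \<rho> * real s)"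
    proof (rule N)
      show "continuous_on UNIV ?h"
        by (rule continuous_on_compose2[OF fc continuous_upd_coord]) auto
      show "\<forall>t. ?h (t + 2 * pi) = ?h t"
      proof
        fix t
        have "upd_coord x j (t + 2 * pi) = upd_coord x j t + axis j (2 * pi)" by (auto simp: vec_eq_iff axis_def)
        then show "?h (t + 2 * pi) = ?h t" using per by (simp add: periodic_def)
      qed
      show "\<forall>\<delta> t. norm ((forward_diff \<delta> ^^ ?l) ?h t) \<le> \<bar>\<delta>\<bar> powr \<rho>"
        unfolding diff_op_slice[symmetric] using D by blast
      show "0 \<le> x $ j" using x by (simp add: mem_torus)
    qed
    then show "norm (f x - vp_coord (2 ^ s) j f x) \<le> C * 2 powr (- \<rho> * real s)"
      by (simp add: vp_coord_def)
  qed
qed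

section \<open>Sobolev classes\<close>

text \<open>
  For fixed \<open>t\<close> the translate of \<open>E\<close> by \<open>t\<close> along the \<open>j\<close>-th axis is a null set. Fubini's theorem exchanges the two
  quantifiers: for almost every \<open>x\<close> the line through \<open>x\<close> meets \<open>E\<close> in a null set.
\<close>

lemma AE_slices:
  fixes E :: "(real^'d) set"
  assumes E: "E \<in> null_sets lborel"
  shows "AE x in lebesgue. negligible {y. upd_coord x j y \<in> E}"
proof -

  let ?P = "\<lambda>(x :: real^'d) t. x + axis j t \<notin> E"
  have Eb: "E \<in> sets borel" using E by (auto dest: null_setsD2)
  have cont: "continuous_on UNIV (\<lambda>z :: (real^'d) \<times> real. fst z + axis j (snd z))"
  proof -
    have eq: "fst z + axis j (snd z) = upd_coord (fst z) j (fst z $ j + snd z)" for z :: "(real^'d) \<times> real"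
      by (auto simp: vec_eq_iff axis_def)
    show ?thesis unfolding eq
      by (intro continuous_upd_coord continuous_on_add continuous_on_component continuous_on_fst continuous_on_snd continuous_on_id)
  qed
  have "(\<lambda>z :: (real^'d) \<times> real. fst z + axis j (snd z)) \<in> borel_measurable (lborel \<Otimes>\<^sub>M lborel)"
    using borel_measurable_continuous_onI[OF cont] by (simp add: borel_prod[symmetric] cong: measurable_cong_sets)
  then have meas: "{z \<in> space (lborel \<Otimes>\<^sub>M lborel). ?P (fst z) (snd z)} \<in> sets (lborel \<Otimes>\<^sub>M lborel)"
    using Eb by measurable
  have negE: "negligible E" using E by (simp add: negligible_iff_null_sets null_sets_completionI)
  have "AE x in lborel. ?P x t" for t
  proof -
    have "negligible ((+) (- axis j t) ` E)" by (rule negligible_translation[OF negE])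
    then have "AE x in lebesgue. x \<notin> (+) (- axis j t) ` E"
      by (intro AE_not_in) (simp add: negligible_iff_null_sets)
    moreover have "x \<notin> (+) (- axis j t) ` E \<longleftrightarrow> ?P x t" for x
      by (auto simp: image_iff algebra_simps)
    ultimately show ?thesis by (simp add: AE_completion_iff)
  qed
  then have "AE t in lborel. AE x in lborel. ?P x t" by simp
  then have "AE x in lborel. AE t in lborel. ?P x t" using lborel_pair.AE_commute[OF meas] by simp
  then have "AE x in lebesgue. AE t in lborel. ?P x t" by (rule AE_completion)
  then show ?thesis
  proof eventually_elim
    case (elim x)
    then have "AE t in lebesgue. ?P x t" by (rule AE_completion)
    then have "{t. \<not> ?P x t} \<in> null_sets lebesgue" by (simp add: completion.AE_iff_null_sets)
    then have "negligible {t. x + axis j t \<in> E}" by (simp add: negligible_iff_null_sets)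
    then have "negligible ((+) (x $ j) ` {t. x + axis j t \<in> E})" by (rule negligible_translation)
    moreover have "{y. upd_coord x j y \<in> E} = (+) (x $ j) ` {t. x + axis j t \<in> E}"
    proof -
      have eq: "upd_coord x j y = x + axis j (y - x $ j)" for y by (auto simp: vec_eq_iff axis_def)
      show ?thesis unfolding eq
        by (auto simp: image_iff intro!: exI[of _ "_ - x $ j"])
    qed
    ultimately show ?case by simp
  qed
qed

lemma measurable_lebesgue_on_AE:
  fixes f h :: "'a::euclidean_space \<Rightarrow> 'b::euclidean_space"
  assumes h: "h \<in> borel_measurable (lebesgue_on S)" and ae: "AE x in lebesgue_on S. f x = h x" and S: "S \<in> sets lebesgue"
  shows "f \<in> borel_measurable (lebesgue_on S)"
proof -
  obtain N where N: "{x \<in> space (lebesgue_on S). f x \<noteq> h x} \<subseteq> N" "N \<in> null_sets (lebesgue_on S)"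
    using AE_E[OF ae] by (metis null_setsI)
  have "h \<in> borel_measurable (lebesgue_on (S - N))" using h borel_measurable_diff_null[OF N(2) S] by blast
  then have "f \<in> borel_measurable (lebesgue_on (S - N))"
    by (rule measurable_cong[THEN iffD1, rotated]) (use N(1) in auto)
  then show ?thesis using borel_measurable_diff_null[OF N(2) S] by blast
qed

text \<open>
  Slices of Lebesgue measurable functions need not be measurable, but slices of Borel functions are.
\<close>

lemma lebesgue_measurable_borel_version:
  fixes \<phi> :: "real^'d \<Rightarrow> complex"
  assumes "\<phi> \<in> borel_measurable (lebesgue_on torus)"
  shows "\<exists>\<phi>'\<in>borel_measurable borel. AE x in lebesgue. x \<in> torus \<longrightarrow> \<phi> x = \<phi>' x"
proof -
  define \<phi>0 where "\<phi>0 x = (if x \<in> torus then \<phi> x else 0)" for x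
  have T: "torus \<in> sets (lebesgue :: (real^'d) measure)" by (simp add: torus_def)
  have "\<phi>0 \<in> borel_measurable lebesgue"
    unfolding \<phi>0_def using assms borel_measurable_if[OF T, of \<phi>] by simp
  then have "(\<lambda>x. Re (\<phi>0 x)) \<in> borel_measurable lebesgue" "(\<lambda>x. Im (\<phi>0 x)) \<in> borel_measurable lebesgue"
    by measurable
  then obtain a b where a: "a \<in> borel_measurable lborel" "AE x in lborel. Re (\<phi>0 x) = a x"
    and b: "b \<in> borel_measurable lborel" "AE x in lborel. Im (\<phi>0 x) = b x"
    by (blast dest!: completion_ex_borel_measurable_real)
  have "(\<lambda>x. Complex (a x) (b x)) \<in> borel_measurable borel"
    using a(1) b(1) by (simp add: Complex_eq)
  moreover have "AE x in lborel. x \<in> torus \<longrightarrow> \<phi> x = Complex (a x) (b x)"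
    using a(2) b(2) by eventually_elim (auto simp: complex_eq_iff \<phi>0_def)
  ultimately show ?thesis by (intro bexI[of _ "\<lambda>x. Complex (a x) (b x)"] AE_completion)
qed

text \<open>
  On almost every line parallel to the \<open>j\<close>-th axis the integral representation and the bound on \<open>\<phi>\<close> hold
  almost everywhere, so \<open>convolution_rate\<close> applies. The operator itself is defined by values on a null
  set, therefore the estimate is first derived on these lines and then extended by continuity.
\<close>

lemma W_class_rate:
  assumes "\<rho> > 0"
  shows "\<exists>C>0. \<forall>(f :: real^'d \<Rightarrow> complex) r \<alpha> j. f \<in> W_class r \<alpha> \<longrightarrow> continuous_on torus f \<longrightarrow> r $ j = \<rho> \<longrightarrow>
     (\<forall>s. \<forall>x\<in>torus. norm (f x - vp_coord (2 ^ s) j f x) \<le> C * 2 powr (- \<rho> * real s))"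
proof -
  obtain C where C: "C > 0" and N: "\<And>\<alpha> \<psi> h s x. \<psi> \<in> borel_measurable period \<Longrightarrow> (AE y in period. norm (\<psi> y :: complex) \<le> 1) \<Longrightarrow>
     continuous_on {0..2 * pi} h \<Longrightarrow>
     (AE x in period. h x = of_real (1 / (2 * pi)) * (LINT y|period. \<psi> y * of_real (bernoulli_kernel \<rho> (x - y) \<alpha>))) \<Longrightarrow>
     x \<in> {0..2 * pi} \<Longrightarrow> norm (h x - vp (2 ^ s) h x) \<le> C * 2 powr (- \<rho> * real s)"
    using convolution_rate[OF assms] by blast
  show ?thesis
  proof (intro exI[of _ C] conjI C allI impI ballI)
    fix f :: "real^'d \<Rightarrow> complex" and r \<alpha> j s and x0 :: "real^'d"
    assume f: "f \<in> W_class r \<alpha>" and cont: "continuous_on torus f" and r: "r $ j = \<rho>" and x0: "x0 \<in> torus"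
    let ?rep = "\<lambda>\<phi> x. complex_of_real (1 / (2 * pi)) * (LINT y|period.
          \<phi> (upd_coord x j y) * complex_of_real (bernoulli_kernel \<rho> (x $ j - y) (\<alpha> $ j)))"
    obtain \<phi> where \<phi>: "Linf_le \<phi> 1" and rep: "AE x in lebesgue_on torus. f x = ?rep \<phi> x"
      using f r unfolding W_class_def by blast
    have T: "torus \<in> sets (lebesgue :: (real^'d) measure)" by (simp add: torus_def)
    obtain \<phi>' where \<phi>': "\<phi>' \<in> borel_measurable borel" "AE x in lebesgue. x \<in> torus \<longrightarrow> \<phi> x = \<phi>' x"
      using lebesgue_measurable_borel_version \<phi> unfolding Linf_le_def by blast
    have "AE x in lebesgue. x \<in> torus \<longrightarrow> f x = ?rep \<phi> x"
      using rep T by (simp add: AE_restrict_space_iff)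
    moreover have "AE x in lebesgue. x \<in> torus \<longrightarrow> norm (\<phi> x) \<le> 1"
      using \<phi> T by (simp add: AE_restrict_space_iff Linf_le_def)
    ultimately have "AE x in lebesgue. x \<in> torus \<longrightarrow> f x = ?rep \<phi> x \<and> norm (\<phi> x) \<le> 1 \<and> \<phi> x = \<phi>' x"
      using \<phi>'(2) by eventually_elim blast
    then have "AE x in lborel. x \<in> torus \<longrightarrow> f x = ?rep \<phi> x \<and> norm (\<phi> x) \<le> 1 \<and> \<phi> x = \<phi>' x"
      by (simp only: AE_completion_iff)
    then obtain E where E: "\<And>x. x \<in> space lborel - E \<Longrightarrow>
        x \<in> torus \<longrightarrow> f x = ?rep \<phi> x \<and> norm (\<phi> x) \<le> 1 \<and> \<phi> x = \<phi>' x" "E \<in> null_sets lborel"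
      by (erule AE_E3)
    have good: "f x = ?rep \<phi> x \<and> norm (\<phi> x) \<le> 1 \<and> \<phi> x = \<phi>' x" if "x \<in> torus" "x \<notin> E" for x
    proof -
      have "x \<in> space lborel - E" using that by simp
      from E(1)[OF this] that(1) show ?thesis by blast
    qed
    let ?F = "\<lambda>x. f x - vp_coord (2 ^ s) j f x"
    have "AE x in lebesgue. x \<in> torus \<longrightarrow> norm (?F x) \<le> C * 2 powr (- \<rho> * real s)"
      using AE_slices[OF E(2), of j]
    proof eventually_elim
      case (elim x)
      show ?case
      proof
        assume x: "x \<in> torus"
        have sl: "upd_coord x j y \<in> torus" if "y \<in> {0..2 * pi}" for y by (rule upd_coord_torus[OF x that])
        have "AE y in lebesgue. y \<notin> {y. upd_coord x j y \<in> E}"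
          using elim by (intro AE_not_in) (simp add: negligible_iff_null_sets)
        then have ae: "AE y in period. upd_coord x j y \<notin> E"
          by (subst AE_restrict_space_iff) auto
        let ?h = "\<lambda>t. f (upd_coord x j t)" and ?\<psi> = "\<lambda>t. \<phi> (upd_coord x j t)"
        have cu: "continuous_on S (upd_coord x j)" for S
          by (intro continuous_upd_coord continuous_on_const continuous_on_id)
        have "norm (?h (x $ j) - vp (2 ^ s) ?h (x $ j)) \<le> C * 2 powr (- \<rho> * real s)"
        proof (rule N)
          have "(\<lambda>t. \<phi>' (upd_coord x j t)) \<in> borel_measurable borel"
            using \<phi>'(1) borel_measurable_continuous_onI[OF cu] by measurable
          then have "(\<lambda>t. \<phi>' (upd_coord x j t)) \<in> borel_measurable period" by (rule borel_measurable_period)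
          moreover have "AE y in period. ?\<psi> y = \<phi>' (upd_coord x j y)"
            using ae by (rule lebesgue_on_mono) (use good sl in blast)
          ultimately show "?\<psi> \<in> borel_measurable period" by (rule measurable_lebesgue_on_AE) simp
          show "AE y in period. norm (?\<psi> y) \<le> 1"
            using ae by (rule lebesgue_on_mono) (use good sl in blast)
          show "continuous_on {0..2 * pi} ?h"
            by (rule continuous_on_compose2[OF cont cu]) (use sl in auto)
          show "AE t in period. ?h t = of_real (1 / (2 * pi)) * (LINT y|period. ?\<psi> y * of_real (bernoulli_kernel \<rho> (t - y) (\<alpha> $ j)))"
            using ae
          proof (rule lebesgue_on_mono)
            fix t assume "upd_coord x j t \<notin> E" "t \<in> {0..2 * pi}"
            then have "f (upd_coord x j t) = ?rep \<phi> (upd_coord x j t)" using good sl by blast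
            then show "?h t = of_real (1 / (2 * pi)) * (LINT y|period. ?\<psi> y * of_real (bernoulli_kernel \<rho> (t - y) (\<alpha> $ j)))"
              by simp
          qed
          show "x $ j \<in> {0..2 * pi}" using x by (simp add: mem_torus)
        qed
        then show "norm (?F x) \<le> C * 2 powr (- \<rho> * real s)" by (simp add: vp_coord_def)
      qed
    qed
    then have "AE x in lebesgue_on torus. norm (?F x) \<le> C * 2 powr (- \<rho> * real s)"
      using T by (simp add: AE_restrict_space_iff)
    moreover have "continuous_on torus ?F"
    proof -
      have "continuous_on torus (\<lambda>x. f (upd_coord x j (node M m)))" if "m < M" for m M
        by (rule continuous_on_compose2[OF cont continuous_upd_coord])
           (use that node_mem in \<open>auto intro!: continuous_intros upd_coord_torus\<close>)
      moreover have "continuous_on torus (\<lambda>x :: real^'d. complex_of_real (vp_kernel n (node M m - x $ j)))" for n M m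
        by (rule continuous_on_compose2[OF tpoly_continuous[OF tpoly_vp_kernel, of UNIV]])
           (auto intro!: continuous_intros continuous_on_component)
      ultimately have "continuous_on torus (vp_coord n j f)" for n
        unfolding vp_coord_def[abs_def] vp_def
        by (cases "n = 0") (auto intro!: continuous_intros)
      then show ?thesis by (intro continuous_on_diff cont)
    qed
    ultimately show "norm (?F x0) \<le> C * 2 powr (- \<rho> * real s)" using x0 by (intro torus_AE_le)
  qed
qed

section \<open>Recovery from the sample points\<close>

text \<open>
  If \<open>u\<close> approximates \<open>f\<close> uniformly up to \<open>\<epsilon>\<close>, the discrete minimizer \<open>v\<close> deviates from \<open>f\<close> on \<open>\<xi>\<close> by at most \<open>\<epsilon>\<close>
  as well. So \<open>u - v\<close> is at most \<open>2 * \<epsilon>\<close> on \<open>\<xi>\<close>, and the discretization property bounds it everywhere.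
  The choice of the best subspace can only improve on the one that contains \<open>u\<close>.
\<close>

lemma ell_near_best:
  fixes \<xi> :: "(real^'d) set"
  assumes \<xi>: "finite \<xi>" "\<xi> \<noteq> {}" "\<xi> \<subseteq> torus" and ud: "universal_discretization \<xi> D (H_coll n)" and D: "D \<ge> 0"
    and ell: "is_ell \<xi> (H_coll n) ell" and cont: "continuous_on torus f"
    and s: "(\<Sum>j\<in>UNIV. s $ j) = n" and u: "u \<in> trig_polys (freq_box s)"
    and e: "\<And>x. x \<in> torus \<Longrightarrow> norm (f x - u x) \<le> \<epsilon>"
  shows "sup_norm (\<lambda>x. f x - ell f x) \<le> (1 + 2 * D) * \<epsilon>"
proof -
  define Y where "Y = trig_polys (freq_box s)"
  have Y: "Y \<in> H_coll n" unfolding H_coll_def Y_def using s by blast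
  obtain L where L: "is_ell_choice \<xi> (H_coll n) L"
    and best: "\<exists>Y. is_arg_min (\<lambda>Y. sup_norm (\<lambda>x. f x - L Y f x)) (\<lambda>Y. Y \<in> H_coll n) Y \<and> ell f = L Y f"
    using ell cont unfolding is_ell_def by blast
  have "sup_norm (\<lambda>x. f x - ell f x) \<le> sup_norm (\<lambda>x. f x - L Y f x)"
    using best Y by (auto simp: is_arg_min_linorder)
  also have "\<dots> \<le> (1 + 2 * D) * \<epsilon>"
  proof (rule sup_norm_le)
    fix x :: "real^'d" assume x: "x \<in> torus"
    let ?v = "L Y f"
    have arg: "is_arg_min (\<lambda>u. discr_norm \<xi> (\<lambda>x. f x - u x)) (\<lambda>u. u \<in> Y) ?v"
      using L Y cont unfolding is_ell_choice_def by blast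
    then have v: "?v \<in> Y" and vmin: "discr_norm \<xi> (\<lambda>x. f x - ?v x) \<le> discr_norm \<xi> (\<lambda>x. f x - u x)"
      using u by (auto simp: is_arg_min_linorder Y_def)
    have fu: "discr_norm \<xi> (\<lambda>x. f x - u x) \<le> \<epsilon>"
      unfolding discr_norm_le_iff[OF \<xi>(1,2)] using e \<xi>(3) by blast
    let ?w = "\<lambda>x. u x + (- 1) * ?v x"
    have w: "?w \<in> trig_polys (freq_box s)" using trig_polys_add_scaled[OF u] v by (simp only: Y_def)
    have "norm (?w y) \<le> 2 * \<epsilon>" if "y \<in> \<xi>" for y
    proof -
      have "norm (f y - ?v y) \<le> \<epsilon>"
        using norm_le_discr_norm[OF \<xi>(1) that, of "\<lambda>x. f x - ?v x"] vmin fu by simp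
      moreover have "norm (f y - u y) \<le> \<epsilon>" using e \<xi>(3) that by blast
      ultimately show ?thesis
        using norm_triangle_ineq4[of "f y - ?v y" "f y - u y"] by simp
    qed
    then have "discr_norm \<xi> ?w \<le> 2 * \<epsilon>" unfolding discr_norm_le_iff[OF \<xi>(1,2)] by blast
    moreover have "sup_norm ?w \<le> D * discr_norm \<xi> ?w"
      using ud w Y unfolding universal_discretization_def Y_def by blast
    ultimately have "sup_norm ?w \<le> D * (2 * \<epsilon>)" using mult_left_mono[OF _ D] order_trans by blast
    moreover have "norm (?w x) \<le> sup_norm ?w" by (rule norm_le_sup_norm[OF continuous_trig_poly[OF w] x])
    ultimately have "norm (u x - ?v x) \<le> D * (2 * \<epsilon>)" by simp
    then show "norm (f x - ?v x) \<le> (1 + 2 * D) * \<epsilon>"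
      using e[OF x] norm_triangle_ineq[of "f x - u x" "u x - ?v x"] by (simp add: algebra_simps)
  qed
  finally show ?thesis .
qed

text \<open>
  The real numbers \<open>g r * n / r $ j\<close> sum to \<open>n\<close> and equalize the errors \<open>2 powr (- r $ j * s $ j)\<close>. They are
  rounded down, and the deficit is given to one coordinate.
\<close>

lemma balanced_exponents:
  fixes r :: "real^'d"
  assumes r: "\<And>j. r $ j > 0"
  shows "\<exists>s :: nat^'d. (\<Sum>j\<in>UNIV. s $ j) = n \<and> (\<forall>j. g r * real n - r $ j \<le> r $ j * real (s $ j))"
proof -
  define \<sigma> where "\<sigma> j = g r * real n / r $ j" for j
  have S: "(\<Sum>j\<in>UNIV. 1 / r $ j) > 0" using r by (intro sum_pos) auto
  then have g: "g r > 0" by (simp add: g_def)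
  have \<sigma>: "\<sigma> j \<ge> 0" for j using g r[of j] by (simp add: \<sigma>_def)
  have "(\<Sum>j\<in>UNIV. \<sigma> j) = g r * real n * (\<Sum>j\<in>UNIV. 1 / r $ j)"
    by (simp add: \<sigma>_def sum_distrib_left)
  also have "\<dots> = real n" using S by (simp add: g_def)
  finally have sum: "(\<Sum>j\<in>UNIV. \<sigma> j) = real n" .
  \<comment> \<open>an arbitrary coordinate that receives the deficit\<close>
  define i :: 'd where "i = undefined"
  define m where "m j = nat \<lfloor>\<sigma> j\<rfloor>" for j
  have m: "real (m j) \<le> \<sigma> j" "\<sigma> j \<le> real (m j) + 1" for j
    unfolding m_def using \<sigma>[of j] by linarith+
  have "real (\<Sum>j\<in>UNIV. m j) \<le> (\<Sum>j\<in>UNIV. \<sigma> j)" by (simp add: sum_mono m)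
  then have le: "(\<Sum>j\<in>UNIV. m j) \<le> n" unfolding sum by (simp only: of_nat_le_iff)
  define s :: "nat^'d" where "s = (\<chi> j. m j + (if j = i then n - (\<Sum>j\<in>UNIV. m j) else 0))"
  have "(\<Sum>j\<in>UNIV. s $ j) = n" using le by (simp add: s_def sum.distrib)
  moreover have "g r * real n - r $ j \<le> r $ j * real (s $ j)" for j
  proof -
    have "g r * real n = r $ j * \<sigma> j" using r[of j] by (simp add: \<sigma>_def)
    also have "\<dots> \<le> r $ j * (real (m j) + 1)" using r[of j] m(2) by (intro mult_left_mono) auto
    also have "\<dots> \<le> r $ j * (real (s $ j) + 1)" using r[of j] by (intro mult_left_mono) (auto simp: s_def)
    finally show ?thesis by (simp add: distrib_left)
  qed
  ultimately show ?thesis by blast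
qed

theorem proposition3p2:
  shows "\<exists>(C::real) (D::real) (Cr :: real^'d \<Rightarrow> real).
    C > 0 \<and> D \<ge> 1 \<and> (\<forall>r. (\<forall>j. r $ j > 0) \<longrightarrow> Cr r > 0) \<and>
    (\<forall>n\<ge>1. \<exists>\<xi> :: (real^'d) set.
       finite \<xi> \<and> \<xi> \<noteq> {} \<and> \<xi> \<subseteq> torus \<and> real (card \<xi>) \<le> C * 2 ^ n \<and>
       universal_discretization \<xi> D (H_coll n) \<and>
       (\<forall>ell. is_ell \<xi> (H_coll n) ell \<longrightarrow>
         (\<forall>r. (\<forall>j. r $ j > 0) \<longrightarrow>
           (\<forall>f. continuous_on torus f \<and> ((\<exists>\<alpha>. f \<in> W_class r \<alpha>) \<or> f \<in> H_class r) \<longrightarrow>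
             sup_norm (\<lambda>x. f x - ell f x) \<le> Cr r * 2 powr (- g r * real n)))))"
proof -
  obtain C :: nat where C: "C > 0" and pts: "\<And>n. \<exists>\<xi> :: (real^'d) set. finite \<xi> \<and> \<xi> \<noteq> {} \<and> \<xi> \<subseteq> torus \<and>
     card \<xi> \<le> C * 2 ^ n \<and> universal_discretization \<xi> 2 (H_coll n)"
    using universal_discretization_exists by blast
  have "\<exists>K>0. \<forall>(f :: real^'d \<Rightarrow> complex) r j.
     continuous_on torus f \<and> ((\<exists>\<alpha>. f \<in> W_class r \<alpha>) \<or> f \<in> H_class r) \<longrightarrow> r $ j = \<rho> \<longrightarrow>
     (\<forall>s. \<forall>x\<in>torus. norm (f x - vp_coord (2 ^ s) j f x) \<le> K * 2 powr (- \<rho> * real s))" if "\<rho> > 0" for \<rho>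
  proof -
    obtain K1 where K1: "K1 > 0" "\<And>(f :: real^'d \<Rightarrow> complex) r \<alpha> j s x. f \<in> W_class r \<alpha> \<Longrightarrow> continuous_on torus f \<Longrightarrow>
       r $ j = \<rho> \<Longrightarrow> x \<in> torus \<Longrightarrow> norm (f x - vp_coord (2 ^ s) j f x) \<le> K1 * 2 powr (- \<rho> * real s)"
      using W_class_rate[OF \<open>\<rho> > 0\<close>] by blast
    obtain K2 where K2: "K2 > 0" "\<And>(f :: real^'d \<Rightarrow> complex) r j s x. f \<in> H_class r \<Longrightarrow> continuous_on torus f \<Longrightarrow>
       r $ j = \<rho> \<Longrightarrow> x \<in> torus \<Longrightarrow> norm (f x - vp_coord (2 ^ s) j f x) \<le> K2 * 2 powr (- \<rho> * real s)"
      using H_class_rate[OF \<open>\<rho> > 0\<close>] by blast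
    have "K1 * 2 powr (- \<rho> * real s) \<le> (K1 + K2) * 2 powr (- \<rho> * real s)"
      "K2 * 2 powr (- \<rho> * real s) \<le> (K1 + K2) * 2 powr (- \<rho> * real s)" for s
      using K1(1) K2(1) by (auto intro!: mult_right_mono)
    note le = this
    show ?thesis
    proof (intro exI[of _ "K1 + K2"] conjI allI impI ballI)
      show "K1 + K2 > 0" using K1(1) K2(1) by simp
      fix f :: "real^'d \<Rightarrow> complex" and r j s and x :: "real^'d"
      assume f: "continuous_on torus f \<and> ((\<exists>\<alpha>. f \<in> W_class r \<alpha>) \<or> f \<in> H_class r)" and r: "r $ j = \<rho>" and x: "x \<in> torus"
      from f consider \<alpha> where "f \<in> W_class r \<alpha>" | "f \<in> H_class r" by blast
      then show "norm (f x - vp_coord (2 ^ s) j f x) \<le> (K1 + K2) * 2 powr (- \<rho> * real s)"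
      proof cases
        case 1
        with f r x show ?thesis by (intro order_trans[OF K1(2) le(1)]) auto
      next
        case 2
        with f r x show ?thesis by (intro order_trans[OF K2(2) le(2)]) auto
      qed
    qed
  qed
  then obtain K where K: "\<And>\<rho>. \<rho> > 0 \<Longrightarrow> K \<rho> > 0"
    and rate: "\<And>\<rho> (f :: real^'d \<Rightarrow> complex) r j s x. \<rho> > 0 \<Longrightarrow>
     continuous_on torus f \<and> ((\<exists>\<alpha>. f \<in> W_class r \<alpha>) \<or> f \<in> H_class r) \<Longrightarrow> r $ j = \<rho> \<Longrightarrow> x \<in> torus \<Longrightarrow>
     norm (f x - vp_coord (2 ^ s) j f x) \<le> K \<rho> * 2 powr (- \<rho> * real s)"
    by metis
  \<comment> \<open>5 from the recovery, \<open>4 ^ CARD('d)\<close> from the coordinatewise means, \<open>2 powr (r $ j)\<close> from rounding the exponents\<close>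
  define Cr :: "real^'d \<Rightarrow> real" where
    "Cr r = 5 * (4 ^ CARD('d) * (\<Sum>j\<in>UNIV. K (r $ j) * 2 powr (r $ j)))" for r
  show ?thesis
  proof (rule exI[of _ "real C"], rule exI[of _ 2], rule exI[of _ Cr], intro conjI allI impI)
    show "real C > 0" using C by simp
    show "Cr r > 0" if "\<forall>j. r $ j > 0" for r
      unfolding Cr_def using that K by (intro mult_pos_pos sum_pos) auto
    fix n :: nat
    obtain \<xi> :: "(real^'d) set" where \<xi>: "finite \<xi>" "\<xi> \<noteq> {}" "\<xi> \<subseteq> torus" "card \<xi> \<le> C * 2 ^ n"
      "universal_discretization \<xi> 2 (H_coll n)"
      using pts by blast
    have "sup_norm (\<lambda>x. f x - ell f x) \<le> Cr r * 2 powr (- g r * real n)"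
      if ell: "is_ell \<xi> (H_coll n) ell" and r: "\<forall>j. r $ j > 0"
        and f: "continuous_on torus f \<and> ((\<exists>\<alpha>. f \<in> W_class r \<alpha>) \<or> f \<in> H_class r)" for ell r f
    proof -
      obtain s :: "nat^'d" where s: "(\<Sum>j\<in>UNIV. s $ j) = n"
        "\<And>j. g r * real n - r $ j \<le> r $ j * real (s $ j)"
        using balanced_exponents[of r n] r by blast
      define e where "e j = K (r $ j) * 2 powr (r $ j) * 2 powr (- g r * real n)" for j
      have "norm (f x - vp_coord (2 ^ (s $ j)) j f x) \<le> e j" if "x \<in> torus" for x j
      proof -
        have "norm (f x - vp_coord (2 ^ (s $ j)) j f x) \<le> K (r $ j) * 2 powr (- (r $ j) * real (s $ j))"
          using r by (intro rate[OF _ f refl that]) auto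
        also have "\<dots> \<le> K (r $ j) * 2 powr (r $ j + - g r * real n)"
          using K r s(2)[of j] by (intro mult_left_mono powr_mono) (auto simp: less_imp_le)
        finally show ?thesis unfolding e_def by (simp only: powr_add mult.assoc)
      qed
      from anisotropic_approximation[where e = e and s = s and f = f, OF this]
      obtain u where u: "u \<in> trig_polys (freq_box s)"
        "\<And>x. x \<in> torus \<Longrightarrow> norm (f x - u x) \<le> 4 ^ CARD('d) * (\<Sum>j\<in>UNIV. e j)" by blast
      have "sup_norm (\<lambda>x. f x - ell f x) \<le> (1 + 2 * 2) * (4 ^ CARD('d) * (\<Sum>j\<in>UNIV. e j))"
        by (rule ell_near_best[OF \<xi>(1,2,3,5) _ ell _ s(1) u]) (use f in auto)
      also have "\<dots> = Cr r * 2 powr (- g r * real n)"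
        by (simp add: Cr_def e_def sum_distrib_right[symmetric])
      finally show ?thesis .
    qed
    moreover have "real (card \<xi>) \<le> real C * 2 ^ n"
    proof -
      have "real (card \<xi>) \<le> real (C * 2 ^ n)" using \<xi>(4) by (simp only: of_nat_le_iff)
      then show ?thesis by simp
    qed
    ultimately show "\<exists>\<xi> :: (real^'d) set.
       finite \<xi> \<and> \<xi> \<noteq> {} \<and> \<xi> \<subseteq> torus \<and> real (card \<xi>) \<le> real C * 2 ^ n \<and>
       universal_discretization \<xi> 2 (H_coll n) \<and>
       (\<forall>ell. is_ell \<xi> (H_coll n) ell \<longrightarrow>
         (\<forall>r. (\<forall>j. r $ j > 0) \<longrightarrow>
           (\<forall>f. continuous_on torus f \<and> ((\<exists>\<alpha>. f \<in> W_class r \<alpha>) \<or> f \<in> H_class r) \<longrightarrow>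
             sup_norm (\<lambda>x. f x - ell f x) \<le> Cr r * 2 powr (- g r * real n))))"
      using \<xi> by (intro exI[of _ \<xi>]) auto
  qed simp
qed

end
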